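(* Let $X=\{x_i \mid i\in\mathbb{N}_0\}$ be a set of variables, let $S_4$ be the symmetric group on $4$ letters, let $\mathbb{F}_4$ be the field with four elements and let $\alpha$ be a primitive element of $\mathbb{F}_4$. The following five decision problems are pairwise polytime-equivalent: (1) ($\textsc{coPolEqv}(S_4)$) Given a word $w\in (S_4\cup X)^*$, decide whether there are an assignment $a\colon X\to S_4$ and $g\in S_4\setminus\{1\}$ such that $w$ evaluates to $g$ under $a$. (2) ($\textsc{PolSat}(S_4)$) Given a word $w\in (S_4\cup X)^*$, decide whether there is an assignment $a\colon X\to S_4$ such that $w$ evaluates to $1$ under $a$. (3) Given $k,n\in\mathbb{N}$ and expanded polynomials $p_1,\dots,p_k\in\mathbb{Z}_3[x_1,\dots,x_n]$, decide whether there exists $\mathbf{y}\in\{-1,1\}^n$ such that $\sum_{i=1}^k \alpha^{p_i(y_1,\dots,y_n)}\neq 0$ (the sum computed in $\mathbb{F}_4$). (4) Given a $\mathrm{CC}[2,3,2]$-circuit $C$, decide whether there is an input vector $x$ such that $C$ does not evaluate to $1$ on input $x$. (5) Given a restricted polynomial expression $f$ over the ring $\mathrm{Mat}_2(\mathbb{Z}_2)$ in variables from $X$, decide whether there is an assignment $a\colon X\to\mathrm{Mat}_2(\mathbb{Z}_2)$ with all $a(x_i)$ invertible such that $f$ does not evaluate to $0$ under $a$.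
   Context: A word $w\in(G\cup X)^*$ over a group $G$ evaluates under an assignment $a\colon X\to G$ to the product in $G$ of its letters, each variable replaced by its value. A decision problem $A$ is polytime-reducible to $B$ if there is a polynomial-time algorithm transforming each input $e$ of $A$ into an input $P(e)$ of $B$ such that $A(e)$ holds iff $B(P(e))$ holds; $A$ and $B$ are polytime-equivalent if each is polytime-reducible to the other. Since $\alpha^3=1$, $\alpha^t$ is well defined for $t\in\mathbb{Z}_3$; the value $p_i(y_1,\dots,y_n)$ is computed in $\mathbb{Z}_3$ with $\pm1$ viewed as elements of $\mathbb{Z}_3$. A polynomial $f\in\mathbb{Z}_3[x_1,\dots,x_n]$ is given in expanded form as $\sum_{(e_1,\dots,e_n)\in I} c_{\mathbf{e}}x_1^{e_1}\cdots x_n^{e_n}$ with $I\subseteq\{0,1,2\}^n$ and all $c_{\mathbf{e}}\in\mathbb{Z}_3\setminus\{0\}$. A $\mathrm{CC}[m_1,\dots,m_d]$-circuit is a depth-$d$ circuit with Boolean inputs ($\{0,1\}\subseteq\mathbb{N}_0$) and output in $\{0,1\}$, whose unbounded fan-in gates at depth $h$ are $\mathrm{MOD}_{m_h}$ gates: such a gate outputs $1$ if the sum of its inputs (counted with multiplicity) is a multiple of $m_h$ and $0$ otherwise; some input wires may be set to the constant $1$. Its size is the number of gates. Equivalently, a $\mathrm{CC}[2,3,2]$-circuit on inputs $y_1,\dots,y_n$ is an expression $\mathrm{Mod}_2\big(c_0+\sum_{i=1}^k\mathrm{Mod}_3\big(c_1(i)+\sum_{j=1}^{l(i)}\mathrm{Mod}_2(c_2(i,j)+\sum_{m=1}^n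 e(i,j,m)y_m)\big)\big)$ with nonnegative integer constants, where $\mathrm{Mod}_r(x)=1$ if $r\mid x$ and $0$ otherwise. For a ring $R$ with unity, a restricted monomial expression is a nonempty word over the alphabet $X\cup U(R)$, where $U(R)$ is the set of invertible elements of $R$ (variables are noncommuting); a restricted polynomial expression is a finite (possibly empty) formal sum of restricted monomial expressions, evaluated in $R$ in the obvious way (the empty sum is $0$). *)

theory Defs
  imports
    "HOL-Algebra.Sym_Groups"
    "HOL-Algebra.Multiplicative_Group"
    "HOL-Computational_Algebra.Polynomial"
    "HOL-Library.Numeral_Type"
    "HOL-Library.Z2"
    "Jordan_Normal_Form.Matrix"
begin

section \<open>Polynomial-time computation\<close>

text \<open>
  The machine model is the language WHILE of Neil Jones, whose data are binary trees
  (S-expressions over a single atom).  A program works on finitely many variables; executing an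
  assignment costs one plus the number of nodes of the tree that is written, every other step
  costs one.  Hence the total size of all stored trees never exceeds the size of the input plus
  the time used, and the model and multi-tape Turing machines simulate each other with
  polynomial overhead, for functions as well as for decision problems.
\<close>

datatype bintree = Leaf | Node bintree bintree

type_synonym store = "nat \<Rightarrow> bintree"

datatype expr =
    Const_Leaf
  | Copy nat
  | Pair_Up nat nat
  | Left_Of nat
  | Right_Of nat

fun left_subtree :: "bintree \<Rightarrow> bintree" where
  "left_subtree Leaf = Leaf"
| "left_subtree (Node l r) = l"

fun right_subtree :: "bintree \<Rightarrow> bintree" where
  "right_subtree Leaf = Leaf"
| "right_subtree (Node l r) = r"

fun expr_val :: "expr \<Rightarrow> store \<Rightarrow> bintree" where
  "expr_val Const_Leaf s = Leaf"
| "expr_val (Copy x) s = s x"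
| "expr_val (Pair_Up x y) s = Node (s x) (s y)"
| "expr_val (Left_Of x) s = left_subtree (s x)"
| "expr_val (Right_Of x) s = right_subtree (s x)"

datatype prog =
    Skip
  | Assign nat expr
  | Seq prog prog
  | Cond nat prog prog
  | While nat prog

text \<open>
  \<open>exec c s t s'\<close>: program \<open>c\<close>, started in store \<open>s\<close>, terminates in store \<open>s'\<close> after time \<open>t\<close>.
  A variable counts as true iff its value is not \<^term>\<open>Leaf\<close>; \<^term>\<open>size\<close> counts the inner nodes
  of a tree.
\<close>

inductive exec :: "prog \<Rightarrow> store \<Rightarrow> nat \<Rightarrow> store \<Rightarrow> bool" where
  exec_Skip: "exec Skip s 1 s"
| exec_Assign: "exec (Assign x e) s (1 + size (expr_val e s)) (s(x := expr_val e s))"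
| exec_Seq: "exec c\<^sub>1 s t\<^sub>1 s' \<Longrightarrow> exec c\<^sub>2 s' t\<^sub>2 s'' \<Longrightarrow> exec (Seq c\<^sub>1 c\<^sub>2) s (t\<^sub>1 + t\<^sub>2) s''"
| exec_Cond_True: "s x \<noteq> Leaf \<Longrightarrow> exec c\<^sub>1 s t s' \<Longrightarrow> exec (Cond x c\<^sub>1 c\<^sub>2) s (1 + t) s'"
| exec_Cond_False: "s x = Leaf \<Longrightarrow> exec c\<^sub>2 s t s' \<Longrightarrow> exec (Cond x c\<^sub>1 c\<^sub>2) s (1 + t) s'"
| exec_While_False: "s x = Leaf \<Longrightarrow> exec (While x c) s 1 s"
| exec_While_True:
    "s x \<noteq> Leaf \<Longrightarrow> exec c s t\<^sub>1 s' \<Longrightarrow> exec (While x c) s' t\<^sub>2 s'' \<Longrightarrow>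
     exec (While x c) s (1 + t\<^sub>1 + t\<^sub>2) s''"

inductive_cases exec_SkipE: "exec Skip s t s'"
inductive_cases exec_AssignE: "exec (Assign x e) s t s'"
inductive_cases exec_SeqE: "exec (Seq c\<^sub>1 c\<^sub>2) s t s'"
inductive_cases exec_CondE: "exec (Cond x c\<^sub>1 c\<^sub>2) s t s'"
inductive_cases exec_WhileE: "exec (While x c) s t s'"

lemma exec_deterministic:
  "exec c s t s' \<Longrightarrow> exec c s u s'' \<Longrightarrow> u = t \<and> s'' = s'"
proof (induction arbitrary: u s'' rule: exec.induct)
  case exec_Skip
  then show ?case by (auto elim: exec_SkipE)
next
  case exec_Assign
  then show ?case by (auto elim: exec_AssignE)
next
  case (exec_Seq c\<^sub>1 s t\<^sub>1 s' c\<^sub>2 t\<^sub>2 v)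
  from exec_Seq.prems show ?case
    by (elim exec_SeqE) (auto dest!: exec_Seq.IH)
next
  case (exec_Cond_True s x c\<^sub>1 t s' c\<^sub>2)
  from exec_Cond_True.prems exec_Cond_True.hyps(1) show ?case
    by (elim exec_CondE) (auto dest!: exec_Cond_True.IH)
next
  case (exec_Cond_False s x c\<^sub>2 t s' c\<^sub>1)
  from exec_Cond_False.prems exec_Cond_False.hyps(1) show ?case
    by (elim exec_CondE) (auto dest!: exec_Cond_False.IH)
next
  case (exec_While_False s x c)
  from exec_While_False.prems exec_While_False.hyps show ?case
    by (cases rule: exec_WhileE) auto
next
  case (exec_While_True s x c t\<^sub>1 s' t\<^sub>2 v)
  from exec_While_True.prems show ?case
  proof (rule exec_WhileE)
    assume "s x = Leaf"
    with exec_While_True.hyps(1) show ?thesis by simp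
  next
    fix u\<^sub>1 r u\<^sub>2
    assume "u = Suc (u\<^sub>1 + u\<^sub>2)" "exec c s u\<^sub>1 r" "exec (While x c) r u\<^sub>2 s''"
    then show ?thesis using exec_While_True.IH by fastforce
  qed
qed

text \<open>Variable 0 holds the input at the start and the output at the end of a computation.\<close>

definition init_store :: "bintree \<Rightarrow> store" where
  "init_store d = (\<lambda>_. Leaf)(0 := d)"

definition polytime_on :: "bintree set \<Rightarrow> (bintree \<Rightarrow> bintree) \<Rightarrow> bool" where
  "polytime_on D f \<longleftrightarrow>
    (\<exists>(c :: prog) (q :: nat poly). \<forall>d\<in>D. \<exists>t s.
       exec c (init_store d) t s \<and> s 0 = f d \<and> t \<le> poly q (size d))"


section \<open>Decision problems and reductions\<close>

text \<open>A decision problem, in encoded form: the set of its inputs and the set of those inputs for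
  which the answer is yes.\<close>

record problem =
  inputs :: "bintree set"
  yes_inputs :: "bintree set"

definition encoded_problem :: "('a \<Rightarrow> bintree) \<Rightarrow> 'a set \<Rightarrow> ('a \<Rightarrow> bool) \<Rightarrow> problem" where
  "encoded_problem enc I A = \<lparr> inputs = enc ` I, yes_inputs = enc ` {e \<in> I. A e} \<rparr>"

definition polytime_reducible :: "problem \<Rightarrow> problem \<Rightarrow> bool" where
  "polytime_reducible A B \<longleftrightarrow>
    (\<exists>P. polytime_on (inputs A) P \<and>
      (\<forall>e\<in>inputs A. P e \<in> inputs B \<and> (e \<in> yes_inputs A \<longleftrightarrow> P e \<in> yes_inputs B)))"

definition polytime_equivalent :: "problem \<Rightarrow> problem \<Rightarrow> bool" where
  "polytime_equivalent A B \<longleftrightarrow> polytime_reducible A B \<and> polytime_reducible B A"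


section \<open>Encodings of basic data\<close>

definition enc_bool :: "bool \<Rightarrow> bintree" where
  "enc_bool b = (if b then Node Leaf Leaf else Leaf)"

text \<open>Binary representation, least significant bit first.\<close>

fun enc_nat :: "nat \<Rightarrow> bintree" where
  "enc_nat n = (if n = 0 then Leaf else Node (enc_bool (odd n)) (enc_nat (n div 2)))"

declare enc_nat.simps [simp del]

definition enc_pair :: "('a \<Rightarrow> bintree) \<Rightarrow> ('b \<Rightarrow> bintree) \<Rightarrow> 'a \<times> 'b \<Rightarrow> bintree" where
  "enc_pair enc\<^sub>1 enc\<^sub>2 p = Node (enc\<^sub>1 (fst p)) (enc\<^sub>2 (snd p))"

definition enc_list :: "('a \<Rightarrow> bintree) \<Rightarrow> 'a list \<Rightarrow> bintree" where
  "enc_list enc xs = foldr (\<lambda>x. Node (enc x)) xs Leaf"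

lemma enc_bool_inject [simp]: "enc_bool a = enc_bool b \<longleftrightarrow> a = b"
  by (simp add: enc_bool_def)

lemma inj_enc_nat: "inj enc_nat"
proof (rule injI)
  fix m n show "enc_nat m = enc_nat n \<Longrightarrow> m = n"
  proof (induction m arbitrary: n rule: less_induct)
    case (less m)
    show ?case
    proof (cases "m = 0 \<or> n = 0")
      case True
      then show ?thesis using less.prems by (auto simp: enc_nat.simps split: if_splits)
    next
      case False
      then have "odd m = odd n" and "enc_nat (m div 2) = enc_nat (n div 2)"
        using less.prems enc_nat.simps[of m] enc_nat.simps[of n] by auto
      moreover from this less.IH[of "m div 2" "n div 2"] False have "m div 2 = n div 2"
        by simp
      ultimately show ?thesis
        by (metis bit_eq_rec)
    qed
  qed
qed

lemma inj_on_enc_pair: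
  "inj_on enc\<^sub>1 S \<Longrightarrow> inj_on enc\<^sub>2 T \<Longrightarrow> inj_on (enc_pair enc\<^sub>1 enc\<^sub>2) (S \<times> T)"
  by (auto simp: inj_on_def enc_pair_def)

lemma inj_on_enc_list:
  assumes "inj_on enc S"
  shows "inj_on (enc_list enc) (lists S)"
proof -
  have "xs = ys" if "set xs \<subseteq> S" "set ys \<subseteq> S" "enc_list enc xs = enc_list enc ys" for xs ys
    using that
  proof (induction xs arbitrary: ys)
    case Nil
    then show ?case by (cases ys) (auto simp: enc_list_def)
  next
    case (Cons x xs)
    then obtain z zs where ys: "ys = z # zs" and eq: "enc x = enc z" "enc_list enc xs = enc_list enc zs"
      by (cases ys) (auto simp: enc_list_def)
    have "x \<in> S" "z \<in> S" "set xs \<subseteq> S" "set zs \<subseteq> S"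
      using Cons.prems(1,2) ys by auto
    then have "x = z" "xs = zs"
      using inj_onD[OF assms eq(1)] Cons.IH[OF _ _ eq(2)] by blast+
    with ys show ?case by simp
  qed
  then show ?thesis
    by (intro inj_onI) (metis in_listsD subsetI)
qed

lemma inj_enc_pair: "inj enc\<^sub>1 \<Longrightarrow> inj enc\<^sub>2 \<Longrightarrow> inj (enc_pair enc\<^sub>1 enc\<^sub>2)"
  using inj_on_enc_pair[of enc\<^sub>1 UNIV enc\<^sub>2 UNIV] by simp

lemma inj_enc_list: "inj enc \<Longrightarrow> inj (enc_list enc)"
  using inj_on_enc_list[of enc UNIV] by simp


section \<open>Words over a monoid and variables\<close>

text \<open>\<open>Var i\<close> is the variable $x_i$.\<close>

datatype 'g letter = Const 'g | Var nat

fun letter_eval :: "(nat \<Rightarrow> 'g) \<Rightarrow> 'g letter \<Rightarrow> 'g" where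
  "letter_eval a (Const g) = g"
| "letter_eval a (Var i) = a i"

definition word_eval :: "('g, 'm) monoid_scheme \<Rightarrow> (nat \<Rightarrow> 'g) \<Rightarrow> 'g letter list \<Rightarrow> 'g" where
  "word_eval G a w = foldr (\<lambda>l g. letter_eval a l \<otimes>\<^bsub>G\<^esub> g) w \<one>\<^bsub>G\<^esub>"

definition words_over :: "'g set \<Rightarrow> 'g letter list set" where
  "words_over S = lists (Const ` S \<union> range Var)"

fun enc_letter :: "('g \<Rightarrow> bintree) \<Rightarrow> 'g letter \<Rightarrow> bintree" where
  "enc_letter enc (Const g) = enc_pair enc_bool enc (False, g)"
| "enc_letter enc (Var i) = enc_pair enc_bool enc_nat (True, i)"

definition enc_word :: "('g \<Rightarrow> bintree) \<Rightarrow> 'g letter list \<Rightarrow> bintree" where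
  "enc_word enc = enc_list (enc_letter enc)"

lemma inj_on_enc_word:
  assumes "inj_on enc S"
  shows "inj_on (enc_word enc) (words_over S)"
proof -
  have "inj_on (enc_letter enc) (Const ` S \<union> range Var)"
  proof (rule inj_onI)
    fix k l assume "k \<in> Const ` S \<union> range Var" "l \<in> Const ` S \<union> range Var"
      and "enc_letter enc k = enc_letter enc l"
    then show "k = l"
      using inj_onD[OF assms] injD[OF inj_enc_nat]
      by (cases k; cases l) (auto simp: enc_pair_def)
  qed
  then show ?thesis
    unfolding enc_word_def words_over_def by (rule inj_on_enc_list)
qed


section \<open>Equations over groups\<close>

definition coPolEqv :: "('g, 'm) monoid_scheme \<Rightarrow> ('g \<Rightarrow> bintree) \<Rightarrow> problem" where
  "coPolEqv G enc = encoded_problem (enc_word enc) (words_over (carrier G))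
     (\<lambda>w. \<exists>a \<in> UNIV \<rightarrow> carrier G. \<exists>g \<in> carrier G - {\<one>\<^bsub>G\<^esub>}. word_eval G a w = g)"

definition PolSat :: "('g, 'm) monoid_scheme \<Rightarrow> ('g \<Rightarrow> bintree) \<Rightarrow> problem" where
  "PolSat G enc = encoded_problem (enc_word enc) (words_over (carrier G))
     (\<lambda>w. \<exists>a \<in> UNIV \<rightarrow> carrier G. word_eval G a w = \<one>\<^bsub>G\<^esub>)"

definition enc_S4 :: "(nat \<Rightarrow> nat) \<Rightarrow> bintree" where
  "enc_S4 p = enc_list enc_nat (map p [1, 2, 3, 4])"

lemma inj_on_enc_S4: "inj_on enc_S4 (carrier (sym_group 4))"
proof (rule inj_onI)
  fix p q assume p: "p \<in> carrier (sym_group 4)" and q: "q \<in> carrier (sym_group 4)"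
    and eq: "enc_S4 p = enc_S4 q"
  have "map p [1, 2, 3, 4] = map q [1, 2, 3, 4]"
    using injD[OF inj_enc_list[OF inj_enc_nat] eq[unfolded enc_S4_def]] .
  moreover have "i = 1 \<or> i = 2 \<or> i = 3 \<or> i = 4" if "i \<in> {1..4}" for i :: nat
    using that by auto
  ultimately have "\<And>i. i \<in> {1..4} \<Longrightarrow> p i = q i"
    by fastforce
  moreover have "\<And>i. i \<notin> {1..4} \<Longrightarrow> p i = q i"
    using p q by (metis permutes_not_in sym_group_carrier)
  ultimately show "p = q"
    by (metis ext)
qed


section \<open>Sums of powers with exponents given by polynomials over the integers mod 3\<close>

text \<open>The type \<^typ>\<open>3\<close> is the ring $\mathbf{Z}_3$; \<open>residue3 t\<close> is the
  representative of \<open>t\<close> in $\{0,1,2\}$.\<close>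

definition residue3 :: "3 \<Rightarrow> nat" where
  "residue3 t = nat (Rep_bit1 t)"

text \<open>A polynomial in expanded form is the list of its terms, a term being an exponent vector
  together with its coefficient.  The inputs are pairs \<open>(n, [p\<^sub>1, \<dots>, p\<^sub>k])\<close> with \<open>n, k \<ge> 1\<close>.\<close>

type_synonym expanded_poly = "(nat list \<times> 3) list"

definition expanded_polys :: "nat \<Rightarrow> expanded_poly set" where
  "expanded_polys n =
    {p. distinct (map fst p) \<and>
        (\<forall>(e, c) \<in> set p. length e = n \<and> set e \<subseteq> {0, 1, 2} \<and> c \<noteq> 0)}"

definition expanded_poly_eval :: "expanded_poly \<Rightarrow> 3 list \<Rightarrow> 3" where
  "expanded_poly_eval p y = (\<Sum>(e, c) \<leftarrow> p. c * (\<Prod>i<length y. y ! i ^ (e ! i)))"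

definition power_sum_inputs :: "(nat \<times> expanded_poly list) set" where
  "power_sum_inputs = {(n, ps). n \<ge> 1 \<and> ps \<noteq> [] \<and> set ps \<subseteq> expanded_polys n}"

definition power_sum :: "('f, 'm) ring_scheme \<Rightarrow> 'f \<Rightarrow> expanded_poly list \<Rightarrow> 3 list \<Rightarrow> 'f" where
  "power_sum F \<alpha> ps y =
    (\<Oplus>\<^bsub>F\<^esub> i \<in> {..<length ps}. \<alpha> [^]\<^bsub>F\<^esub> residue3 (expanded_poly_eval (ps ! i) y))"

definition enc_expanded_poly :: "expanded_poly \<Rightarrow> bintree" where
  "enc_expanded_poly = enc_list (enc_pair (enc_list enc_nat) (\<lambda>c. enc_nat (residue3 c)))"

definition enc_power_sum :: "nat \<times> expanded_poly list \<Rightarrow> bintree" where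
  "enc_power_sum = enc_pair enc_nat (enc_list enc_expanded_poly)"

definition PowerSumNonzero :: "('f, 'm) ring_scheme \<Rightarrow> 'f \<Rightarrow> problem" where
  "PowerSumNonzero F \<alpha> = encoded_problem enc_power_sum power_sum_inputs
     (\<lambda>(n, ps). \<exists>y. length y = n \<and> set y \<subseteq> {-1, 1} \<and> power_sum F \<alpha> ps y \<noteq> \<zero>\<^bsub>F\<^esub>)"

definition primitive_element :: "('f, 'm) ring_scheme \<Rightarrow> 'f \<Rightarrow> bool" where
  "primitive_element F \<alpha> \<longleftrightarrow>
    \<alpha> \<in> carrier (mult_of F) \<and> carrier (mult_of F) = {\<alpha> [^]\<^bsub>F\<^esub> i | i::nat. i \<in> UNIV}"

lemma inj_residue3: "inj residue3"
proof (rule injI)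
  fix s t :: 3 assume "residue3 s = residue3 t"
  moreover have "Rep_bit1 s \<ge> 0" "Rep_bit1 t \<ge> 0"
    using Rep_bit1[of s] Rep_bit1[of t] by auto
  ultimately show "s = t"
    by (simp add: residue3_def eq_nat_nat_iff Rep_bit1_inject)
qed

lemma inj_enc_power_sum: "inj enc_power_sum"
proof -
  have "inj (\<lambda>c. enc_nat (residue3 c))"
    using inj_compose[OF inj_enc_nat inj_residue3] by (simp add: comp_def)
  then show ?thesis
    unfolding enc_power_sum_def enc_expanded_poly_def
    by (intro inj_enc_pair inj_enc_list inj_enc_nat)
qed


section \<open>CC[2,3,2]-circuits\<close>

text \<open>
  \<open>(n, c\<^sub>0, [(c\<^sub>1(i), [(c\<^sub>2(i,j), [e(i,j,1), \<dots>, e(i,j,n)])]\<^sub>j)]\<^sub>i)\<close> denotes the circuit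
  $\mathrm{Mod}_2(c_0 + \sum_i \mathrm{Mod}_3(c_1(i) + \sum_j \mathrm{Mod}_2(c_2(i,j) +
  \sum_m e(i,j,m) y_m)))$ on the inputs $y_1, \dots, y_n$.
\<close>

type_synonym cc232_circuit = "nat \<times> nat \<times> (nat \<times> (nat \<times> nat list) list) list"

definition MOD_gate :: "nat \<Rightarrow> nat \<Rightarrow> nat" where
  "MOD_gate r x = (if r dvd x then 1 else 0)"

definition cc232_circuits :: "cc232_circuit set" where
  "cc232_circuits =
    {(n, c\<^sub>0, gs). \<forall>(c\<^sub>1, hs) \<in> set gs. \<forall>(c\<^sub>2, es) \<in> set hs. length es = n}"

fun cc232_eval :: "cc232_circuit \<Rightarrow> nat list \<Rightarrow> nat" where
  "cc232_eval (n, c\<^sub>0, gs) y =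
    MOD_gate 2 (c\<^sub>0 + (\<Sum>(c\<^sub>1, hs) \<leftarrow> gs.
      MOD_gate 3 (c\<^sub>1 + (\<Sum>(c\<^sub>2, es) \<leftarrow> hs.
        MOD_gate 2 (c\<^sub>2 + (\<Sum>m<n. es ! m * y ! m))))))"

definition enc_cc232 :: "cc232_circuit \<Rightarrow> bintree" where
  "enc_cc232 =
    enc_pair enc_nat (enc_pair enc_nat
      (enc_list (enc_pair enc_nat (enc_list (enc_pair enc_nat (enc_list enc_nat))))))"

definition CC232NotOne :: problem where
  "CC232NotOne = encoded_problem enc_cc232 cc232_circuits
     (\<lambda>C. \<exists>y. length y = fst C \<and> set y \<subseteq> {0, 1} \<and> cc232_eval C y \<noteq> 1)"

lemma inj_enc_cc232: "inj enc_cc232"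
  unfolding enc_cc232_def by (intro inj_enc_pair inj_enc_list inj_enc_nat)


section \<open>Restricted polynomial expressions over rings\<close>

text \<open>A formal sum is the list of its summands.\<close>

definition restricted_exprs :: "('r, 'm) ring_scheme \<Rightarrow> 'r letter list list set" where
  "restricted_exprs R = lists (words_over (Units R) - {[]})"

definition restricted_eval ::
    "('r, 'm) ring_scheme \<Rightarrow> (nat \<Rightarrow> 'r) \<Rightarrow> 'r letter list list \<Rightarrow> 'r" where
  "restricted_eval R a f = foldr (\<lambda>w r. word_eval R a w \<oplus>\<^bsub>R\<^esub> r) f \<zero>\<^bsub>R\<^esub>"

definition RestrictedNonzero :: "('r, 'm) ring_scheme \<Rightarrow> ('r \<Rightarrow> bintree) \<Rightarrow> problem" where
  "RestrictedNonzero R enc = encoded_problem (enc_list (enc_word enc)) (restricted_exprs R)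
     (\<lambda>f. \<exists>a \<in> UNIV \<rightarrow> Units R. restricted_eval R a f \<noteq> \<zero>\<^bsub>R\<^esub>)"

abbreviation Mat2_Z2 :: "bit mat ring" where
  "Mat2_Z2 \<equiv> ring_mat TYPE(bit) 2 ()"

definition enc_Mat2_Z2 :: "bit mat \<Rightarrow> bintree" where
  "enc_Mat2_Z2 A =
    enc_list enc_bool (map (\<lambda>ij. A $$ ij = 1) [(0, 0), (0, 1), (1, 0), (1, 1)])"

lemma inj_on_enc_Mat2_Z2: "inj_on enc_Mat2_Z2 (carrier Mat2_Z2)"
proof (rule inj_onI)
  fix A B assume A: "A \<in> carrier Mat2_Z2" and B: "B \<in> carrier Mat2_Z2"
    and eq: "enc_Mat2_Z2 A = enc_Mat2_Z2 B"
  have bit: "(x = 1) = (y = 1) \<Longrightarrow> x = y" for x y :: bit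
    by (cases x; cases y) auto
  have "A $$ (i, j) = B $$ (i, j)" if "i < 2" "j < 2" for i j
    using eq that by (auto simp: enc_Mat2_Z2_def enc_list_def less_2_cases_iff intro!: bit)
  then show "A = B"
    using A B by (auto simp: ring_mat_simps)
qed

lemma inj_on_enc_restricted:
  assumes "inj_on enc (carrier R)"
  shows "inj_on (enc_list (enc_word enc)) (restricted_exprs R)"
proof -
  have "inj_on enc (Units R)"
    by (rule inj_on_subset[OF assms]) (auto simp: Units_def)
  then have "inj_on (enc_word enc) (words_over (Units R) - {[]})"
    by (rule inj_on_subset[OF inj_on_enc_word]) auto
  then show ?thesis
    unfolding restricted_exprs_def by (rule inj_on_enc_list)
qed

end

theory Submission
  imports Defs
begin

text \<open>
  The five problems are reduced to each other in the cyclic order (1), (2), (3), (4), (5), (1).  Everything is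
  expressed through the field with four elements: $S_4$ is the group of all permutations of it, each of
  which has the form $x \mapsto \alpha^p x^s + v$ with $s \in \{1, 2\}$, and $\mathrm{Mat}_2(\mathbf{Z}_2)$ is the ring of
  its additive maps, the units of which are those permutations with $v = 0$.

  (1) to (2): if $w$ is nontrivial, then some commutator $[y, w]$ is a nontrivial translation, and all
  of these are conjugate.  So $w$ can be nontrivial iff $g [y, w'] g^{-1} \tau = 1$ is solvable, with fresh
  $g$, $y$.

  (2) to (3): write every variable as a product of generators that are switched on or off by signs.  The
  value of $w$ is then $x \mapsto \alpha^P x^s + T$ with $P$ a polynomial in the signs, $s \equiv \pm 1$ a monomial and $T$ a
  sum of powers of $\alpha$, and $(1 + T^3)(1 + \alpha^P + \alpha^{2P})(1 + \alpha^{s-1} + \alpha^{2(s-1)})$, expanded, is 1 if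
  the value is the identity, and 0 otherwise.

  (3) to (4): a power sum $s$ is nonzero iff the trace of $\alpha s^3$ is 1, and the trace of $\alpha^t$ is 1 plus the
  output of a MOD 3 gate on $t$.

  (4) to (5): the output of a MOD 3 gate on $t$ is $1 + \alpha^t + \alpha^{2t}$, and a MOD 2 gate yields an exponent
  $\pm 1$, which is obtained by conjugating $\alpha$ with a product of variables.

  (5) to (1): conjugation by a word $u$ maps a translation by $v$ to the translation by the linear part
  of $u$ applied to $v$, and products of translations add up, so sums of words become products of conjugates.
\<close>

section \<open>Polynomial-time functions\<close>

text \<open>In the normal form alpha^P x^s + T, Frobenius acts on exponents of alpha as
  multiplication by -1 in Z_3. Hence signs multiply along a word and s remains a single monomial,
  while a rotation adds two monomials to P and a translation two powers to T. So the normal form of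
  a long composition has polynomial size. Cubes are cheap as well: s^3 = s s^2, and squaring is
  additive, so the cube of a sum is a double sum only; and s^3 is 0 or 1. The same -1 makes the ring
  problem express signs: a linear bijection either commutes with multiplication by alpha or inverts
  it. The commutator in the first reduction is there because nontrivial permutations form several
  conjugacy classes, but nontrivial translations just one. The other half of the work is to compute
  every reduction on trees. \<open>ptime\<close> is closed under composition, pairing, branching and
  folds with an a priori bound on the accumulator, so the reductions are written with maps,
  concatenations, suffixes and folds, and even the numbering of fresh variables is chosen to be easy
  on binary digits.\<close>

lemma poly_nat_mono: "m \<le> n \<Longrightarrow> poly (q :: nat poly) m \<le> poly q n"
  by (induction q) (auto intro: add_mono mult_mono)

text \<open>With the identity as an encoding, \<open>ptime\<close> also covers functions on raw
  trees, by which encoded data are built and taken apart.\<close>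

definition enc_tree :: "bintree \<Rightarrow> bintree" where
  "enc_tree d = d"

abbreviation runs :: "prog \<Rightarrow> store \<Rightarrow> bintree \<Rightarrow> nat \<Rightarrow> nat \<Rightarrow> bool" where
  "runs c s d m b \<equiv> \<exists>t s'. exec c s t s' \<and> s' 0 = d \<and> (\<forall>v\<ge>m. s' v = s v) \<and> t \<le> b"

text \<open>Programs must work in every store with the input in variable 0 and keep all variables from some
  bound on, so that they can be used as subroutines.\<close>

definition ptime :: "('a \<Rightarrow> bintree) \<Rightarrow> ('b \<Rightarrow> bintree) \<Rightarrow> ('a \<Rightarrow> 'b) \<Rightarrow> bool" where
  "ptime e e' f \<longleftrightarrow> (\<exists>c m (q :: nat poly). \<forall>(s :: store) x. s 0 = e x \<longrightarrow>
     runs c s (e' (f x)) m (poly q (size (e x))))"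

lemma ptimeI:
  assumes "\<And>(s :: store) x. s 0 = e x \<Longrightarrow>
     runs c s (e' (f x)) m (poly q (size (e x)))"
  shows "ptime e e' f"
  using assms unfolding ptime_def by blast

text \<open>The bound on the touched variables may be raised, so several subroutines can be given a
  common one, with scratch variables placed from there on.\<close>

lemma ptimeE:
  assumes "ptime e e' f"
  obtains c q m0 where "\<And>m (s :: store) x. m \<ge> m0 \<Longrightarrow> s 0 = e x \<Longrightarrow>
     runs c s (e' (f x)) m (poly q (size (e x)))"
proof -
  obtain c m and q :: "nat poly" where *: "\<And>(s :: store) x. s 0 = e x \<Longrightarrow>
     runs c s (e' (f x)) m (poly q (size (e x)))"
    using assms unfolding ptime_def by blast
  show thesis
  proof (rule that)
    fix k and s :: store and x assume "k \<ge> m" "s 0 = e x"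
    then show "runs c s (e' (f x)) k (poly q (size (e x)))"
      using *[of s x] by (meson order_trans)
  qed
qed

text \<open>Writing a tree costs more than its size, so a short run cannot leave large trees behind.
  This keeps outputs polynomial in \<open>pbounded_output\<close>.\<close>

lemma exec_size: "exec c s t s' \<Longrightarrow> size (s' v) \<le> size (s v) + t"
proof (induction arbitrary: v rule: exec.induct)
  case (exec_Seq c1 s t1 s' c2 t2 s'')
  then show ?case using exec_Seq.IH(1)[of v] exec_Seq.IH(2)[of v] by linarith
next
  case (exec_Cond_True s x c1 t s' c2)
  then show ?case using exec_Cond_True.IH[of v] by linarith
next
  case (exec_Cond_False s x c2 t s' c1)
  then show ?case using exec_Cond_False.IH[of v] by linarith
next
  case (exec_While_True s x c t1 s' t2 s'')
  then show ?case using exec_While_True.IH(1)[of v] exec_While_True.IH(2)[of v] by linarith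
qed simp_all

section \<open>Quantities bounded by a polynomial in the size of the input\<close>

definition pbounded :: "('a \<Rightarrow> bintree) \<Rightarrow> ('a \<Rightarrow> nat) \<Rightarrow> bool" where
  "pbounded e h \<longleftrightarrow> (\<exists>q. \<forall>x. h x \<le> poly q (size (e x)))"

lemma pbounded_mono: "pbounded e h \<Longrightarrow> (\<And>x. g x \<le> h x) \<Longrightarrow> pbounded e g"
  unfolding pbounded_def by (meson order_trans)

lemma pbounded_const: "pbounded e (\<lambda>_. k)"
  unfolding pbounded_def by (rule exI[of _ "[:k:]"]) simp

lemma pbounded_add:
  assumes "pbounded e g" "pbounded e h" shows "pbounded e (\<lambda>x. g x + h x)"
proof -
  obtain p q where "\<And>x. g x \<le> poly p (size (e x))" "\<And>x. h x \<le> poly q (size (e x))"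
    using assms unfolding pbounded_def by auto
  then show ?thesis
    unfolding pbounded_def by (intro exI[of _ "p + q"]) (simp add: add_mono)
qed

lemma pbounded_mult:
  assumes "pbounded e g" "pbounded e h" shows "pbounded e (\<lambda>x. g x * h x)"
proof -
  obtain p q where "\<And>x. g x \<le> poly p (size (e x))" "\<And>x. h x \<le> poly q (size (e x))"
    using assms unfolding pbounded_def by auto
  then show ?thesis
    unfolding pbounded_def by (intro exI[of _ "p * q"]) (simp add: mult_mono)
qed

lemma pbounded_poly:
  assumes "pbounded e h" shows "pbounded e (\<lambda>x. poly q (h x))"
proof -
  obtain p where "\<And>x. h x \<le> poly p (size (e x))"
    using assms unfolding pbounded_def by auto
  then show ?thesis
    unfolding pbounded_def
    by (intro exI[of _ "q \<circ>\<^sub>p p"]) (simp add: poly_pcompose poly_nat_mono)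
qed

lemma pbounded_input: "pbounded e (\<lambda>x. size (e x))"
  unfolding pbounded_def by (rule exI[of _ "[:0, 1:]"]) simp

lemma pbounded_output:
  assumes "ptime e e' f" shows "pbounded e (\<lambda>x. size (e' (f x)))"
proof -
  obtain c q m where *: "\<And>(s :: store) x. s 0 = e x \<Longrightarrow>
     runs c s (e' (f x)) m (poly q (size (e x)))"
    using assms unfolding ptime_def by blast
  have "size (e' (f x)) \<le> size (e x) + poly q (size (e x))" for x
  proof -
    obtain t s' where "exec c (init_store (e x)) t s'" "s' 0 = e' (f x)" "t \<le> poly q (size (e x))"
      using *[of "init_store (e x)" x] by (auto simp: init_store_def)
    then show ?thesis
      using exec_size[of c "init_store (e x)" t s' 0] by (simp add: init_store_def)
  qed
  then show ?thesis
    by (rule pbounded_mono[rotated])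
      (intro pbounded_add pbounded_poly pbounded_input)
qed

lemma ptime_cong:
  "ptime e e' f \<Longrightarrow> (\<And>x. e x = d x) \<Longrightarrow> (\<And>x. e' (f x) = d' (g x)) \<Longrightarrow> ptime d d' g"
  unfolding ptime_def by simp

lemma ptime_encoded: "ptime e e' f \<Longrightarrow> ptime e enc_tree (\<lambda>x. e' (f x))"
  by (simp add: ptime_def enc_tree_def)

lemma ptimeI':
  assumes h: "pbounded e h"
    and c: "\<And>(s :: store) x. s 0 = e x \<Longrightarrow>
     runs c s (e' (f x)) m (h x)"
  shows "ptime e e' f"
proof -
  obtain q where "\<And>x. h x \<le> poly q (size (e x))"
    using h unfolding pbounded_def by auto
  then show ?thesis
    using c by (intro ptimeI[of e c e' f m q]) (meson order_trans)
qed

section \<open>Programs for composition, pairing, branching and loops\<close>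

lemma ptime_comp:
  assumes f: "ptime e e' f" and g: "ptime e' e'' g"
  shows "ptime e e'' (\<lambda>x. g (f x))"
proof -
  obtain c p m1 where c: "\<And>m (s :: store) x. m \<ge> m1 \<Longrightarrow> s 0 = e x \<Longrightarrow>
     runs c s (e' (f x)) m (poly p (size (e x)))"
    by (rule ptimeE[OF f]) (rule that)
  obtain d q m2 where d: "\<And>m (s :: store) x. m \<ge> m2 \<Longrightarrow> s 0 = e' x \<Longrightarrow>
     runs d s (e'' (g x)) m (poly q (size (e' x)))"
    by (rule ptimeE[OF g]) (rule that)
  define m where "m = max m1 m2"
  show ?thesis
  proof (rule ptimeI'[where c = "Seq c d" and m = m])
    \<comment> \<open>The time of the second program is polynomial in the size of the intermediate
      result, which itself is polynomial in the size of the input.\<close>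
    show "pbounded e (\<lambda>x. poly p (size (e x)) + poly q (size (e' (f x))))"
      by (intro pbounded_add pbounded_poly pbounded_input pbounded_output f)
  next
    fix s :: store and x assume "s 0 = e x"
    then obtain t s' where 1: "exec c s t s'" "s' 0 = e' (f x)" "\<forall>v\<ge>m. s' v = s v"
      "t \<le> poly p (size (e x))" using c[of m s x] unfolding m_def by auto
    obtain u s'' where 2: "exec d s' u s''" "s'' 0 = e'' (g (f x))" "\<forall>v\<ge>m. s'' v = s' v"
      "u \<le> poly q (size (e' (f x)))" using d[of m s' "f x"] 1(2) unfolding m_def by auto
    show "runs (Seq c d) s (e'' (g (f x))) m (poly p (size (e x)) + poly q (size (e' (f x))))"
      using exec_Seq[OF 1(1) 2(1)] 1 2 by (metis add_mono)
  qed
qed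

lemma ptime_id: "ptime e e (\<lambda>x. x)"
  by (rule ptimeI[where c = Skip and m = 0 and q = "[:1:]"])
    (intro exI conjI, rule exec_Skip, simp_all)

lemma ptime_tree_expr:
  assumes "\<And>(s :: store) x. s 0 = e x \<Longrightarrow> expr_val a s = e' (f x)"
    and "pbounded e (\<lambda>x. size (e' (f x)))"
  shows "ptime e e' f"
proof (rule ptimeI'[where c = "Assign 0 a" and m = 1])
  show "pbounded e (\<lambda>x. 1 + size (e' (f x)))"
    by (intro pbounded_add pbounded_const assms(2))
next
  fix s :: store and x assume "s 0 = e x"
  then have *: "expr_val a s = e' (f x)" by (rule assms(1))
  show "\<exists>t s'. exec (Assign 0 a) s t s' \<and> s' 0 = e' (f x) \<and> (\<forall>v\<ge>1. s' v = s v) \<and>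
      t \<le> 1 + size (e' (f x))"
    by (intro exI conjI, rule exec_Assign) (use * in auto)
qed

lemma size_subtree_le: "size (left_subtree d) \<le> size d" "size (right_subtree d) \<le> size d"
  by (cases d; simp)+

lemma ptime_left_subtree: "ptime enc_tree enc_tree left_subtree"
  by (rule ptime_tree_expr[where a = "Left_Of 0"])
    (auto simp: enc_tree_def size_subtree_le intro: pbounded_mono[OF pbounded_input])

lemma ptime_right_subtree: "ptime enc_tree enc_tree right_subtree"
  by (rule ptime_tree_expr[where a = "Right_Of 0"])
    (auto simp: enc_tree_def size_subtree_le intro: pbounded_mono[OF pbounded_input])

lemma ptime_Leaf: "ptime e enc_tree (\<lambda>x. Leaf)"
  by (rule ptime_tree_expr[where a = Const_Leaf]) (auto simp: enc_tree_def intro: pbounded_const)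

text \<open>The input is saved in variable m and the value of f in variable m + 1, and the input is
  restored before the second run. Both survive because the subroutines keep all variables from m
  on.\<close>

lemma ptime_Node:
  assumes f: "ptime e enc_tree f" and g: "ptime e enc_tree g"
  shows "ptime e enc_tree (\<lambda>x. Node (f x) (g x))"
proof -
  obtain c p m1 where c: "\<And>m (s :: store) x. m \<ge> m1 \<Longrightarrow> s 0 = e x \<Longrightarrow>
     runs c s (f x) m (poly p (size (e x)))"
    by (rule ptimeE[OF f, unfolded enc_tree_def]) (rule that)
  obtain d q m2 where d: "\<And>m (s :: store) x. m \<ge> m2 \<Longrightarrow> s 0 = e x \<Longrightarrow>
     runs d s (g x) m (poly q (size (e x)))"
    by (rule ptimeE[OF g, unfolded enc_tree_def]) (rule that)
  define m where "m = Suc (max m1 m2)"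
  let ?c = "Seq (Assign m (Copy 0)) (Seq c (Seq (Assign (Suc m) (Copy 0)) (Seq (Assign 0 (Copy m))
    (Seq d (Assign 0 (Pair_Up (Suc m) 0))))))"
  show ?thesis
  proof (rule ptimeI'[where c = ?c and m = "Suc (Suc m)"])
    show "pbounded e (\<lambda>x. 4 + 2 * size (e x) + poly p (size (e x)) + poly q (size (e x))
        + 2 * size (f x) + size (g x) + 1)"
      using pbounded_output[OF f, unfolded enc_tree_def] pbounded_output[OF g, unfolded enc_tree_def]
      by (intro pbounded_add pbounded_mult pbounded_poly pbounded_input
          pbounded_const) simp_all
  next
    fix s :: store and x assume s: "s 0 = e x"
    have m: "m > 0" and mm: "m1 \<le> m" "m2 \<le> m" by (simp_all add: m_def)
    obtain t1 s1 where 1: "exec c (s(m := e x)) t1 s1" "s1 0 = f x" "\<forall>v\<ge>m. s1 v = (s(m := e x)) v"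
      "t1 \<le> poly p (size (e x))" using c[of m "s(m := e x)" x] s m mm by auto
    define s2 where "s2 = s1(Suc m := f x, 0 := e x)"
    obtain t3 s3 where 3: "exec d s2 t3 s3" "s3 0 = g x" "\<forall>v\<ge>m. s3 v = s2 v"
      "t3 \<le> poly q (size (e x))" using d[of m s2 x] mm by (auto simp: s2_def)
    have a1: "exec (Assign m (Copy 0)) s (1 + size (e x)) (s(m := e x))"
      using exec_Assign[of m "Copy 0" s] s by simp
    have a2: "exec (Assign (Suc m) (Copy 0)) s1 (1 + size (f x)) (s1(Suc m := f x))"
      using exec_Assign[of "Suc m" "Copy 0" s1] 1 by simp
    have a3: "exec (Assign 0 (Copy m)) (s1(Suc m := f x)) (1 + size (e x)) s2"
      using exec_Assign[of 0 "Copy m" "s1(Suc m := f x)"] 1 m unfolding s2_def by simp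
    have a4: "exec (Assign 0 (Pair_Up (Suc m) 0)) s3 (1 + size (Node (f x) (g x)))
        (s3(0 := Node (f x) (g x)))"
      using exec_Assign[of 0 "Pair_Up (Suc m) 0" s3] 3 m unfolding s2_def by simp
    note ex = exec_Seq[OF a1 exec_Seq[OF 1(1) exec_Seq[OF a2 exec_Seq[OF a3 exec_Seq[OF 3(1) a4]]]]]
    show "runs ?c s (enc_tree (Node (f x) (g x))) (Suc (Suc m))
      (4 + 2 * size (e x) + poly p (size (e x)) + poly q (size (e x)) + 2 * size (f x) + size (g x) + 1)"
      by (intro exI conjI, rule ex) (use 1 3 in \<open>auto simp: s2_def enc_tree_def\<close>)
  qed
qed

lemma ptime_tree_If:
  assumes b: "ptime e enc_tree b" and f: "ptime e e' f" and g: "ptime e e' g"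
  shows "ptime e e' (\<lambda>x. if b x \<noteq> Leaf then f x else g x)"
proof -
  obtain a r m0 where a: "\<And>m (s :: store) x. m \<ge> m0 \<Longrightarrow> s 0 = e x \<Longrightarrow>
     runs a s (b x) m (poly r (size (e x)))"
    by (rule ptimeE[OF b, unfolded enc_tree_def]) (rule that)
  obtain c p m1 where c: "\<And>m (s :: store) x. m \<ge> m1 \<Longrightarrow> s 0 = e x \<Longrightarrow>
     runs c s (e' (f x)) m (poly p (size (e x)))"
    by (rule ptimeE[OF f]) (rule that)
  obtain d q m2 where d: "\<And>m (s :: store) x. m \<ge> m2 \<Longrightarrow> s 0 = e x \<Longrightarrow>
     runs d s (e' (g x)) m (poly q (size (e x)))"
    by (rule ptimeE[OF g]) (rule that)
  define m where "m = Suc (max m0 (max m1 m2))"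
  let ?c = "Seq (Assign m (Copy 0)) (Seq a (Seq (Assign (Suc m) (Copy 0)) (Seq (Assign 0 (Copy m))
    (Cond (Suc m) c d))))"
  show ?thesis
  proof (rule ptimeI'[where c = ?c and m = "Suc (Suc m)"])
    show "pbounded e (\<lambda>x. 4 + 2 * size (e x) + size (b x) + poly r (size (e x))
        + poly p (size (e x)) + poly q (size (e x)))"
      using pbounded_output[OF b, unfolded enc_tree_def]
      by (intro pbounded_add pbounded_mult pbounded_poly pbounded_input
          pbounded_const) simp_all
  next
    fix s :: store and x assume s: "s 0 = e x"
    have m: "m > 0" and mm: "m0 \<le> m" "m1 \<le> m" "m2 \<le> m" by (simp_all add: m_def)
    obtain t1 s1 where 1: "exec a (s(m := e x)) t1 s1" "s1 0 = b x" "\<forall>v\<ge>m. s1 v = (s(m := e x)) v"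
      "t1 \<le> poly r (size (e x))" using a[of m "s(m := e x)" x] s m mm by auto
    define s2 where "s2 = s1(Suc m := b x, 0 := e x)"
    have s2: "s2 0 = e x" "s2 (Suc m) = b x" by (simp_all add: s2_def)
    obtain t3 s3 where 3: "exec (Cond (Suc m) c d) s2 (1 + t3) s3"
      "s3 0 = e' (if b x \<noteq> Leaf then f x else g x)" "\<forall>v\<ge>m. s3 v = s2 v"
      "t3 \<le> poly p (size (e x)) + poly q (size (e x))"
    proof (cases "b x = Leaf")
      case True
      obtain t3 s3 where "exec d s2 t3 s3" "s3 0 = e' (g x)" "\<forall>v\<ge>m. s3 v = s2 v"
        "t3 \<le> poly q (size (e x))" using d[of m s2 x] s2 mm by auto
      with True show ?thesis using exec_Cond_False[of s2 "Suc m" d] s2 by (intro that[of t3 s3]) auto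
    next
      case False
      obtain t3 s3 where "exec c s2 t3 s3" "s3 0 = e' (f x)" "\<forall>v\<ge>m. s3 v = s2 v"
        "t3 \<le> poly p (size (e x))" using c[of m s2 x] s2 mm by auto
      with False show ?thesis using exec_Cond_True[of s2 "Suc m" c] s2 by (intro that[of t3 s3]) auto
    qed
    have a1: "exec (Assign m (Copy 0)) s (1 + size (e x)) (s(m := e x))"
      using exec_Assign[of m "Copy 0" s] s by simp
    have a2: "exec (Assign (Suc m) (Copy 0)) s1 (1 + size (b x)) (s1(Suc m := b x))"
      using exec_Assign[of "Suc m" "Copy 0" s1] 1 by simp
    have a3: "exec (Assign 0 (Copy m)) (s1(Suc m := b x)) (1 + size (e x)) s2"
      using exec_Assign[of 0 "Copy m" "s1(Suc m := b x)"] 1 m unfolding s2_def by simp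
    note ex = exec_Seq[OF a1 exec_Seq[OF 1(1) exec_Seq[OF a2 exec_Seq[OF a3 3(1)]]]]
    show "runs ?c s (e' (if b x \<noteq> Leaf then f x else g x)) (Suc (Suc m))
      (4 + 2 * size (e x) + size (b x) + poly r (size (e x)) + poly p (size (e x)) + poly q (size (e x)))"
      by (intro exI conjI, rule ex) (use 1 3 in \<open>auto simp: s2_def enc_tree_def\<close>)
  qed
qed

lemma enc_list_simps [simp]: "enc_list e [] = Leaf" "enc_list e (x # xs) = Node (e x) (enc_list e xs)"
  by (simp_all add: enc_list_def)

lemma size_enc_list: "size (enc_list e xs) = (\<Sum>x\<leftarrow>xs. Suc (size (e x)))"
  by (induction xs) auto

text \<open>A polynomial-time step that is iterated over a list may let its accumulator grow
  exponentially; therefore a polynomial bound h on all intermediate accumulators is assumed. The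
  step also receives the whole input d as its environment.\<close>

lemma ptime_foldl:
  assumes xs: "ptime e (enc_list e1) xs" and z: "ptime e e2 z"
    and g: "ptime (enc_pair e1 (enc_pair e2 e)) e2 (\<lambda>p. g (snd (snd p)) (fst (snd p)) (fst p))"
    and h: "pbounded e h"
    and bound: "\<And>d ys zs. xs d = ys @ zs \<Longrightarrow> size (e2 (foldl (g d) (z d) ys)) \<le> h d"
  shows "ptime e e2 (\<lambda>d. foldl (g d) (z d) (xs d))"
proof -
  \<comment> \<open>The start state of the loop in one tree: list, initial accumulator,
    environment.\<close>
  define E where "E = (\<lambda>d. Node (enc_list e1 (xs d)) (Node (e2 (z d)) (e d)))"
  have E: "ptime e enc_tree E"
    unfolding E_def
    by (intro ptime_Node ptime_encoded[OF xs] ptime_encoded[OF z]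
        ptime_encoded[OF ptime_id, of e])
  obtain c q m0 where c: "\<And>m (s :: store) p. m \<ge> m0 \<Longrightarrow> s 0 = enc_pair e1 (enc_pair e2 e) p \<Longrightarrow>
     runs c s (e2 (g (snd (snd p)) (fst (snd p)) (fst p))) m
       (poly q (size (enc_pair e1 (enc_pair e2 e) p)))"
    by (rule ptimeE[OF g]) (rule that)
  define m where "m = Suc m0"
  \<comment> \<open>Registers for the rest of the list, the accumulator and the environment. The
    subroutine c does not change them, as it keeps all variables from m on.\<close>
  let ?L = m and ?A = "Suc m" and ?D = "Suc (Suc m)"
  let ?body = "Seq (Assign 0 (Pair_Up ?A ?D)) (Seq (Assign ?A (Left_Of ?L)) (Seq (Assign 0 (Pair_Up ?A 0))
     (Seq c (Seq (Assign ?A (Copy 0)) (Assign ?L (Right_Of ?L))))))"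
  \<comment> \<open>Bounds the argument of the subroutine, the code of the triple (x, a, d); the 2
    counts its two pairing nodes.\<close>
  let ?B = "\<lambda>d. size (enc_list e1 (xs d)) + h d + size (e d) + 2"
  define T where "T = (\<lambda>d. 7 + 6 * ?B d + poly q (?B d))"
  \<comment> \<open>The inequality is strict because one unit of \<open>T d\<close> pays for the
    test of the loop.\<close>
  have step: "\<exists>t s'. exec ?body s t s' \<and> s' ?L = enc_list e1 xs' \<and> s' ?A = e2 (g d a x) \<and> s' ?D = e d
       \<and> (\<forall>v>?D. s' v = s v) \<and> t < T d"
    if "s ?L = enc_list e1 (x # xs')" "s ?A = e2 a" "s ?D = e d" "size (e2 a) \<le> h d" "size (e2 (g d a x)) \<le> h d"
      "size (enc_list e1 (x # xs')) \<le> size (enc_list e1 (xs d))"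
    for s x xs' a d
  proof -
    define s1 where "s1 = s(0 := Node (e2 a) (e d))"
    define s2 where "s2 = s1(?A := e1 x)"
    define s3 where "s3 = s2(0 := enc_pair e1 (enc_pair e2 e) (x, a, d))"
    have "s3 0 = enc_pair e1 (enc_pair e2 e) (x, a, d)" by (simp add: s3_def)
    then obtain t4 s4 where 4: "exec c s3 t4 s4" "s4 0 = e2 (g d a x)" "\<forall>v\<ge>m. s4 v = s3 v"
       "t4 \<le> poly q (size (enc_pair e1 (enc_pair e2 e) (x, a, d)))"
      using c[of m s3 "(x, a, d)"] unfolding m_def by auto
    have sz: "size (enc_pair e1 (enc_pair e2 e) (x, a, d)) \<le> ?B d"
      using that by (simp add: enc_pair_def)
    define s5 where "s5 = s4(?A := e2 (g d a x))"
    define s6 where "s6 = s5(?L := enc_list e1 xs')"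
    have m: "m > 0" by (simp add: m_def)
    have a1: "exec (Assign 0 (Pair_Up ?A ?D)) s (1 + size (Node (e2 a) (e d))) s1"
      using exec_Assign[of 0 "Pair_Up ?A ?D" s] that by (simp add: s1_def)
    have a2: "exec (Assign ?A (Left_Of ?L)) s1 (1 + size (e1 x)) s2"
      using exec_Assign[of ?A "Left_Of ?L" s1] that m by (simp add: s1_def s2_def)
    have a3: "exec (Assign 0 (Pair_Up ?A 0)) s2 (1 + size (enc_pair e1 (enc_pair e2 e) (x, a, d))) s3"
      using exec_Assign[of 0 "Pair_Up ?A 0" s2] that m by (simp add: s1_def s2_def s3_def enc_pair_def)
    have a5: "exec (Assign ?A (Copy 0)) s4 (1 + size (e2 (g d a x))) s5"
      using exec_Assign[of ?A "Copy 0" s4] 4 by (simp add: s5_def)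
    have s5: "s5 ?L = enc_list e1 (x # xs')"
      using that m 4 by (simp add: s5_def s3_def s2_def s1_def)
    have a6: "exec (Assign ?L (Right_Of ?L)) s5 (1 + size (enc_list e1 xs')) s6"
      using exec_Assign[of ?L "Right_Of ?L" s5] s5 by (simp add: s6_def)
    note ex = exec_Seq[OF a1 exec_Seq[OF a2 exec_Seq[OF a3 exec_Seq[OF 4(1) exec_Seq[OF a5 a6]]]]]
    have t4: "t4 \<le> poly q (?B d)"
      using 4(4) poly_nat_mono[OF sz] by (rule order_trans)
    have st: "s6 ?L = enc_list e1 xs' \<and> s6 ?A = e2 (g d a x) \<and> s6 ?D = e d \<and> (\<forall>v>?D. s6 v = s v)"
      using that(1-3) m 4(3) by (simp add: s1_def s2_def s3_def s5_def s6_def)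
    have "size (e2 a) + size (e d) + 1 \<le> ?B d" "size (e1 x) \<le> ?B d" "size (enc_list e1 xs') \<le> ?B d"
      "size (e2 (g d a x)) \<le> ?B d"
      using that(4-6) by simp_all
    with t4 sz have tm: "1 + size (Node (e2 a) (e d)) + (1 + size (e1 x) +
       (1 + size (enc_pair e1 (enc_pair e2 e) (x, a, d)) + (t4 + (1 + size (e2 (g d a x)) + (1 + size (enc_list e1 xs')))))) < T d"
      unfolding T_def by simp
    show ?thesis using ex st tm by blast
  qed
  have loop: "\<exists>t s'. exec (While ?L ?body) s t s' \<and> s' ?A = e2 (foldl (g d) a xs')
       \<and> (\<forall>v>?D. s' v = s v) \<and> t \<le> Suc (length xs' * T d)"
    if "s ?L = enc_list e1 xs'" "s ?A = e2 a" "s ?D = e d"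
      "size (enc_list e1 xs') \<le> size (enc_list e1 (xs d))"
      "\<And>ys zs. xs' = ys @ zs \<Longrightarrow> size (e2 (foldl (g d) a ys)) \<le> h d"
    for s xs' a d
    using that
  proof (induction xs' arbitrary: s a)
    case Nil
    have "exec (While ?L ?body) s 1 s" by (rule exec_While_False) (use Nil in auto)
    then show ?case by (intro exI[of _ 1] exI[of _ s]) (use Nil in auto)
  next
    case (Cons x xs')
    have "size (e2 (foldl (g d) a [])) \<le> h d" "size (e2 (foldl (g d) a [x])) \<le> h d"
      by (rule Cons.prems(5)[of _ "x # xs'"], simp) (rule Cons.prems(5)[of _ xs'], simp)
    then obtain t1 s1 where 1: "exec ?body s t1 s1" "s1 ?L = enc_list e1 xs'" "s1 ?A = e2 (g d a x)"
      "s1 ?D = e d" "\<forall>v>?D. s1 v = s v" "t1 < T d"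
      using step[OF Cons.prems(1-3)] Cons.prems(4) by auto
    obtain t2 s2 where 2: "exec (While ?L ?body) s1 t2 s2" "s2 ?A = e2 (foldl (g d) (g d a x) xs')"
       "\<forall>v>?D. s2 v = s1 v" "t2 \<le> Suc (length xs' * T d)"
    proof -
      have "size (e2 (foldl (g d) (g d a x) ys)) \<le> h d" if "xs' = ys @ zs" for ys zs
        using Cons.prems(5)[of "x # ys" zs] that by simp
      moreover have "size (enc_list e1 xs') \<le> size (enc_list e1 (xs d))"
        using Cons.prems(4) by simp
      ultimately show ?thesis
        using Cons.IH[OF 1(2-4)] that by blast
    qed
    have "s ?L \<noteq> Leaf" using Cons.prems(1) by simp
    note ex = exec_While_True[OF this 1(1) 2(1)]
    show ?case by (intro exI conjI, rule ex) (use 1 2 in auto)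
  qed
  have main: "ptime E e2 (\<lambda>d. foldl (g d) (z d) (xs d))"
  proof -
    let ?pre = "Seq (Assign ?L (Left_Of 0)) (Seq (Assign ?D (Right_Of 0)) (Seq (Assign ?A (Left_Of ?D)) (Assign ?D (Right_Of ?D))))"
    let ?prog = "Seq ?pre (Seq (While ?L ?body) (Assign 0 (Copy ?A)))"
    \<comment> \<open>The tree \<open>e d\<close> is a part of \<open>E d\<close>, so a bound in
      terms of the former is one in terms of the latter.\<close>
    have bE: "pbounded E k" if k: "pbounded e k" for k
    proof -
      obtain q where "\<And>x. k x \<le> poly q (size (e x))" using k by (auto simp: pbounded_def)
      moreover have "poly q (size (e x)) \<le> poly q (size (E x))" for x
        by (rule poly_nat_mono) (simp add: E_def)
      ultimately show ?thesis unfolding pbounded_def by (meson order_trans)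
    qed
    have sE: "pbounded e (\<lambda>x. size (E x))" using pbounded_output[OF E] by (simp add: enc_tree_def)
    have len: "length ys \<le> size (enc_list e1 ys)" for ys by (induction ys) auto
    show ?thesis
    proof (rule ptimeI'[where c = ?prog and m = "Suc ?D"])
      show "pbounded E (\<lambda>x. 6 + 4 * size (E x) + size (E x) * T x + h x)"
        unfolding T_def
        by (intro bE pbounded_add pbounded_mult pbounded_const sE pbounded_poly h
            pbounded_input pbounded_output[OF xs])
    next
      fix s :: store and d assume s: "s 0 = E d"
      let ?X = "enc_list e1 (xs d)" and ?Z = "e2 (z d)" and ?R = "e2 (foldl (g d) (z d) (xs d))"
      let ?s = "s(?L := ?X, ?D := e d, ?A := ?Z)"
      have m: "m > 0" by (simp add: m_def)
      have a1: "exec (Assign ?L (Left_Of 0)) s (1 + size ?X) (s(?L := ?X))"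
        using exec_Assign[of ?L "Left_Of 0" s] s by (simp add: E_def)
      have a2: "exec (Assign ?D (Right_Of 0)) (s(?L := ?X)) (1 + size (Node ?Z (e d)))
          (s(?L := ?X, ?D := Node ?Z (e d)))"
        using exec_Assign[of ?D "Right_Of 0" "s(?L := ?X)"] s m by (simp add: E_def)
      have a3: "exec (Assign ?A (Left_Of ?D)) (s(?L := ?X, ?D := Node ?Z (e d)))
          (1 + size ?Z) (s(?L := ?X, ?D := Node ?Z (e d), ?A := ?Z))"
        using exec_Assign[of ?A "Left_Of ?D" "s(?L := ?X, ?D := Node ?Z (e d))"] by simp
      have a4: "exec (Assign ?D (Right_Of ?D)) (s(?L := ?X, ?D := Node ?Z (e d), ?A := ?Z))
          (1 + size (e d)) ?s"
        using exec_Assign[of ?D "Right_Of ?D" "s(?L := ?X, ?D := Node ?Z (e d), ?A := ?Z)"]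
        by (simp add: fun_upd_twist)
      obtain t s' where 5: "exec (While ?L ?body) ?s t s'" "s' ?A = ?R"
         "\<forall>v>?D. s' v = ?s v" "t \<le> Suc (length (xs d) * T d)"
        using loop[of ?s "xs d" "z d" d] bound[of d] by auto
      have a6: "exec (Assign 0 (Copy ?A)) s' (1 + size ?R)
          (s'(0 := ?R))"
        using exec_Assign[of 0 "Copy ?A" s'] 5 by simp
      note ex = exec_Seq[OF exec_Seq[OF a1 exec_Seq[OF a2 exec_Seq[OF a3 a4]]] exec_Seq[OF 5(1) a6]]
      have "length (xs d) * T d \<le> size (E d) * T d"
        using len[of "xs d"] by (intro mult_right_mono) (simp_all add: E_def)
      moreover have "size ?R \<le> h d" using bound[of d "xs d" "[]"] by simp
      moreover have "size ?X + 2 * size ?Z + 2 * size (e d) \<le> 2 * size (E d)"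
        by (simp add: E_def)
      ultimately have tm: "1 + size ?X + (1 + size (Node ?Z (e d)) +
          (1 + size ?Z + (1 + size (e d)))) + (t + (1 + size ?R))
          \<le> 6 + 4 * size (E d) + size (E d) * T d + h d"
        using 5(4) by (simp add: E_def)
      have st: "\<forall>v\<ge>Suc ?D. (s'(0 := ?R)) v = s v"
        using 5(3) by simp
      show "runs ?prog s ?R (Suc ?D)
          (6 + 4 * size (E d) + size (E d) * T d + h d)"
        using ex st tm by (intro exI[of _ "s'(0 := ?R)"] exI conjI) auto
    qed
  qed
  have "ptime e E (\<lambda>d. d)"
    by (rule ptime_cong[OF E]) (simp_all add: enc_tree_def)
  then show ?thesis
    using main by (rule ptime_comp)
qed

section \<open>Booleans, pairs, finite tables and lists\<close>

lemma ptime_decode: "ptime e enc_tree (\<lambda>x. e' (f x)) \<Longrightarrow> ptime e e' f"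
  by (simp add: ptime_def enc_tree_def)

lemmas ptime_left = ptime_comp[OF _ ptime_left_subtree]

lemmas ptime_right = ptime_comp[OF _ ptime_right_subtree]

lemma ptime_tree: "ptime e enc_tree (\<lambda>_. d)"
  by (induction d) (auto intro: ptime_Leaf ptime_Node)

lemma ptime_const: "ptime e e' (\<lambda>_. c)"
  by (rule ptime_decode) (rule ptime_tree)

lemma ptime_Pair:
  assumes "ptime e a f" "ptime e b g"
  shows "ptime e (enc_pair a b) (\<lambda>x. (f x, g x))"
  by (rule ptime_cong[OF ptime_Node[OF assms[THEN ptime_encoded]]])
    (simp_all add: enc_pair_def enc_tree_def)

lemma ptime_fst:
  assumes "ptime e (enc_pair a b) f" shows "ptime e a (\<lambda>x. fst (f x))"
  by (rule ptime_cong[OF ptime_left[OF ptime_encoded[OF assms]]])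
    (simp_all add: enc_pair_def enc_tree_def)

lemma ptime_snd:
  assumes "ptime e (enc_pair a b) f" shows "ptime e b (\<lambda>x. snd (f x))"
  by (rule ptime_cong[OF ptime_right[OF ptime_encoded[OF assms]]])
    (simp_all add: enc_pair_def enc_tree_def)

lemma enc_bool_eq_Leaf [simp]: "enc_bool b = Leaf \<longleftrightarrow> \<not> b"
  by (simp add: enc_bool_def)

lemma ptime_If:
  assumes "ptime e enc_bool b" "ptime e e' f" "ptime e e' g"
  shows "ptime e e' (\<lambda>x. if b x then f x else g x)"
  using ptime_tree_If[OF ptime_encoded[OF assms(1)] assms(2,3)] by simp

lemma ptime_not_Leaf:
  assumes "ptime e enc_tree f" shows "ptime e enc_bool (\<lambda>x. f x \<noteq> Leaf)"
  by (rule ptime_cong[OF ptime_tree_If[OF assms ptime_const ptime_const,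
          of enc_bool True False]]) simp_all

lemma ptime_Not: "ptime e enc_bool b \<Longrightarrow> ptime e enc_bool (\<lambda>x. \<not> b x)"
  by (rule ptime_cong[OF ptime_If[of e b enc_bool "\<lambda>_. False" "\<lambda>_. True"]])
    (simp_all add: ptime_const)

lemma ptime_conj:
  "ptime e enc_bool b \<Longrightarrow> ptime e enc_bool c \<Longrightarrow> ptime e enc_bool (\<lambda>x. b x \<and> c x)"
  by (rule ptime_cong[OF ptime_If[of e b enc_bool c "\<lambda>_. False"]])
    (simp_all add: ptime_const)

lemma ptime_disj:
  "ptime e enc_bool b \<Longrightarrow> ptime e enc_bool c \<Longrightarrow> ptime e enc_bool (\<lambda>x. b x \<or> c x)"
  by (rule ptime_cong[OF ptime_If[of e b enc_bool "\<lambda>_. True" c]])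
    (simp_all add: ptime_const)

lemma ptime_tree_eq_const:
  "ptime e enc_tree f \<Longrightarrow> ptime e enc_bool (\<lambda>x. f x = d)"
proof (induction d arbitrary: f)
  case Leaf
  show ?case
    by (rule ptime_cong[OF ptime_Not[OF ptime_not_Leaf[OF Leaf]]]) simp_all
next
  case (Node l r)
  have "(\<lambda>x. f x = Node l r) = (\<lambda>x. f x \<noteq> Leaf \<and> left_subtree (f x) = l \<and> right_subtree (f x) = r)"
    by (rule ext, case_tac "f x") auto
  then show ?case
    using ptime_conj[OF ptime_not_Leaf[OF Node.prems]
        ptime_conj[OF Node.IH(1)[OF ptime_left[OF Node.prems]]
          Node.IH(2)[OF ptime_right[OF Node.prems]]]]
    by (simp only:)
qed

lemma ptime_lookup:
  assumes "finite S"
  shows "ptime e e' (\<lambda>x. if e x \<in> S then h (e x) else c)"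
  using assms
proof induction
  case empty
  then show ?case by (simp add: ptime_const)
next
  case (insert d S)
  have *: "(if e x \<in> insert d S then h (e x) else c) = (if e x = d then h d else if e x \<in> S then h (e x) else c)" for x
    by simp
  show ?case
    unfolding *
    by (rule ptime_If[OF ptime_tree_eq_const[OF ptime_encoded[OF ptime_id]]
        ptime_const insert.IH])
qed

text \<open>With finitely many codes, a function that depends only on the code of its argument is a
  table. The default \<open>undefined\<close> is never reached.\<close>

lemma ptime_finite:
  assumes "finite (range e)" and "\<And>x y. e x = e y \<Longrightarrow> e' (f x) = e' (f y)"
  shows "ptime e e' f"
proof (rule ptime_cong[OF ptime_lookup[OF assms(1), of e e' "\<lambda>d. f (inv_into UNIV e d)" undefined]])
  fix x
  have "e (inv_into UNIV e (e x)) = e x" by (rule f_inv_into_f) simp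
  from assms(2)[OF this]
  show "e' (if e x \<in> range e then f (inv_into UNIV e (e x)) else undefined) = e' (f x)"
    by simp
qed simp

lemma ptime_Cons:
  assumes "ptime e a f" "ptime e (enc_list a) g"
  shows "ptime e (enc_list a) (\<lambda>x. f x # g x)"
  by (rule ptime_cong[OF ptime_Node[OF assms[THEN ptime_encoded]]])
    (simp_all add: enc_tree_def)

lemma enc_list_eq_Leaf [simp]: "enc_list a xs = Leaf \<longleftrightarrow> xs = []"
  by (cases xs) auto

lemma ptime_case_list:
  assumes f: "ptime e (enc_list a) f" and g: "ptime e b g"
    and h: "ptime (enc_pair a (enc_pair (enc_list a) e)) b (\<lambda>p. h (fst p) (fst (snd p)) (snd (snd p)))"
  shows "ptime e b (\<lambda>x. case f x of [] \<Rightarrow> g x | y # ys \<Rightarrow> h y ys x)"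
proof -
  \<comment> \<open>Both parts of a branching must be computable on all inputs, so an empty list is
    padded with an arbitrary head.\<close>
  obtain u where u: "u = (\<lambda>x. if f x = [] then (undefined, [], x) else (hd (f x), tl (f x), x))"
    by blast
  note f' = ptime_encoded[OF f]
  have "ptime e enc_tree (\<lambda>x. if enc_list a (f x) \<noteq> Leaf
      then Node (left_subtree (enc_list a (f x))) (Node (right_subtree (enc_list a (f x))) (e x))
      else Node (a undefined) (Node Leaf (e x)))"
    by (rule ptime_tree_If[OF f' ptime_Node[OF ptime_left[OF f']
        ptime_Node[OF ptime_right[OF f']]] ptime_Node[OF ptime_tree
        ptime_Node[OF ptime_tree]]])
      (rule ptime_encoded[OF ptime_id])+
  then have "ptime e (enc_pair a (enc_pair (enc_list a) e)) u"
    by (rule ptime_cong) (auto simp: u enc_pair_def enc_tree_def neq_Nil_conv split: if_splits)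
  from ptime_comp[OF this h]
  have "ptime e b (\<lambda>x. h (fst (u x)) (fst (snd (u x))) (snd (snd (u x))))" .
  from ptime_tree_If[OF f' this g] show ?thesis
    by (rule ptime_cong) (auto simp: u split: list.splits)
qed

lemma size_enc_list_append: "size (enc_list a (xs @ ys)) = size (enc_list a xs) + size (enc_list a ys)"
  by (simp add: size_enc_list)

lemma size_enc_list_rev: "size (enc_list a (rev xs)) = size (enc_list a xs)"
  by (simp add: size_enc_list rev_map[symmetric])

lemma length_le_size_enc_list: "length xs \<le> size (enc_list a xs)"
  by (induction xs) auto

lemma member_size_enc_list: "x \<in> set xs \<Longrightarrow> size (a x) \<le> size (enc_list a xs)"
  by (induction xs) auto

lemma foldl_Cons: "foldl (\<lambda>ys x. f x # ys) ys xs = rev (map f xs) @ ys"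
  by (induction xs arbitrary: ys) auto

lemma ptime_rev_append:
  assumes f: "ptime e (enc_list a) f" and g: "ptime e (enc_list a) g"
  shows "ptime e (enc_list a) (\<lambda>x. rev (f x) @ g x)"
proof -
  have "ptime e (enc_list a) (\<lambda>x. foldl (\<lambda>ys y. y # ys) (g x) (f x))"
  proof (rule ptime_foldl[OF f g, where h = "\<lambda>x. size (enc_list a (f x)) + size (enc_list a (g x))"])
    show "pbounded e (\<lambda>x. size (enc_list a (f x)) + size (enc_list a (g x)))"
      by (intro pbounded_add pbounded_output f g)
    show "ptime (enc_pair a (enc_pair (enc_list a) e)) (enc_list a) (\<lambda>p. fst p # fst (snd p))"
      by (rule ptime_Cons, rule ptime_fst, rule ptime_id,
          rule ptime_fst, rule ptime_snd, rule ptime_id)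
  qed (simp add: foldl_Cons[of "\<lambda>x. x", simplified] size_enc_list_append size_enc_list_rev)
  then show ?thesis
    by (simp add: foldl_Cons[of "\<lambda>x. x", simplified])
qed

lemma ptime_rev: "ptime e (enc_list a) f \<Longrightarrow> ptime e (enc_list a) (\<lambda>x. rev (f x))"
  using ptime_rev_append[of e a f "\<lambda>_. []"] by (simp add: ptime_const)

lemma ptime_append:
  "ptime e (enc_list a) f \<Longrightarrow> ptime e (enc_list a) g \<Longrightarrow> ptime e (enc_list a) (\<lambda>x. f x @ g x)"
  using ptime_rev_append[OF ptime_rev[of e a f], of g] by simp

lemma ptime_foldr:
  assumes xs: "ptime e (enc_list e1) xs" and z: "ptime e e2 z"
    and g: "ptime (enc_pair e1 (enc_pair e2 e)) e2 (\<lambda>p. g (snd (snd p)) (fst p) (fst (snd p)))"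
    and h: "pbounded e h"
    and bound: "\<And>d ys zs. xs d = ys @ zs \<Longrightarrow> size (e2 (foldr (g d) zs (z d))) \<le> h d"
  shows "ptime e e2 (\<lambda>d. foldr (g d) (xs d) (z d))"
proof -
  have "ptime e e2 (\<lambda>d. foldl (\<lambda>y x. g d x y) (z d) (rev (xs d)))"
  proof (rule ptime_foldl[OF ptime_rev[OF xs] z g h])
    fix d ys zs assume "rev (xs d) = ys @ zs"
    then have "rev (rev (xs d)) = rev zs @ rev ys" by (simp only: rev_append)
    then have "xs d = rev zs @ rev ys" by simp
    from bound[OF this] show "size (e2 (foldl (\<lambda>y x. g d x y) (z d) ys)) \<le> h d"
      by (simp add: foldr_conv_foldl)
  qed
  then show ?thesis by (simp add: foldr_conv_foldl)
qed

lemma pbounded_sum_list: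
  assumes xs: "ptime e (enc_list a) xs" and h: "pbounded (enc_pair a e) h"
  shows "pbounded e (\<lambda>d. \<Sum>x\<leftarrow>xs d. h (x, d))"
proof -
  obtain q where q: "\<And>p. h p \<le> poly q (size (enc_pair a e p))"
    using h unfolding pbounded_def by auto
  let ?B = "\<lambda>d. size (enc_list a (xs d)) + size (e d) + 1"
  have "(\<Sum>x\<leftarrow>xs d. h (x, d)) \<le> size (enc_list a (xs d)) * poly q (?B d)" for d
  proof -
    have "h (x, d) \<le> poly q (?B d)" if "x \<in> set (xs d)" for x
    proof -
      have "size (enc_pair a e (x, d)) \<le> ?B d"
        using member_size_enc_list[OF that, of a] by (simp add: enc_pair_def)
      from order_trans[OF q poly_nat_mono[OF this]] show ?thesis .
    qed
    then have "(\<Sum>x\<leftarrow>xs d. h (x, d)) \<le> (\<Sum>x\<leftarrow>xs d. poly q (?B d))"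
      by (rule sum_list_mono)
    also have "\<dots> = length (xs d) * poly q (?B d)"
      by (simp add: sum_list_triv)
    finally show ?thesis
      using mult_right_mono[OF length_le_size_enc_list[of "xs d" a], of "poly q (?B d)"] by linarith
  qed
  then show ?thesis
    by (rule pbounded_mono[rotated])
      (intro pbounded_mult pbounded_poly pbounded_add pbounded_output[OF xs]
        pbounded_input pbounded_const)
qed

lemma ptime_map:
  assumes xs: "ptime e (enc_list a) xs" and g: "ptime (enc_pair a e) b (\<lambda>p. g (snd p) (fst p))"
  shows "ptime e (enc_list b) (\<lambda>x. map (g x) (xs x))"
proof -
  have "ptime e (enc_list b) (\<lambda>x. foldl (\<lambda>ys y. g x y # ys) [] (xs x))"
  proof (rule ptime_foldl[OF xs ptime_const])
    show "pbounded e (\<lambda>d. \<Sum>x\<leftarrow>xs d. (\<lambda>p. 1 + size (b (g (snd p) (fst p)))) (x, d))"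
      by (intro pbounded_sum_list[OF xs] pbounded_add pbounded_const pbounded_output[OF g])
    have "ptime (enc_pair a (enc_pair (enc_list b) e)) b (\<lambda>p. (\<lambda>q. g (snd q) (fst q)) (fst p, snd (snd p)))"
      by (rule ptime_comp[OF _ g], rule ptime_Pair, rule ptime_fst, rule ptime_id,
          rule ptime_snd, rule ptime_snd, rule ptime_id)
    then show "ptime (enc_pair a (enc_pair (enc_list b) e)) (enc_list b)
       (\<lambda>p. g (snd (snd p)) (fst p) # fst (snd p))"
      by (simp, intro ptime_Cons) (assumption,
          rule ptime_fst, rule ptime_snd, rule ptime_id)
  qed (simp add: foldl_Cons size_enc_list_rev, simp add: size_enc_list comp_def)
  from ptime_rev[OF this] show ?thesis by (simp add: foldl_Cons)
qed

lemma ptime_concat: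
  assumes f: "ptime e (enc_list (enc_list a)) f"
  shows "ptime e (enc_list a) (\<lambda>x. concat (f x))"
proof -
  have le: "size (enc_list a (concat xss)) \<le> size (enc_list (enc_list a) xss)" for xss
    by (induction xss) (auto simp: size_enc_list_append)
  have "ptime e (enc_list a) (\<lambda>x. foldr (\<lambda>xs ys. xs @ ys) (f x) [])"
  proof (rule ptime_foldr[OF f ptime_const])
    show "pbounded e (\<lambda>x. size (enc_list (enc_list a) (f x)))"
      by (rule pbounded_output[OF f])
    show "ptime (enc_pair (enc_list a) (enc_pair (enc_list a) e)) (enc_list a) (\<lambda>p. fst p @ fst (snd p))"
      by (rule ptime_append, rule ptime_fst, rule ptime_id,
          rule ptime_fst, rule ptime_snd, rule ptime_id)
  next
    fix d ys zs assume "f d = ys @ zs"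
    then show "size (enc_list a (foldr (\<lambda>xs ys. xs @ ys) zs [])) \<le> size (enc_list (enc_list a) (f d))"
      using le[of zs] by (simp add: concat_conv_foldr[symmetric] size_enc_list_append)
  qed
  then show ?thesis by (simp add: concat_conv_foldr)
qed

text \<open>These rules follow the syntax of a function, so polynomial time is checked by backward
  chaining. Constants and the identity stand first and end the descent as early as possible.\<close>

lemmas ptime_rules =
  ptime_const ptime_id ptime_If ptime_Not ptime_conj ptime_disj
  ptime_Cons ptime_case_list ptime_rev ptime_append ptime_map
  ptime_concat ptime_Pair ptime_fst ptime_snd

lemma ptime_filter:
  assumes xs: "ptime e (enc_list a) xs"
    and g: "ptime (enc_pair a e) enc_bool (\<lambda>p. g (snd p) (fst p))"
  shows "ptime e (enc_list a) (\<lambda>x. filter (g x) (xs x))"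
proof -
  have "ptime e (enc_list a) (\<lambda>x. concat (map (\<lambda>y. if g x y then [y] else []) (xs x)))"
    by (rule xs g ptime_rules)+
  moreover have "concat (map (\<lambda>y. if g x y then [y] else []) ys) = filter (g x) ys" for x ys
    by (induction ys) auto
  ultimately show ?thesis by simp
qed

text \<open>A recursion whose step looks at the whole tail becomes a map over suffixes, to which the
  closure rule for maps applies.\<close>

fun nonempty_suffixes :: "'a list \<Rightarrow> 'a list list" where
  "nonempty_suffixes [] = []"
| "nonempty_suffixes (x # xs) = (x # xs) # nonempty_suffixes xs"

lemma ptime_nonempty_suffixes:
  fixes xs :: "'a \<Rightarrow> 'b list"
  assumes xs: "ptime e (enc_list a) xs"
  shows "ptime e (enc_list (enc_list a)) (\<lambda>x. nonempty_suffixes (xs x))"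
proof -
  \<comment> \<open>The first component rebuilds the list itself, which a plain fold would
    lose.\<close>
  let ?g = "\<lambda>x p. (x # fst p, (x # fst p) # snd p)"
  have eq: "foldr ?g ys ([], []) = (ys, nonempty_suffixes ys)" for ys :: "'b list"
    by (induction ys) auto
  have le: "size (enc_list (enc_list a) (nonempty_suffixes ys)) \<le> length ys * Suc (size (enc_list a ys))" for ys
  proof (induction ys)
    case (Cons y ys)
    have "length ys * Suc (size (enc_list a ys)) \<le> length ys * Suc (size (enc_list a (y # ys)))"
      by (intro mult_left_mono) simp_all
    with Cons show ?case by simp
  qed simp
  have "ptime e (enc_pair (enc_list a) (enc_list (enc_list a))) (\<lambda>x. foldr ?g (xs x) ([], []))"
  proof (rule ptime_foldr[OF xs ptime_const])
    show "pbounded e (\<lambda>d. 1 + size (enc_list a (xs d)) + size (enc_list a (xs d)) * (1 + size (enc_list a (xs d))))"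
      by (intro pbounded_add pbounded_mult pbounded_const pbounded_output[OF xs])
    show "ptime (enc_pair a (enc_pair (enc_pair (enc_list a) (enc_list (enc_list a))) e))
      (enc_pair (enc_list a) (enc_list (enc_list a))) (\<lambda>p. ?g (fst p) (fst (snd p)))"
      by (rule ptime_rules)+
  next
    fix d ys zs assume d: "xs d = ys @ zs"
    have "length zs * Suc (size (enc_list a zs)) \<le> size (enc_list a (xs d)) * Suc (size (enc_list a (xs d)))"
      using length_le_size_enc_list[of zs a] by (intro mult_mono) (auto simp: d size_enc_list_append)
    then show "size (enc_pair (enc_list a) (enc_list (enc_list a)) (foldr ?g zs ([], [])))
       \<le> 1 + size (enc_list a (xs d)) + size (enc_list a (xs d)) * (1 + size (enc_list a (xs d)))"
      using le[of zs] unfolding eq by (simp add: enc_pair_def d size_enc_list_append)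
  qed
  from ptime_snd[OF this] show ?thesis by (simp add: eq)
qed

text \<open>Finitely many codes have bounded size, so the bound on the accumulators comes for
  free.\<close>

lemma ptime_foldr_finite:
  assumes "ptime e (enc_list e1) xs" and "ptime e e2 z"
    and "ptime (enc_pair e1 (enc_pair e2 e)) e2 (\<lambda>p. g (snd (snd p)) (fst p) (fst (snd p)))"
    and "finite (range e2)"
  shows "ptime e e2 (\<lambda>d. foldr (g d) (xs d) (z d))"
proof (rule ptime_foldr[OF assms(1-3), where h = "\<lambda>_. Max (size ` range e2)"])
  show "pbounded e (\<lambda>_. Max (size ` range e2))" by (rule pbounded_const)
qed (use assms(4) in \<open>auto intro: Max_ge\<close>)

section \<open>Polynomial-time functions on numbers, equality tests and words\<close>

fun bits :: "nat \<Rightarrow> bool list" where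
  "bits n = (if n = 0 then [] else odd n # bits (n div 2))"

declare bits.simps [simp del]

lemma bits_0 [simp]: "bits 0 = []"
  by (simp add: bits.simps)

lemma enc_nat_eq_bits: "enc_nat n = enc_list enc_bool (bits n)"
proof (induction n rule: less_induct)
  case (less n)
  then show ?case by (subst enc_nat.simps, subst bits.simps) auto
qed

lemma ptime_bits: "ptime e enc_nat f \<Longrightarrow> ptime e (enc_list enc_bool) (\<lambda>x. bits (f x))"
  by (simp add: ptime_def enc_nat_eq_bits)

lemma ptime_of_bits: "ptime e (enc_list enc_bool) (\<lambda>x. bits (f x)) \<Longrightarrow> ptime e enc_nat f"
  by (simp add: ptime_def enc_nat_eq_bits)

lemma ptime_odd:
  assumes "ptime e enc_nat f" shows "ptime e enc_bool (\<lambda>x. odd (f x))"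
proof -
  have "left_subtree (enc_nat n) = enc_bool (odd n)" for n
    by (subst enc_nat.simps) (simp add: enc_bool_def)
  then show ?thesis
    by (intro ptime_cong[OF ptime_left[OF ptime_encoded[OF assms]]])
      (simp_all add: enc_tree_def)
qed

lemma bits_double: "bits (2 * n) = (if n = 0 then [] else False # bits n)"
  by (subst bits.simps) auto

lemma bits_double_Suc: "bits (Suc (2 * n)) = True # bits n"
  by (subst bits.simps) auto

lemma bits_eq_Nil [simp]: "bits n = [] \<longleftrightarrow> n = 0"
  by (subst bits.simps) auto

lemma ptime_double_Suc:
  assumes "ptime e enc_nat f" shows "ptime e enc_nat (\<lambda>x. Suc (2 * f x))"
  by (rule ptime_of_bits, unfold bits_double_Suc)
    (rule ptime_rules ptime_bits assms)+

lemma ptime_double: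
  assumes "ptime e enc_nat f" shows "ptime e enc_nat (\<lambda>x. 2 * f x)"
proof (rule ptime_of_bits)
  have "ptime e (enc_list enc_bool) (\<lambda>x. case bits (f x) of [] \<Rightarrow> [] | b # bs \<Rightarrow> False # b # bs)"
    by (rule ptime_rules ptime_bits assms)+
  then show "ptime e (enc_list enc_bool) (\<lambda>x. bits (2 * f x))"
    by (rule ptime_cong) (auto simp: bits_double split: list.splits)
qed

fun inc_bits :: "bool list \<Rightarrow> bool list" where
  "inc_bits [] = [True]"
| "inc_bits (b # bs) = (if b then False # inc_bits bs else True # bs)"

lemma bits_Suc: "bits (Suc n) = inc_bits (bits n)"
proof (induction n rule: less_induct)
  case (less n)
  show ?case
  proof (cases "even n")
    case True
    then obtain k where "n = 2 * k" by (auto elim: evenE)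
    then show ?thesis by (simp add: bits_double bits_double_Suc)
  next
    case False
    then obtain k where k: "n = Suc (2 * k)" by (auto elim: oddE)
    then have "bits (Suc n) = bits (2 * Suc k)" by simp
    then show ?thesis using less[of k] k by (simp add: bits_double bits_double_Suc del: mult_Suc_right)
  qed
qed

lemma ptime_Suc:
  assumes "ptime e enc_nat f" shows "ptime e enc_nat (\<lambda>x. Suc (f x))"
proof (rule ptime_of_bits)
  \<comment> \<open>The unchanged bits are carried along, since they are the answer behind the first
    zero, where the carry stops.\<close>
  let ?g = "\<lambda>b p. (if b then False # fst p else True # snd p, b # snd p)"
  have eq: "foldr ?g bs ([True], []) = (inc_bits bs, bs)" for bs
    by (induction bs) auto
  have len: "size (enc_list enc_bool (inc_bits bs)) \<le> 2 + size (enc_list enc_bool bs)" for bs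
    by (induction bs) (auto simp: enc_bool_def)
  note b = ptime_bits[OF assms]
  have "ptime e (enc_pair (enc_list enc_bool) (enc_list enc_bool)) (\<lambda>x. foldr ?g (bits (f x)) ([True], []))"
  proof (rule ptime_foldr[OF b ptime_const])
    show "pbounded e (\<lambda>x. 3 + 2 * size (enc_list enc_bool (bits (f x))))"
      by (intro pbounded_add pbounded_mult pbounded_const pbounded_output[OF b])
    show "ptime (enc_pair enc_bool (enc_pair (enc_pair (enc_list enc_bool) (enc_list enc_bool)) e))
       (enc_pair (enc_list enc_bool) (enc_list enc_bool)) (\<lambda>p. ?g (fst p) (fst (snd p)))"
      by (rule ptime_rules)+
  next
    fix d ys zs assume "bits (f d) = ys @ zs"
    then show "size (enc_pair (enc_list enc_bool) (enc_list enc_bool) (foldr ?g zs ([True], [])))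
      \<le> 3 + 2 * size (enc_list enc_bool (bits (f d)))"
      using len[of zs] unfolding eq by (simp add: enc_pair_def size_enc_list_append)
  qed
  from ptime_fst[OF this] show "ptime e (enc_list enc_bool) (\<lambda>x. bits (Suc (f x)))"
    by (simp only: eq bits_Suc fst_conv)
qed

text \<open>Crude, but sufficient for \<open>ptime_length\<close>, where the number itself is at
  most the size of the input.\<close>

lemma size_enc_nat_le: "size (enc_nat n) \<le> 2 * n"
proof (induction n rule: less_induct)
  case (less n)
  show ?case
  proof (cases "n = 0")
    case True
    then show ?thesis by (simp add: enc_nat.simps)
  next
    case False
    then have *: "size (enc_nat (n div 2)) \<le> 2 * (n div 2)" by (intro less) simp
    have "size (enc_nat n) = Suc (size (enc_bool (odd n)) + size (enc_nat (n div 2)))"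
      using False by (subst enc_nat.simps) simp
    moreover have "Suc (of_bool (odd n) + 2 * (n div 2)) \<le> 2 * n"
      using False by (auto elim!: oddE evenE)
    ultimately show ?thesis using * by (simp add: enc_bool_def split: if_splits)
  qed
qed

lemma ptime_length:
  assumes "ptime e (enc_list a) f" shows "ptime e enc_nat (\<lambda>x. length (f x))"
proof -
  have eq: "foldr (\<lambda>_. Suc) xs 0 = length xs" for xs :: "'z list"
    by (induction xs) auto
  have "ptime e enc_nat (\<lambda>x. foldr (\<lambda>_. Suc) (f x) 0)"
  proof (rule ptime_foldr[OF assms ptime_const])
    show "pbounded e (\<lambda>x. 2 * size (enc_list a (f x)))"
      by (intro pbounded_mult pbounded_const pbounded_output[OF assms])
    show "ptime (enc_pair a (enc_pair enc_nat e)) enc_nat (\<lambda>p. Suc (fst (snd p)))"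
      by (rule ptime_Suc ptime_rules)+
  next
    fix d ys zs assume "f d = ys @ zs"
    then show "size (enc_nat (foldr (\<lambda>_. Suc) zs 0)) \<le> 2 * size (enc_list a (f d))"
      using size_enc_nat_le[of "length zs"] length_le_size_enc_list[of zs a]
      by (simp add: eq size_enc_list_append)
  qed
  then show ?thesis by (simp only: eq)
qed

section \<open>Equality tests, membership and multiplicities\<close>

definition polytime_eq :: "('a \<Rightarrow> bintree) \<Rightarrow> bool" where
  "polytime_eq a \<longleftrightarrow> ptime (enc_pair a a) enc_bool (\<lambda>p. fst p = snd p)"

lemma ptime_eq:
  assumes "polytime_eq a" "ptime e a f" "ptime e a g"
  shows "ptime e enc_bool (\<lambda>x. f x = g x)"
  using ptime_comp[OF ptime_Pair[OF assms(2,3)] assms(1)[unfolded polytime_eq_def]] by simp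

lemma finite_range_enc_pair: "finite (range a) \<Longrightarrow> finite (range b) \<Longrightarrow> finite (range (enc_pair a b))"
  by (rule finite_subset[of _ "case_prod Node ` (range a \<times> range b)"]) (auto simp: enc_pair_def)

lemma polytime_eq_finite:
  assumes "inj a" "finite (range a)" shows "polytime_eq a"
  unfolding polytime_eq_def
  by (rule ptime_finite[OF finite_range_enc_pair[OF assms(2,2)]])
    (auto simp: enc_pair_def inj_eq[OF assms(1)])

lemma polytime_eq_bool: "polytime_eq enc_bool"
  by (rule polytime_eq_finite) (auto simp: inj_def)

lemma polytime_eq_list:
  assumes "polytime_eq a" shows "polytime_eq (enc_list a)"
proof -
  \<comment> \<open>The state tells whether all entries so far agreed, and holds the rest of the
    second list. If that list is too short the flag becomes \<open>False\<close>, if it is too long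
    a rest remains.\<close>
  let ?g = "\<lambda>p x. case snd p of [] \<Rightarrow> (False, []) | y # ys \<Rightarrow> (fst p \<and> x = y, ys)"
  have eq: "(fst (foldl ?g (b, ys) xs) \<and> snd (foldl ?g (b, ys) xs) = []) \<longleftrightarrow> b \<and> xs = ys" for b xs ys
  proof (induction xs arbitrary: b ys)
    case (Cons x xs)
    then show ?case by (cases ys) auto
  qed auto
  have len: "size (enc_list a (snd (foldl ?g (b, ys) xs))) \<le> size (enc_list a ys)" for b xs ys
  proof (induction xs arbitrary: b ys)
    case (Cons x xs)
    show ?case using Cons[of "b \<and> x = hd ys" "tl ys"] Cons[of False "[]"] by (cases ys) auto
  qed auto
  let ?e = "enc_pair (enc_list a) (enc_list a)"
  have "ptime ?e (enc_pair enc_bool (enc_list a)) (\<lambda>p. foldl ?g (True, snd p) (fst p))"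
  proof (rule ptime_foldl)
    show "ptime ?e (enc_list a) fst" "ptime ?e (enc_pair enc_bool (enc_list a)) (\<lambda>p. (True, snd p))"
      by (rule ptime_rules)+
    show "pbounded ?e (\<lambda>p. 2 + size (?e p))"
      by (intro pbounded_add pbounded_const pbounded_input)
    show "ptime (enc_pair a (enc_pair (enc_pair enc_bool (enc_list a)) ?e)) (enc_pair enc_bool (enc_list a))
       (\<lambda>p. ?g (fst (snd p)) (fst p))"
      by (rule ptime_eq[OF assms] ptime_rules)+
  next
    fix d ys zs
    show "size (enc_pair enc_bool (enc_list a) (foldl ?g (True, snd d) ys)) \<le> 2 + size (?e d)"
      using len[of True "snd d" ys] by (auto simp: enc_pair_def enc_bool_def)
  qed
  note st = this
  have "ptime ?e enc_bool (\<lambda>p. fst (foldl ?g (True, snd p) (fst p)) \<and>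
      \<not> (case snd (foldl ?g (True, snd p) (fst p)) of [] \<Rightarrow> False | _ # _ \<Rightarrow> True))"
    by (rule ptime_conj[OF ptime_fst[OF st] ptime_Not[OF
        ptime_case_list[OF ptime_snd[OF st] ptime_const ptime_const]]])
  moreover have "\<not> (case l of [] \<Rightarrow> False | _ # _ \<Rightarrow> True) \<longleftrightarrow> l = []" for l :: "'a list"
    by (cases l) auto
  ultimately show ?thesis
    unfolding polytime_eq_def by (simp only: eq simp_thms)
qed

lemma polytime_eq_nat: "polytime_eq enc_nat"
proof -
  have "inj bits" using inj_enc_nat by (auto simp: inj_def enc_nat_eq_bits)
  then have eq: "bits m = bits n \<longleftrightarrow> m = n" for m n by (auto dest: injD)
  have "ptime (enc_pair enc_nat enc_nat) enc_bool (\<lambda>p. bits (fst p) = bits (snd p))"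
    by (rule ptime_eq[OF polytime_eq_list[OF polytime_eq_bool]] ptime_bits ptime_rules)+
  then show ?thesis by (simp add: polytime_eq_def eq)
qed

lemma finite_range_enc_bool: "finite (range enc_bool)"
  by simp

lemma ptime_member:
  fixes xs :: "'a \<Rightarrow> 'b list"
  assumes "polytime_eq a" "ptime e a f" "ptime e (enc_list a) xs"
  shows "ptime e enc_bool (\<lambda>x. f x \<in> set (xs x))"
proof -
  have "ptime e enc_bool (\<lambda>x. foldr (\<lambda>y b. b \<or> f x = y) (xs x) False)"
  proof (rule ptime_foldr_finite[OF assms(3) ptime_const _ finite_range_enc_bool])
    have "ptime (enc_pair a (enc_pair enc_bool e)) a (\<lambda>p. f (snd (snd p)))"
      by (rule ptime_comp[OF _ assms(2)], (rule ptime_rules)+)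
    then show "ptime (enc_pair a (enc_pair enc_bool e)) enc_bool (\<lambda>p. fst (snd p) \<or> f (snd (snd p)) = fst p)"
      by (intro ptime_disj ptime_eq[OF assms(1)]) (assumption | rule ptime_rules)+
  qed
  moreover have "foldr (\<lambda>y b. b \<or> z = y) ys False \<longleftrightarrow> z \<in> set ys" for z :: 'b and ys
    by (induction ys) auto
  ultimately show ?thesis by (simp only:)
qed

lemma ptime_remdups:
  assumes "polytime_eq a" "ptime e (enc_list a) xs"
  shows "ptime e (enc_list a) (\<lambda>x. remdups (xs x))"
proof -
  let ?g = "\<lambda>y ys. if y \<in> set ys then ys else y # ys"
  have eq: "foldr ?g ys [] = remdups ys" for ys
    by (induction ys) auto
  have len: "size (enc_list a (remdups ys)) \<le> size (enc_list a ys)" for ys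
    by (induction ys) auto
  have "ptime e (enc_list a) (\<lambda>x. foldr ?g (xs x) [])"
  proof (rule ptime_foldr[OF assms(2) ptime_const])
    show "pbounded e (\<lambda>x. size (enc_list a (xs x)))"
      by (rule pbounded_output[OF assms(2)])
    show "ptime (enc_pair a (enc_pair (enc_list a) e)) (enc_list a)
       (\<lambda>p. ?g (fst p) (fst (snd p)))"
      by (rule ptime_member[OF assms(1)] ptime_rules)+
  next
    fix d ys zs assume "xs d = ys @ zs"
    then show "size (enc_list a (foldr ?g zs [])) \<le> size (enc_list a (xs d))"
      using len[of zs] by (simp add: eq size_enc_list_append)
  qed
  then show ?thesis by (simp only: eq)
qed

lemma ptime_odd_count:
  fixes xs :: "'a \<Rightarrow> 'b list"
  assumes "polytime_eq a" "ptime e a f" "ptime e (enc_list a) xs"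
  shows "ptime e enc_bool (\<lambda>x. odd (count_list (xs x) (f x)))"
proof -
  have "ptime e enc_bool (\<lambda>x. foldr (\<lambda>y b. b \<noteq> (f x = y)) (xs x) False)"
  proof (rule ptime_foldr_finite[OF assms(3) ptime_const _ finite_range_enc_bool])
    have "ptime (enc_pair a (enc_pair enc_bool e)) a (\<lambda>p. f (snd (snd p)))"
      by (rule ptime_comp[OF _ assms(2)], (rule ptime_rules)+)
    then show "ptime (enc_pair a (enc_pair enc_bool e)) enc_bool
        (\<lambda>p. fst (snd p) \<noteq> (f (snd (snd p)) = fst p))"
      by (intro ptime_Not ptime_eq[OF assms(1)] ptime_eq[OF polytime_eq_bool])
        (assumption | rule ptime_rules)+
  qed
  moreover have "foldr (\<lambda>y b. b \<noteq> (z = y)) ys False \<longleftrightarrow> odd (count_list ys z)" for z :: 'b and ys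
    by (induction ys) auto
  ultimately show ?thesis by (simp only:)
qed

section \<open>Arithmetic modulo 3\<close>

lemma three_cases: obtains "x = (0::3)" | "x = 1" | "x = 2"
proof (cases x rule: bit1_cases)
  case (of_int z)
  then have "z = 0 \<or> z = 1 \<or> z = 2" by auto
  then show thesis using of_int that by auto
qed

lemma three_arith:
  "(1::3) + 1 = 2" "(1::3) + 2 = 0" "(2::3) + 1 = 0" "(2::3) + 2 = 1" "(2::3) * 2 = 1"
  "- (1::3) = 2" "- (2::3) = 1" "(0::3) \<noteq> 1" "(1::3) \<noteq> 0" "(0::3) \<noteq> 2" "(2::3) \<noteq> 0" "(1::3) \<noteq> 2" "(2::3) \<noteq> 1"
  "(3::3) = 0" "(4::3) = 1"
  by simp_all

lemma residue3_simps [simp]: "residue3 0 = 0" "residue3 1 = 1" "residue3 2 = 2"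
  by (simp_all add: residue3_def bit1.Rep_0 bit1.Rep_1 bit1.Rep_numeral)

abbreviation enc3 :: "3 \<Rightarrow> bintree" where
  "enc3 c \<equiv> enc_nat (residue3 c)"

lemma inj_enc3: "inj enc3"
  using inj_compose[OF inj_enc_nat inj_residue3] by (simp add: comp_def)

lemma finite_range_enc3: "finite (range enc3)"
  by simp

lemma polytime_eq_3: "polytime_eq enc3"
  by (rule polytime_eq_finite[OF inj_enc3 finite_range_enc3])

lemma ptime_binary3:
  assumes "ptime e enc3 f" "ptime e enc3 g"
  shows "ptime e enc3 (\<lambda>x. h (f x) (g x))"
proof -
  have "ptime (enc_pair enc3 enc3) enc3 (\<lambda>p. h (fst p) (snd p))"
    by (rule ptime_finite[OF finite_range_enc_pair[OF finite_range_enc3 finite_range_enc3]])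
      (auto simp: enc_pair_def inj_eq[OF inj_enc3])
  from ptime_comp[OF ptime_Pair[OF assms] this] show ?thesis by simp
qed

lemmas ptime_arith3 = ptime_binary3[of _ _ _ "(+)"] ptime_binary3[of _ _ _ "(*)"]

text \<open>Horner's rule, carried out modulo 3 throughout, so that the accumulator has three values
  however large the number is.\<close>

lemma of_nat_eq_foldr_bits: "(of_nat n :: 3) = foldr (\<lambda>b acc. of_bool b + (acc + acc)) (bits n) 0"
proof (induction n rule: less_induct)
  case (less n)
  show ?case
  proof (cases "n = 0")
    case False
    have "(of_nat n :: 3) = of_nat (n div 2 + n div 2 + n mod 2)"
      by (rule arg_cong[of _ _ of_nat]) presburger
    also have "\<dots> = of_bool (odd n) + (of_nat (n div 2) + of_nat (n div 2))"
      by (cases "even n") (auto simp: odd_iff_mod_2_eq_one)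
    finally show ?thesis
      using less[of "n div 2"] False by (subst bits.simps) simp
  qed simp
qed

lemma ptime_of_nat3:
  assumes "ptime e enc_nat f" shows "ptime e enc3 (\<lambda>x. of_nat (f x))"
proof -
  have b: "ptime enc_bool enc3 of_bool"
    by (rule ptime_finite) auto
  have "ptime e enc3 (\<lambda>x. foldr (\<lambda>b acc. of_bool b + (acc + acc)) (bits (f x)) 0)"
  proof (rule ptime_foldr_finite[OF ptime_bits[OF assms] ptime_const _ finite_range_enc3])
    show "ptime (enc_pair enc_bool (enc_pair enc3 e)) enc3
       (\<lambda>p. of_bool (fst p) + (fst (snd p) + fst (snd p)))"
      by (rule ptime_arith3 ptime_comp[OF _ b] ptime_rules)+
  qed
  then show ?thesis by (simp only: of_nat_eq_foldr_bits)
qed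

lemma ptime_of_bool:
  assumes "ptime e enc_bool f" shows "ptime e enc_nat (\<lambda>x. of_bool (f x))"
  unfolding of_bool_def by (rule ptime_rules assms)+

lemma ptime_Const:
  assumes "ptime e a f" shows "ptime e (enc_letter a) (\<lambda>x. Const (f x))"
  by (rule ptime_cong[OF ptime_Pair[OF ptime_const[of e enc_bool False] assms]])
    (auto simp: enc_pair_def)

lemma ptime_Var:
  assumes "ptime e enc_nat f" shows "ptime e (enc_letter a) (\<lambda>x. Var (f x))"
  by (rule ptime_cong[OF ptime_Pair[OF ptime_const[of e enc_bool True] assms]])
    (auto simp: enc_pair_def)

lemma ptime_case_letter:
  assumes f: "ptime e (enc_letter a) f"
    and g: "ptime (enc_pair a e) b (\<lambda>p. g (fst p) (snd p))"
    and h: "ptime (enc_pair enc_nat e) b (\<lambda>p. h (fst p) (snd p))"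
  shows "ptime e b (\<lambda>x. case f x of Const c \<Rightarrow> g c x | Var i \<Rightarrow> h i x)"
proof -
  note f' = ptime_encoded[OF f]
  let ?u = "\<lambda>x. case f x of Const c \<Rightarrow> (c, x) | Var i \<Rightarrow> (undefined, x)"
  let ?v = "\<lambda>x. case f x of Const c \<Rightarrow> (0, x) | Var i \<Rightarrow> (i, x)"
  have t: "ptime e enc_tree (\<lambda>x. left_subtree (enc_letter a (f x)))"
    by (rule ptime_left[OF f'])
  have p: "ptime e enc_tree (\<lambda>x. Node (right_subtree (enc_letter a (f x))) (e x))"
    by (rule ptime_Node[OF ptime_right[OF f'] ptime_encoded[OF ptime_id]])
  have "ptime e (enc_pair a e) ?u"
    by (rule ptime_cong[OF ptime_tree_If[OF t
            ptime_Node[OF ptime_tree[of e "a undefined"] ptime_encoded[OF ptime_id]] p]])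
      (auto simp: enc_pair_def enc_tree_def split: letter.splits)
  from ptime_comp[OF this g] have g': "ptime e b (\<lambda>x. g (fst (?u x)) (snd (?u x)))" .
  have "ptime e (enc_pair enc_nat e) ?v"
    by (rule ptime_cong[OF ptime_tree_If[OF t p
            ptime_Node[OF ptime_tree[of e "enc_nat 0"] ptime_encoded[OF ptime_id]]]])
      (auto simp: enc_pair_def enc_tree_def split: letter.splits)
  from ptime_comp[OF this h] have h': "ptime e b (\<lambda>x. h (fst (?v x)) (snd (?v x)))" .
  show ?thesis
    by (rule ptime_cong[OF ptime_tree_If[OF t h' g']])
      (auto simp: enc_pair_def split: letter.splits)
qed

section \<open>The field with four elements, its permutations and additive maps\<close>

text \<open>\<open>Fa\<close> is alpha and \<open>Fb\<close> is alpha^2 = alpha + 1. In this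
  concrete model, identities of the field are finite case checks.\<close>

datatype f4 = F0 | F1 | Fa | Fb

instantiation f4 :: comm_ring_1
begin

definition "0 = F0"
definition "1 = F1"

fun plus_f4 where
  "plus_f4 F0 y = y"
| "plus_f4 F1 y = (case y of F0 \<Rightarrow> F1 | F1 \<Rightarrow> F0 | Fa \<Rightarrow> Fb | Fb \<Rightarrow> Fa)"
| "plus_f4 Fa y = (case y of F0 \<Rightarrow> Fa | F1 \<Rightarrow> Fb | Fa \<Rightarrow> F0 | Fb \<Rightarrow> F1)"
| "plus_f4 Fb y = (case y of F0 \<Rightarrow> Fb | F1 \<Rightarrow> Fa | Fa \<Rightarrow> F1 | Fb \<Rightarrow> F0)"

fun times_f4 where
  "times_f4 F0 y = F0"
| "times_f4 F1 y = y"
| "times_f4 Fa y = (case y of F0 \<Rightarrow> F0 | F1 \<Rightarrow> Fa | Fa \<Rightarrow> Fb | Fb \<Rightarrow> F1)"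
| "times_f4 Fb y = (case y of F0 \<Rightarrow> F0 | F1 \<Rightarrow> Fb | Fa \<Rightarrow> F1 | Fb \<Rightarrow> Fa)"

definition "uminus (x :: f4) = x"
definition "minus (x :: f4) y = x + y"

instance
proof
  fix x y z :: f4
  show "x + y + z = x + (y + z)" by (cases x; cases y; cases z) simp_all
  show "x + y = y + x" by (cases x; cases y) simp_all
  show "0 + x = x" by (simp add: zero_f4_def)
  show "- x + x = 0" by (cases x) (simp_all add: zero_f4_def uminus_f4_def)
  show "x - y = x + - y" by (simp add: uminus_f4_def minus_f4_def)
  show "x * y * z = x * (y * z)" by (cases x; cases y; cases z) simp_all
  show "x * y = y * x" by (cases x; cases y) simp_all
  show "1 * x = x" by (simp add: one_f4_def)
  show "(x + y) * z = x * z + y * z" by (cases x; cases y; cases z) simp_all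
  show "(0::f4) \<noteq> 1" by (simp add: zero_f4_def one_f4_def)
qed

end

lemmas f4_consts = zero_f4_def one_f4_def

lemma UNIV_f4: "UNIV = {F0, F1, Fa, Fb}"
  using f4.nchotomy by auto

instance f4 :: finite
  by standard (simp add: UNIV_f4)

lemma f4_add_self [simp]: "x + x = (0 :: f4)"
  by (cases x) (simp_all add: f4_consts)

lemma f4_two [simp]: "(2 :: f4) = 0"
  by (simp only: one_add_one[symmetric] f4_add_self)

lemma f4_add_self_left [simp]: "x + (x + y) = (y :: f4)"
  by (simp add: add.assoc[symmetric])

lemma f4_add_eq_0_iff: "x + y = 0 \<longleftrightarrow> x = (y :: f4)"
  by (cases x; cases y) (simp_all add: f4_consts)

lemma f4_mult_eq_0_iff [simp]: "x * y = 0 \<longleftrightarrow> x = 0 \<or> y = (0 :: f4)"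
  by (cases x; cases y) (simp_all add: f4_consts)

lemma f4_frobenius_add: "(x + y) * (x + y) = x * x + y * (y :: f4)"
  by (cases x; cases y) (simp_all add: f4_consts)

definition alpha_pow :: "3 \<Rightarrow> f4" where
  "alpha_pow t = (if t = 0 then F1 else if t = 1 then Fa else Fb)"

lemma alpha_pow_simps [simp]:
  "alpha_pow 0 = 1" "alpha_pow 1 = Fa" "alpha_pow 2 = Fb" "alpha_pow 3 = 1" "alpha_pow 4 = Fa"
proof -
  show *: "alpha_pow 0 = 1" "alpha_pow 1 = Fa" "alpha_pow 2 = Fb"
    by (simp_all add: alpha_pow_def f4_consts)
  show "alpha_pow 3 = 1" "alpha_pow 4 = Fa"
    using *(1,2) by (simp_all only: three_arith)
qed

lemma alpha_pow_add: "alpha_pow (s + t) = alpha_pow s * alpha_pow t"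
  by (rule three_cases[of s]; rule three_cases[of t]) (simp_all add: f4_consts)

lemma alpha_pow_eq_1_iff: "alpha_pow t = 1 \<longleftrightarrow> t = 0"
  by (rule three_cases[of t]) (simp_all add: f4_consts)

lemma alpha_pow_nonzero [simp]: "alpha_pow t \<noteq> 0"
  by (rule three_cases[of t]) (simp_all add: f4_consts)

lemma f4_nonzero_cases: "x \<noteq> 0 \<Longrightarrow> \<exists>t. x = alpha_pow t"
  by (cases x) (auto simp: f4_consts intro: exI[of _ 0] exI[of _ 1] exI[of _ 2])

text \<open>For t \<noteq> 0 this is the sum of all cube roots of unity, which is 0; for t = 0 it is
  1 + 1 + 1 = 1 in characteristic 2.\<close>

lemma alpha_pow_indicator: "1 + alpha_pow t + alpha_pow (t + t) = (if t = 0 then 1 else 0)"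
  by (rule three_cases[of t]) (simp_all add: f4_consts)

section \<open>Permutations of the field as affine maps\<close>

definition lin :: "(f4 \<Rightarrow> f4) \<Rightarrow> f4 \<Rightarrow> f4" where
  "lin f x = f x + f 0"

definition additive :: "(f4 \<Rightarrow> f4) \<Rightarrow> bool" where
  "additive f \<longleftrightarrow> (\<forall>x y. f (x + y) = f x + f y)"

lemma additive_0: "additive f \<Longrightarrow> f 0 = 0"
  unfolding additive_def by (metis f4_add_self add_cancel_right_right)

text \<open>A permutation of the field preserves the sum of all elements, which is 0.\<close>

lemma sum_inj_f4:
  assumes "inj f" shows "f Fb = f F0 + f F1 + (f Fa :: f4)"
proof -
  have "bij f" using assms by (simp add: bij_def finite_UNIV_inj_surj)
  then have "(\<Sum>x\<in>UNIV. f x) = (\<Sum>x\<in>UNIV. x)"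
    by (rule sum.reindex_bij_betw)
  then have "f F0 + f F1 + f Fa + f Fb = 0"
    by (simp add: UNIV_f4 add.assoc zero_f4_def)
  then show ?thesis by (simp add: f4_add_eq_0_iff)
qed

text \<open>The four points of a plane over Z_2 satisfy one affine relation, that their sum is 0,
  and every permutation preserves it. So all 24 permutations are affine, with linear part
  \<open>lin f\<close>; adding \<open>f 0\<close> is the same as subtracting it.\<close>

lemma inj_f4_affine:
  fixes f :: "f4 \<Rightarrow> f4"
  assumes "inj f" shows "f (x + y) = f x + f y + f 0"
proof -
  define g where "g x = f x + f F0" for x
  have swap: "a + (c + a) = c" for a c :: f4
    by (cases a; cases c) (simp_all add: zero_f4_def)
  have "g F0 = 0" by (simp add: g_def)
  then have g: "g F0 = 0" "g 0 = 0" "g Fb = g F1 + g Fa"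
    using sum_inj_f4[OF assms] by (simp_all only: zero_f4_def, simp add: g_def swap add.assoc)
  have "g (x + y) = g x + g y"
    by (cases x; cases y) (simp_all add: g swap add.assoc)
  then show ?thesis
    unfolding g_def zero_f4_def by (metis add.assoc add.commute swap)
qed

lemma additive_lin:
  assumes "inj f" shows "additive (lin f)"
proof -
  have "f (x + y) + f 0 = (f x + f 0) + (f y + f 0)" for x y
    unfolding inj_f4_affine[OF assms] by (simp add: add_ac)
  then show ?thesis by (simp add: additive_def lin_def)
qed

lemma inj_lin: "inj f \<Longrightarrow> inj (lin f)"
  by (auto simp: inj_def lin_def)

text \<open>Among four points every orbit returns after 1, 2, 3 or 4 steps, and 24 is a multiple of
  each of these.\<close>

lemma inj_f4_pow_24:
  assumes "inj (f :: f4 \<Rightarrow> f4)" shows "(f ^^ 24) x = x"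
proof -
  have "card ((\<lambda>i. (f ^^ i) x) ` {0..4::nat}) \<le> card (UNIV :: f4 set)"
    by (rule card_mono) auto
  also have "\<dots> = 4" by (simp add: UNIV_f4)
  finally have "\<not> inj_on (\<lambda>i. (f ^^ i) x) {0..4::nat}"
    by (auto dest!: card_image)
  then obtain i0 j0 where "i0 \<le> 4" "j0 \<le> 4" "i0 \<noteq> j0" "(f ^^ i0) x = (f ^^ j0) x"
    unfolding inj_on_def by auto
  then obtain i j where ij: "i < j" "j \<le> 4" "(f ^^ i) x = (f ^^ j) x"
    by (cases "i0 < j0") (simp_all, metis linorder_neqE_nat)
  have "(f ^^ i) ((f ^^ (j - i)) x) = (f ^^ (i + (j - i))) x"
    by (simp only: funpow_add comp_apply)
  also have "\<dots> = (f ^^ i) x" using ij by simp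
  finally have *: "(f ^^ (j - i)) x = x"
    using inj_fn[OF assms, of i] by (auto dest: injD)
  have mult: "((f ^^ k) ^^ m) x = x" if "(f ^^ k) x = x" for k m
    using that by (induction m) auto
  have "j - i = 1 \<or> j - i = 2 \<or> j - i = 3 \<or> j - i = 4" using ij by arith
  then have "(j - i) * (24 div (j - i)) = 24" by auto
  with mult[OF *, of "24 div (j - i)"] show ?thesis by (simp add: funpow_mult mult.commute)
qed

section \<open>Words as maps of the field\<close>

fun letter_fun :: "('g \<Rightarrow> f4 \<Rightarrow> f4) \<Rightarrow> (nat \<Rightarrow> f4 \<Rightarrow> f4) \<Rightarrow> 'g letter \<Rightarrow> f4 \<Rightarrow> f4" where
  "letter_fun h b (Const g) = h g"
| "letter_fun h b (Var i) = b i"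

definition word_fun :: "('g \<Rightarrow> f4 \<Rightarrow> f4) \<Rightarrow> (nat \<Rightarrow> f4 \<Rightarrow> f4) \<Rightarrow> 'g letter list \<Rightarrow> f4 \<Rightarrow> f4" where
  "word_fun h b w = foldr (\<lambda>l f. letter_fun h b l \<circ> f) w id"

lemma word_fun_simps [simp]:
  "word_fun h b [] x = x"
  "word_fun h b (l # w) x = letter_fun h b l (word_fun h b w x)"
  by (simp_all add: word_fun_def)

lemma word_fun_append [simp]: "word_fun h b (u @ v) x = word_fun h b u (word_fun h b v x)"
  by (induction u) auto

text \<open>All letters evaluate to elements of order dividing 24, hence 23-rd powers are inverses.\<close>

definition inv_word :: "'g letter list \<Rightarrow> 'g letter list" where
  "inv_word w = concat (map (replicate 23) (rev w))"

definition conj_word :: "'g letter list \<Rightarrow> 'g letter list \<Rightarrow> 'g letter list" where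
  "conj_word u w = u @ w @ inv_word u"

lemma word_fun_replicate: "word_fun h b (replicate n l) x = (letter_fun h b l ^^ n) x"
  by (induction n) auto

lemma word_fun_inv_word:
  assumes "\<forall>l\<in>set w. inj (letter_fun h b l)"
  shows "word_fun h b w (word_fun h b (inv_word w) x) = x"
    and "word_fun h b (inv_word w) (word_fun h b w x) = x"
proof -
  have "word_fun h b w (word_fun h b (inv_word w) x) = x \<and>
      word_fun h b (inv_word w) (word_fun h b w x) = x" for x
    using assms
  proof (induction w arbitrary: x)
    case (Cons l w)
    let ?f = "letter_fun h b l"
    have inv: "word_fun h b (inv_word (l # w)) y = word_fun h b (inv_word w) ((?f ^^ 23) y)" for y
      unfolding inv_word_def rev.simps map_append list.map concat_append word_fun_append concat.simps
        append_Nil2 word_fun_replicate ..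
    have "(?f ^^ Suc 23) y = y" for y
      using inj_f4_pow_24[of ?f y] Cons.prems by simp
    then have f: "?f ((?f ^^ 23) y) = y" "(?f ^^ 23) (?f y) = y" for y
      unfolding funpow_swap1[symmetric] by (simp_all only: funpow.simps comp_apply)
    show ?case
      using Cons.IH Cons.prems unfolding inv word_fun_simps f by (auto simp: f)
  qed (simp add: inv_word_def)
  then show "word_fun h b w (word_fun h b (inv_word w) x) = x"
    and "word_fun h b (inv_word w) (word_fun h b w x) = x" by auto
qed

lemma inj_word_fun: "\<forall>l\<in>set w. inj (letter_fun h b l) \<Longrightarrow> inj (word_fun h b w)"
  by (metis injI word_fun_inv_word(2))

lemma word_fun_conj_translation:
  assumes "\<forall>l\<in>set u. inj (letter_fun h b l)" and "\<And>x. word_fun h b w x = x + v"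
  shows "word_fun h b (conj_word u w) x = x + lin (word_fun h b u) v"
  using inj_f4_affine[OF inj_word_fun[OF assms(1)], of "word_fun h b (inv_word u) x" v] assms
  by (simp add: conj_word_def word_fun_inv_word lin_def add.assoc)

section \<open>The symmetric group on the four elements of the field\<close>

definition f4_of_nat :: "nat \<Rightarrow> f4" where
  "f4_of_nat k = (if k = 2 then F1 else if k = 3 then Fa else if k = 4 then Fb else F0)"

fun nat_of_f4 :: "f4 \<Rightarrow> nat" where
  "nat_of_f4 F0 = 1" | "nat_of_f4 F1 = 2" | "nat_of_f4 Fa = 3" | "nat_of_f4 Fb = 4"

lemma f4_of_nat_of_f4 [simp]: "f4_of_nat (nat_of_f4 x) = x"
  by (cases x) (simp_all add: f4_of_nat_def)

lemma nat_of_f4_in [simp]: "nat_of_f4 x \<in> {1..4}" "Suc 0 \<le> nat_of_f4 x" "nat_of_f4 x \<le> 4"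
  by (cases x; simp)+

lemma nat_of_f4_of_nat: "k \<in> {1..4} \<Longrightarrow> nat_of_f4 (f4_of_nat k) = k"
  by (cases "k = 1 \<or> k = 2 \<or> k = 3 \<or> k = 4") (auto simp: f4_of_nat_def)

definition perm_fun :: "(nat \<Rightarrow> nat) \<Rightarrow> f4 \<Rightarrow> f4" where
  "perm_fun p x = f4_of_nat (p (nat_of_f4 x))"

definition fun_perm :: "(f4 \<Rightarrow> f4) \<Rightarrow> nat \<Rightarrow> nat" where
  "fun_perm f k = (if k \<in> {1..4} then nat_of_f4 (f (f4_of_nat k)) else k)"

lemma perm_fun_comp:
  "q permutes {1..4} \<Longrightarrow> perm_fun (p \<circ> q) x = perm_fun p (perm_fun q x)"
  using permutes_in_image[of q "{1..4}" "nat_of_f4 x"]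
  by (simp add: perm_fun_def nat_of_f4_of_nat)

lemma perm_fun_fun_perm [simp]: "perm_fun (fun_perm f) = f"
  by (rule ext) (simp add: perm_fun_def fun_perm_def)

lemma inj_perm_fun:
  assumes "p permutes {1..4}" shows "inj (perm_fun p)"
proof (rule injI)
  fix x y assume "perm_fun p x = perm_fun p y"
  then have "nat_of_f4 (f4_of_nat (p (nat_of_f4 x))) = nat_of_f4 (f4_of_nat (p (nat_of_f4 y)))"
    by (simp add: perm_fun_def)
  then have "p (nat_of_f4 x) = p (nat_of_f4 y)"
    using permutes_in_image[OF assms] by (simp add: nat_of_f4_of_nat)
  then have "nat_of_f4 x = nat_of_f4 y" by (metis assms permutes_inverses(2))
  then show "x = y" by (metis f4_of_nat_of_f4)
qed

lemma fun_perm_permutes: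
  assumes "inj f" shows "fun_perm f permutes {1..4}"
proof (rule bij_imp_permutes)
  have "inj_on (fun_perm f) {1..4}"
  proof (rule inj_onI)
    fix j k assume *: "j \<in> {1..4}" "k \<in> {1..4}" "fun_perm f j = fun_perm f k"
    then have "f (f4_of_nat j) = f (f4_of_nat k)"
      by (metis f4_of_nat_of_f4 fun_perm_def)
    then have "f4_of_nat j = f4_of_nat k" using assms by (auto dest: injD)
    then show "j = k" using * by (metis nat_of_f4_of_nat)
  qed
  moreover have "fun_perm f ` {1..4} \<subseteq> {1..4}"
    using nat_of_f4_in by (auto simp: fun_perm_def)
  ultimately show "bij_betw (fun_perm f) {1..4} {1..4}"
    by (simp add: bij_betw_def endo_inj_surj)
next
  fix k :: nat assume "k \<notin> {1..4}"
  then show "fun_perm f k = k" unfolding fun_perm_def by (rule if_not_P)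
qed

lemma perm_fun_eq_id_iff:
  assumes "p permutes {1..4}" shows "p = id \<longleftrightarrow> (\<forall>x. perm_fun p x = x)"
proof
  assume "\<forall>x. perm_fun p x = x"
  have "p k = k" for k
  proof (cases "k \<in> {1..4}")
    case True
    then have "nat_of_f4 (perm_fun p (f4_of_nat k)) = p k"
      using permutes_in_image[OF assms] by (simp add: perm_fun_def nat_of_f4_of_nat)
    with \<open>\<forall>x. perm_fun p x = x\<close> show ?thesis using True nat_of_f4_of_nat by simp
  next
    case False
    then show ?thesis using assms by (meson permutes_not_in)
  qed
  then show "p = id" by auto
qed (simp add: perm_fun_def)

abbreviation S4_word :: "(nat \<Rightarrow> nat) letter list \<Rightarrow> bool" where
  "S4_word w \<equiv> w \<in> words_over (carrier (sym_group 4))"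

lemma words_over_Nil [simp]: "[] \<in> words_over S"
  by (simp add: words_over_def)

lemma words_over_Cons [simp]:
  "l # w \<in> words_over S \<longleftrightarrow> (case l of Const g \<Rightarrow> g \<in> S | Var _ \<Rightarrow> True) \<and> w \<in> words_over S"
  by (auto simp: words_over_def split: letter.splits)

lemma words_over_append [simp]:
  "u @ v \<in> words_over S \<longleftrightarrow> u \<in> words_over S \<and> v \<in> words_over S"
  by (induction u) auto

lemma words_over_concat: "(\<And>u. u \<in> set us \<Longrightarrow> u \<in> words_over S) \<Longrightarrow> concat us \<in> words_over S"
  by (induction us) auto

lemma words_over_inv_word: "w \<in> words_over S \<Longrightarrow> inv_word w \<in> words_over S"
proof (unfold inv_word_def, rule words_over_concat)
  fix u assume "w \<in> words_over S" "u \<in> set (map (replicate 23) (rev w))"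
  then obtain l where "l \<in> set w" "u = replicate 23 l" by auto
  then show "u \<in> words_over S" using \<open>w \<in> words_over S\<close> by (auto simp: words_over_def)
qed

lemma words_over_conj_word:
  "u \<in> words_over S \<Longrightarrow> w \<in> words_over S \<Longrightarrow> conj_word u w \<in> words_over S"
  by (simp add: conj_word_def words_over_inv_word)

abbreviation S4_fun :: "(nat \<Rightarrow> f4 \<Rightarrow> f4) \<Rightarrow> (nat \<Rightarrow> nat) letter list \<Rightarrow> f4 \<Rightarrow> f4" where
  "S4_fun \<equiv> word_fun perm_fun"

lemma perm_fun_word_eval:
  assumes "S4_word w" "a \<in> UNIV \<rightarrow> carrier (sym_group 4)"
  shows "word_eval (sym_group 4) a w permutes {1..4} \<and>
    perm_fun (word_eval (sym_group 4) a w) x = S4_fun (\<lambda>i. perm_fun (a i)) w x"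
  using assms(1)
proof (induction w)
  case Nil
  have "word_eval (sym_group 4) a [] = id" by (simp add: word_eval_def sym_group_def)
  then show ?case
    using permutes_id[of "{1..4::nat}"] by (simp only: word_fun_simps) (simp add: perm_fun_def)
next
  case (Cons l w)
  have l: "letter_eval a l permutes {1..4}"
    using Cons.prems assms(2) by (cases l) (auto simp: sym_group_def)
  have ev: "word_eval (sym_group 4) a (l # w) = letter_eval a l \<circ> word_eval (sym_group 4) a w"
    by (simp add: word_eval_def sym_group_def)
  have lf: "letter_fun perm_fun (\<lambda>i. perm_fun (a i)) l = perm_fun (letter_eval a l)"
    by (cases l) auto
  have w: "word_eval (sym_group 4) a w permutes {1..4}"
    "perm_fun (word_eval (sym_group 4) a w) x = S4_fun (\<lambda>i. perm_fun (a i)) w x"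
    using Cons by auto
  show ?case
    unfolding ev word_fun_simps lf perm_fun_comp[OF w(1)] w(2)
    by (rule conjI[OF permutes_compose[OF w(1) l] refl])
qed

text \<open>\<open>perm_fun\<close> and \<open>fun_perm\<close> carry assignments back and forth.
  The property is arbitrary, so that both solvability and nontriviality can be transferred.\<close>

lemma ex_S4_assignment_iff:
  assumes "S4_word w" and "\<And>p. p permutes {1..4} \<Longrightarrow> Q p \<longleftrightarrow> R (perm_fun p)"
  shows "(\<exists>a \<in> UNIV \<rightarrow> carrier (sym_group 4). Q (word_eval (sym_group 4) a w)) \<longleftrightarrow>
    (\<exists>b. (\<forall>i. inj (b i)) \<and> R (S4_fun b w))"
proof
  assume "\<exists>a \<in> UNIV \<rightarrow> carrier (sym_group 4). Q (word_eval (sym_group 4) a w)"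
  then obtain a where a: "a \<in> UNIV \<rightarrow> carrier (sym_group 4)" "Q (word_eval (sym_group 4) a w)" by auto
  have "perm_fun (word_eval (sym_group 4) a w) = S4_fun (\<lambda>i. perm_fun (a i)) w"
    using perm_fun_word_eval[OF assms(1) a(1)] by auto
  then have "R (S4_fun (\<lambda>i. perm_fun (a i)) w)"
    using perm_fun_word_eval[OF assms(1) a(1)] a(2) assms(2)[of "word_eval (sym_group 4) a w"] by simp
  moreover have "\<forall>i. inj (perm_fun (a i))"
    using a(1) by (intro allI inj_perm_fun) (auto simp: sym_group_def Pi_iff)
  ultimately show "\<exists>b. (\<forall>i. inj (b i)) \<and> R (S4_fun b w)"
    by (intro exI[of _ "\<lambda>i. perm_fun (a i)"]) simp
next
  assume "\<exists>b. (\<forall>i. inj (b i)) \<and> R (S4_fun b w)"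
  then obtain b where b: "\<forall>i. inj (b i)" "R (S4_fun b w)" by auto
  have a: "(\<lambda>i. fun_perm (b i)) \<in> UNIV \<rightarrow> carrier (sym_group 4)"
    using fun_perm_permutes[OF b(1)[rule_format]] unfolding sym_group_def by simp
  have "perm_fun (word_eval (sym_group 4) (\<lambda>i. fun_perm (b i)) w) = S4_fun b w"
    using perm_fun_word_eval[OF assms(1) a] by auto
  then have "Q (word_eval (sym_group 4) (\<lambda>i. fun_perm (b i)) w)"
    using perm_fun_word_eval[OF assms(1) a, of 0] b(2)
      assms(2)[of "word_eval (sym_group 4) (\<lambda>i. fun_perm (b i)) w"] by simp
  with a show "\<exists>a \<in> UNIV \<rightarrow> carrier (sym_group 4). Q (word_eval (sym_group 4) a w)" by blast
qed

abbreviation S4_solvable :: "(nat \<Rightarrow> nat) letter list \<Rightarrow> bool" where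
  "S4_solvable w \<equiv> \<exists>b. (\<forall>i. inj (b i)) \<and> (\<forall>x. S4_fun b w x = x)"

abbreviation S4_nontrivial :: "(nat \<Rightarrow> nat) letter list \<Rightarrow> bool" where
  "S4_nontrivial w \<equiv> \<exists>b. (\<forall>i. inj (b i)) \<and> (\<exists>x. S4_fun b w x \<noteq> x)"

lemma PolSat_S4_iff:
  assumes "S4_word w"
  shows "(\<exists>a \<in> UNIV \<rightarrow> carrier (sym_group 4). word_eval (sym_group 4) a w = \<one>\<^bsub>sym_group 4\<^esub>) \<longleftrightarrow>
    (S4_solvable w)"
  using ex_S4_assignment_iff[OF assms, of "\<lambda>p. p = id" "\<lambda>f. \<forall>x. f x = x"] perm_fun_eq_id_iff
  by (simp add: sym_group_def)

lemma coPolEqv_S4_iff: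
  assumes "S4_word w"
  shows "(\<exists>a \<in> UNIV \<rightarrow> carrier (sym_group 4). \<exists>g \<in> carrier (sym_group 4) - {\<one>\<^bsub>sym_group 4\<^esub>}.
      word_eval (sym_group 4) a w = g) \<longleftrightarrow>
    (S4_nontrivial w)"
proof -
  have "(\<exists>g \<in> carrier (sym_group 4) - {\<one>\<^bsub>sym_group 4\<^esub>}. word_eval (sym_group 4) a w = g) \<longleftrightarrow>
     word_eval (sym_group 4) a w \<noteq> id" if "a \<in> UNIV \<rightarrow> carrier (sym_group 4)" for a
    using perm_fun_word_eval[OF assms that] by (auto simp: sym_group_def)
  then show ?thesis
    using ex_S4_assignment_iff[OF assms, of "\<lambda>p. p \<noteq> id" "\<lambda>f. \<exists>x. f x \<noteq> x"] perm_fun_eq_id_iff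
    by simp
qed

section \<open>Matrices over Z_2 as additive maps of the field\<close>

definition f4_of_bits :: "bit \<Rightarrow> bit \<Rightarrow> f4" where
  "f4_of_bits a c = (if a = 0 then if c = 0 then F0 else Fa else if c = 0 then F1 else Fb)"

fun coord :: "nat \<Rightarrow> f4 \<Rightarrow> bit" where
  "coord i F0 = 0" | "coord i F1 = of_bool (i = 0)" | "coord i Fa = of_bool (i \<noteq> 0)" | "coord i Fb = 1"

lemma f4_of_bits_add: "f4_of_bits (a + a') (c + c') = f4_of_bits a c + f4_of_bits a' c'"
  by (cases a; cases a'; cases c; cases c') (simp_all add: f4_of_bits_def zero_f4_def)

lemma f4_of_bits_coord [simp]: "f4_of_bits (coord 0 x) (coord 1 x) = x" "f4_of_bits (coord 0 x) (coord (Suc 0) x) = x"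
  by (cases x; simp add: f4_of_bits_def)+

lemma coord_f4_of_bits [simp]: "coord 0 (f4_of_bits a c) = a" "coord 1 (f4_of_bits a c) = c" "coord (Suc 0) (f4_of_bits a c) = c"
  by (cases a; cases c; simp add: f4_of_bits_def)+

lemma coord_add: "coord i (x + y) = coord i x + coord i y"
  by (cases x; cases y; cases "i = 0") (simp_all add: zero_f4_def)

definition mat_fun :: "bit mat \<Rightarrow> f4 \<Rightarrow> f4" where
  "mat_fun M x = f4_of_bits (M $$ (0, 0) * coord 0 x + M $$ (0, 1) * coord 1 x)
     (M $$ (1, 0) * coord 0 x + M $$ (1, 1) * coord 1 x)"

text \<open>The basis over Z_2 consists of 1 and alpha, so the columns are the coordinates of the
  images of \<open>F1\<close> and \<open>Fa\<close>.\<close>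

definition fun_mat :: "(f4 \<Rightarrow> f4) \<Rightarrow> bit mat" where
  "fun_mat f = mat 2 2 (\<lambda>(i, j). coord i (f (if j = 0 then F1 else Fa)))"

lemma additive_mat_fun: "additive (mat_fun M)"
  unfolding additive_def mat_fun_def coord_add distrib_left f4_of_bits_add[symmetric]
  by (simp only: add_ac simp_thms)

lemma mat_fun_mult:
  assumes "M \<in> carrier_mat 2 2" "N \<in> carrier_mat 2 2"
  shows "mat_fun (M * N) x = mat_fun M (mat_fun N x)"
proof -
  have "(M * N) $$ (i, j) = M $$ (i, 0) * N $$ (0, j) + M $$ (i, 1) * N $$ (1, j)" if "i < 2" "j < 2" for i j
  proof -
    have "(M * N) $$ (i, j) = (\<Sum>k\<in>{0..<2}. M $$ (i, k) * N $$ (k, j))"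
      using that assms by (auto simp only: times_mat_def scalar_prod_def carrier_matD dim_col index_mat index_row
          index_col atLeastLessThan_iff split_conv intro!: sum.cong)
    moreover have "(\<Sum>k\<in>{0..<2}. h k) = h 0 + h 1" for h :: "nat \<Rightarrow> bit"
      by (simp add: numeral_2_eq_2)
    ultimately show ?thesis by (simp only:)
  qed
  then show ?thesis
    unfolding mat_fun_def by (simp only: coord_f4_of_bits) (simp only: algebra_simps pos2 one_less_numeral_iff semiring_norm)
qed

lemma mat_fun_add:
  assumes "M \<in> carrier_mat 2 2" "N \<in> carrier_mat 2 2"
  shows "mat_fun (M + N) x = mat_fun M x + mat_fun N x"
proof -
  have "(M + N) $$ (i, j) = M $$ (i, j) + N $$ (i, j)" if "i < 2" "j < 2" for i j
    using that assms by simp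
  then show ?thesis
    unfolding mat_fun_def f4_of_bits_add[symmetric]
    by (simp only: distrib_right add_ac pos2 one_less_numeral_iff semiring_norm)
qed

lemma mat_fun_one [simp]: "mat_fun (1\<^sub>m 2) x = x"
proof -
  have "1\<^sub>m 2 $$ (0, 0) = (1::bit)" "1\<^sub>m 2 $$ (0, 1) = (0::bit)" "1\<^sub>m 2 $$ (1, 0) = (0::bit)"
    "1\<^sub>m 2 $$ (1, 1) = (1::bit)" by simp_all
  then show ?thesis
    by (simp only: mat_fun_def mult_1_left mult_zero_left add_0_left add_0_right f4_of_bits_coord)
qed

lemma mat_fun_zero [simp]: "mat_fun (0\<^sub>m 2 2) x = 0"
  by (simp add: mat_fun_def f4_of_bits_def zero_f4_def)

lemma fun_mat_carrier [simp]: "fun_mat f \<in> carrier_mat 2 2"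
  by (simp add: fun_mat_def)

lemma mat_fun_fun_mat:
  assumes "additive f" shows "mat_fun (fun_mat f) x = f x"
proof -
  have "f F0 = 0" using additive_0[OF assms] by (simp add: zero_f4_def)
  moreover have "f Fb = f F1 + f Fa" using assms[unfolded additive_def, rule_format, of F1 Fa] by simp
  moreover have "f4_of_bits 0 0 = F0" by (simp add: f4_of_bits_def)
  moreover have "fun_mat f $$ (0, 0) = coord 0 (f F1)" "fun_mat f $$ (0, 1) = coord 0 (f Fa)"
    "fun_mat f $$ (1, 0) = coord 1 (f F1)" "fun_mat f $$ (1, 1) = coord 1 (f Fa)"
    by (simp_all add: fun_mat_def)
  ultimately show ?thesis
    by (cases x) (simp_all only: mat_fun_def coord.simps of_bool_eq mult_1_right mult_zero_right add_0_left
        add_0_right zero_neq_one one_neq_zero simp_thms f4_of_bits_coord f4_of_bits_add, simp add: zero_f4_def)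
qed

lemma mat_fun_inject:
  assumes "M \<in> carrier_mat 2 2" "N \<in> carrier_mat 2 2" "\<And>x. mat_fun M x = mat_fun N x"
  shows "M = N"
proof -
  have "coord i (mat_fun M x) = coord i (mat_fun N x)" for i x using assms(3) by simp
  from this[of 0 F1] this[of 1 F1] this[of 0 Fa] this[of 1 Fa] have
    "M $$ (0,0) = N $$ (0,0)" "M $$ (1,0) = N $$ (1,0)" "M $$ (0,1) = N $$ (0,1)" "M $$ (1,1) = N $$ (1,1)"
    by (simp_all only: mat_fun_def coord_f4_of_bits coord.simps of_bool_eq mult_1_right mult_zero_right
        add_0_left add_0_right zero_neq_one one_neq_zero simp_thms)
  then show ?thesis
    using assms(1,2) by (intro eq_matI) (auto simp: less_2_cases_iff)
qed

text \<open>By finiteness an injective map has a two-sided inverse; that inverse is again additive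
  and hence comes from a matrix.\<close>

lemma Units_Mat2_Z2: "M \<in> Units Mat2_Z2 \<longleftrightarrow> M \<in> carrier_mat 2 2 \<and> inj (mat_fun M)"
proof
  assume "M \<in> Units Mat2_Z2"
  then obtain N where N: "M \<in> carrier_mat 2 2" "N \<in> carrier_mat 2 2" "N * M = 1\<^sub>m 2"
    by (auto simp: Units_def ring_mat_simps)
  then have "mat_fun N (mat_fun M x) = x" for x
    using mat_fun_mult[of N M x] by simp
  then show "M \<in> carrier_mat 2 2 \<and> inj (mat_fun M)"
    using N(1) by (metis injI)
next
  assume M: "M \<in> carrier_mat 2 2 \<and> inj (mat_fun M)"
  then have "surj (mat_fun M)" by (simp add: finite_UNIV_inj_surj)
  define g where "g = inv_into UNIV (mat_fun M)"
  have g: "mat_fun M (g x) = x" "g (mat_fun M x) = x" for x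
    using M \<open>surj (mat_fun M)\<close> by (simp_all add: g_def surj_f_inv_f)
  have "additive g"
    unfolding additive_def
  proof (intro allI)
    fix x y
    have "mat_fun M (g x + g y) = x + y"
      using additive_mat_fun[of M] by (simp add: additive_def g)
    then show "g (x + y) = g x + g y" using g(2) by metis
  qed
  then have gm: "mat_fun (fun_mat g) x = g x" for x by (rule mat_fun_fun_mat)
  have "fun_mat g * M = 1\<^sub>m 2" "M * fun_mat g = 1\<^sub>m 2"
    using M mult_carrier_mat[of "fun_mat g" 2 2 M 2] mult_carrier_mat[of M 2 2 "fun_mat g" 2]
    by (auto intro!: mat_fun_inject simp: mat_fun_mult gm g)
  then show "M \<in> Units Mat2_Z2"
    using M by (auto simp: Units_def ring_mat_simps intro!: bexI[of _ "fun_mat g"])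
qed

lemma mat_fun_word_eval:
  assumes "w \<in> words_over (Units Mat2_Z2)" "a \<in> UNIV \<rightarrow> Units Mat2_Z2"
  shows "word_eval Mat2_Z2 a w \<in> carrier_mat 2 2 \<and>
    (\<forall>x. mat_fun (word_eval Mat2_Z2 a w) x = word_fun mat_fun (\<lambda>i. mat_fun (a i)) w x)"
  using assms(1)
proof (induction w)
  case Nil
  then show ?case by (simp add: word_eval_def ring_mat_simps)
next
  case (Cons l w)
  have "letter_eval a l \<in> carrier_mat 2 2"
    using Cons.prems assms(2) Units_Mat2_Z2 by (cases l) auto
  moreover have "letter_fun mat_fun (\<lambda>i. mat_fun (a i)) l = mat_fun (letter_eval a l)"
    by (cases l) auto
  moreover have "word_eval Mat2_Z2 a (l # w) = letter_eval a l * word_eval Mat2_Z2 a w"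
    by (simp add: word_eval_def ring_mat_simps)
  ultimately show ?case
    using Cons by (auto simp: mat_fun_mult)
qed

lemma mat_fun_restricted_eval:
  assumes "f \<in> restricted_exprs Mat2_Z2" "a \<in> UNIV \<rightarrow> Units Mat2_Z2"
  shows "restricted_eval Mat2_Z2 a f \<in> carrier_mat 2 2 \<and>
    (\<forall>x. mat_fun (restricted_eval Mat2_Z2 a f) x = (\<Sum>w\<leftarrow>f. word_fun mat_fun (\<lambda>i. mat_fun (a i)) w x))"
  using assms(1)
proof (induction f)
  case Nil
  then show ?case by (simp add: restricted_eval_def ring_mat_simps)
next
  case (Cons w f)
  then have "w \<in> words_over (Units Mat2_Z2)" "f \<in> restricted_exprs Mat2_Z2"
    by (auto simp: restricted_exprs_def)
  moreover have "restricted_eval Mat2_Z2 a (w # f) = word_eval Mat2_Z2 a w + restricted_eval Mat2_Z2 a f"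
    by (simp add: restricted_eval_def ring_mat_simps)
  ultimately show ?case
    using Cons.IH mat_fun_word_eval[OF _ assms(2), of w] by (auto simp: mat_fun_add)
qed

abbreviation mat_nonzero :: "bit mat letter list list \<Rightarrow> bool" where
  "mat_nonzero f \<equiv> \<exists>b. (\<forall>i. additive (b i) \<and> inj (b i)) \<and> (\<exists>x. (\<Sum>w\<leftarrow>f. word_fun mat_fun b w x) \<noteq> 0)"

lemma RestrictedNonzero_Mat2_iff:
  assumes "f \<in> restricted_exprs Mat2_Z2"
  shows "(\<exists>a \<in> UNIV \<rightarrow> Units Mat2_Z2. restricted_eval Mat2_Z2 a f \<noteq> \<zero>\<^bsub>Mat2_Z2\<^esub>) \<longleftrightarrow>
    (mat_nonzero f)"
proof
  assume "\<exists>a \<in> UNIV \<rightarrow> Units Mat2_Z2. restricted_eval Mat2_Z2 a f \<noteq> \<zero>\<^bsub>Mat2_Z2\<^esub>"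
  then obtain a where a: "a \<in> UNIV \<rightarrow> Units Mat2_Z2" "restricted_eval Mat2_Z2 a f \<noteq> 0\<^sub>m 2 2"
    by (auto simp: ring_mat_simps)
  have "\<exists>x. mat_fun (restricted_eval Mat2_Z2 a f) x \<noteq> mat_fun (0\<^sub>m 2 2) x"
    using mat_fun_inject[of "restricted_eval Mat2_Z2 a f" "0\<^sub>m 2 2"] mat_fun_restricted_eval[OF assms a(1)] a(2)
    by auto
  moreover have "\<forall>i. additive (mat_fun (a i)) \<and> inj (mat_fun (a i))"
    using a(1) Units_Mat2_Z2 additive_mat_fun by auto
  ultimately show "mat_nonzero f"
    using mat_fun_restricted_eval[OF assms a(1)] by (intro exI[of _ "\<lambda>i. mat_fun (a i)"]) simp
next
  assume "mat_nonzero f"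
  then obtain b x where b: "\<And>i. additive (b i)" "\<And>i. inj (b i)" "(\<Sum>w\<leftarrow>f. word_fun mat_fun b w x) \<noteq> 0"
    by blast
  have m: "mat_fun (fun_mat (b i)) = b i" for i
    using mat_fun_fun_mat[OF b(1)] by auto
  have a: "(\<lambda>i. fun_mat (b i)) \<in> UNIV \<rightarrow> Units Mat2_Z2"
    using b(2) by (simp add: Units_Mat2_Z2 m)
  have "mat_fun (restricted_eval Mat2_Z2 (\<lambda>i. fun_mat (b i)) f) x \<noteq> 0"
    using mat_fun_restricted_eval[OF assms a] b(3) by (simp add: m)
  then have "restricted_eval Mat2_Z2 (\<lambda>i. fun_mat (b i)) f \<noteq> 0\<^sub>m 2 2" by auto
  with a show "\<exists>a \<in> UNIV \<rightarrow> Units Mat2_Z2. restricted_eval Mat2_Z2 a f \<noteq> \<zero>\<^bsub>Mat2_Z2\<^esub>"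
    by (auto simp: ring_mat_simps)
qed

section \<open>Reductions to equations over the symmetric group\<close>

text \<open>Moving all variables to odd indices makes the even ones fresh. On binary digits, the new
  index arises by putting a 1 in front.\<close>

definition shift_letter :: "('g \<Rightarrow> 'h) \<Rightarrow> 'g letter \<Rightarrow> 'h letter" where
  "shift_letter \<psi> l = (case l of Const g \<Rightarrow> Const (\<psi> g) | Var i \<Rightarrow> Var (Suc (2 * i)))"

lemma word_fun_shift:
  "word_fun h b (map (shift_letter \<psi>) w) x = word_fun (\<lambda>g. h (\<psi> g)) (\<lambda>i. b (Suc (2 * i))) w x"
  by (induction w) (auto simp: shift_letter_def split: letter.splits)

lemma words_over_shift:
  "w \<in> words_over S \<Longrightarrow> (\<And>g. g \<in> S \<Longrightarrow> \<psi> g \<in> T) \<Longrightarrow> map (shift_letter \<psi>) w \<in> words_over T"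
  by (induction w) (auto simp: shift_letter_def split: letter.splits)

definition translation_perm :: "nat \<Rightarrow> nat" where
  "translation_perm = fun_perm (\<lambda>x. x + 1)"

lemma inj_translation [simp]: "inj (\<lambda>x. x + (v :: f4))"
  by (simp add: inj_def)

lemma inj_alpha_mult [simp]: "inj (\<lambda>x. alpha_pow t * x)"
  by (rule injI) (metis f4_add_eq_0_iff f4_mult_eq_0_iff alpha_pow_nonzero distrib_left)

lemma additive_alpha_mult [simp]: "additive (\<lambda>x. alpha_pow t * x)"
  by (simp add: additive_def distrib_left)

lemma lin_additive: "additive f \<Longrightarrow> lin f = f"
  by (auto simp: lin_def additive_0)

lemma translation_perm_S4 [simp]: "translation_perm \<in> carrier (sym_group 4)"
  using fun_perm_permutes[OF inj_translation[of 1]] by (simp add: translation_perm_def sym_group_def)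

lemma perm_fun_translation [simp]: "perm_fun translation_perm = (\<lambda>x. x + 1)"
  by (simp add: translation_perm_def)

lemma inj_letter_fun_S4:
  assumes "S4_word w" "\<forall>i. inj (b i)" shows "\<forall>l\<in>set w. inj (letter_fun perm_fun b l)"
proof
  fix l assume "l \<in> set w"
  then have "l \<in> Const ` carrier (sym_group 4) \<union> range Var"
    using assms(1) by (auto simp: words_over_def)
  then show "inj (letter_fun perm_fun b l)"
    using assms(2) inj_perm_fun by (auto simp: sym_group_def)
qed

text \<open>If f has a nontrivial linear part, take for y a translation; otherwise f is a translation and y is
  multiplication by alpha.\<close>

lemma ex_commutator_translation:
  fixes f :: "f4 \<Rightarrow> f4"
  assumes "inj f" "\<And>x. f (g x) = x" "\<exists>x. f x \<noteq> x"
  shows "\<exists>y v. inj y \<and> v \<noteq> 0 \<and> (\<forall>z. (\<forall>x. y (z x) = x) \<longrightarrow> (\<forall>x. y (f (z (g x))) = x + v))"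
proof (cases "\<exists>u. lin f u \<noteq> u")
  case True
  then obtain u where u: "lin f u \<noteq> u" by auto
  have "z x = x + u" if "\<forall>x. z x + u = x" for z :: "f4 \<Rightarrow> f4" and x
    using that[rule_format, of x] by (metis add.assoc add_0_right f4_add_self)
  \<comment> \<open>The commutator of the translation by u with f is the translation by
    \<open>lin f u\<close> - u, which is nontrivial by the choice of u.\<close>
  moreover have "f (g x + u) + u = x + (lin f u + u)" for x
    using inj_f4_affine[OF assms(1), of "g x" u] assms(2) by (simp add: lin_def add_ac)
  ultimately have "\<forall>x. f (z (g x)) + u = x + (lin f u + u)" if "\<forall>x. z x + u = x" for z
    using that by metis
  then show ?thesis
    using u by (intro exI[of _ "\<lambda>x. x + u"] exI[of _ "lin f u + u"]) (simp only: inj_translation f4_add_eq_0_iff, simp)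
next
  case False
  define c where "c = f 0"
  have f: "f x = x + c" for x
    using False by (metis add.assoc add_0_right c_def f4_add_self lin_def)
  have "c \<noteq> 0" using assms(3) f by auto
  have g: "g x = x + c" for x
    using assms(2)[of x] unfolding f by (metis add.assoc add_0_right f4_add_self)
  \<comment> \<open>The commutator of multiplication by alpha with the translation by c is the
    translation by (1 + alpha) c = alpha^2 c.\<close>
  have "c + Fa * c = Fb * c" by (cases c) (simp_all add: zero_f4_def)
  then have "alpha_pow 1 * (z (x + c) + c) = x + Fb * c" if "\<forall>x. alpha_pow 1 * z x = x" for z x
    unfolding distrib_left that[rule_format] by (simp only: alpha_pow_simps add.assoc)
  moreover have "Fb * c \<noteq> 0" using \<open>c \<noteq> 0\<close> by (cases c) (simp_all add: zero_f4_def)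
  ultimately show ?thesis
    unfolding f g
    by (intro exI[of _ "\<lambda>x. alpha_pow 1 * x"] exI[of _ "Fb * c"] conjI inj_alpha_mult allI impI)
qed

text \<open>\<open>Var 0\<close> is the conjugating g and \<open>Var 2\<close> the y of the
  commutator. The last letter is tau, the translation by 1, which is its own inverse.\<close>

definition coPolEqv_to_PolSat :: "(nat \<Rightarrow> nat) letter list \<Rightarrow> (nat \<Rightarrow> nat) letter list" where
  "coPolEqv_to_PolSat w = (let u = map (shift_letter (\<lambda>g. g)) w in
     conj_word [Var 0] (conj_word [Var 2] u @ inv_word u) @ [Const translation_perm])"

lemma S4_word_coPolEqv_to_PolSat: "S4_word w \<Longrightarrow> S4_word (coPolEqv_to_PolSat w)"
  by (simp add: coPolEqv_to_PolSat_def Let_def words_over_conj_word words_over_inv_word words_over_shift)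

lemma coPolEqv_to_PolSat_correct:
  assumes w: "S4_word w"
  shows "(S4_nontrivial w) \<longleftrightarrow>
    (S4_solvable (coPolEqv_to_PolSat w))"
proof -
  define u where "u = map (shift_letter (\<lambda>g. g)) w"
  have u: "S4_word u" using w by (simp add: u_def words_over_shift)
  define c where "c = conj_word [Var 2] u @ inv_word u"
  have F: "S4_fun b (coPolEqv_to_PolSat w) x = S4_fun b (conj_word [Var 0] c) (x + 1)" for b x
    by (simp add: coPolEqv_to_PolSat_def u_def[symmetric] c_def)
  have ev: "S4_fun b u x = S4_fun (\<lambda>i. b (Suc (2 * i))) w x" for b x
    by (simp add: u_def word_fun_shift)
  have C: "S4_fun b c x = b 2 (S4_fun b u (S4_fun b (inv_word [Var 2])
      (S4_fun b (inv_word u) x)))" for b x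
    by (simp add: c_def conj_word_def)
  show ?thesis
  proof
    assume "S4_nontrivial w"
    then obtain b where b: "\<forall>i. inj (b i)" "\<exists>x. S4_fun b w x \<noteq> x" by auto
    \<comment> \<open>On odd indices this is b with the shift undone; g and y are placed at the two
      fresh indices.\<close>
    let ?b = "\<lambda>g y i. if i = 0 then g else if i = 2 then y else b ((i - 1) div 2)"
    have odd: "(\<lambda>i. ?b g y (Suc (2 * i))) = b" for g y
      by (rule ext) (simp; presburger)
    have invu: "S4_fun (?b g y) u (S4_fun (?b g y) (inv_word u) x) = x"
      if "inj g" "inj y" for g y x
      using that b(1) by (intro word_fun_inv_word inj_letter_fun_S4[OF u]) auto
    \<comment> \<open>Neither \<open>Var 0\<close> nor \<open>Var 2\<close> occurs in u. So the
      value of the inverse can be fixed with \<open>id\<close> in their places before y, which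
      depends on it, is chosen.\<close>
    have invu': "S4_fun (?b g y) (inv_word u) x = S4_fun (?b id id) (inv_word u) x"
      if "inj g" "inj y" for g y x
    proof -
      have "S4_fun (?b g y) (inv_word u) (S4_fun (?b g y) u (S4_fun (?b id id) (inv_word u) x))
        = S4_fun (?b id id) (inv_word u) x"
        using that b(1) by (intro word_fun_inv_word inj_letter_fun_S4[OF u]) auto
      moreover have "S4_fun (?b g y) u (S4_fun (?b id id) (inv_word u) x) = x"
        using invu[of id id x] by (simp add: ev odd)
      ultimately show ?thesis by simp
    qed
    have "inj (S4_fun b w)"
      by (intro inj_word_fun inj_letter_fun_S4[OF w] b)
    moreover have "S4_fun b w (S4_fun (?b id id) (inv_word u) x) = x" for x
      using invu[of id id x] by (simp add: ev odd)
    ultimately obtain y v where y: "inj y" "v \<noteq> 0"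
      "\<And>z x. \<forall>x. y (z x) = x \<Longrightarrow> y (S4_fun b w (z (S4_fun (?b id id) (inv_word u) x))) = x + v"
      using ex_commutator_translation[of "S4_fun b w" "S4_fun (?b id id) (inv_word u)"] b(2)
      by blast
    obtain t where t: "v = alpha_pow t" using y(2) f4_nonzero_cases by blast
    \<comment> \<open>Multiplication by alpha^(-t) takes v = alpha^t to 1, so the conjugated
      commutator becomes the translation by 1 and cancels tau.\<close>
    let ?g = "\<lambda>x. alpha_pow (- t) * x"
    let ?B = "?b ?g y"
    have inj: "\<forall>i. inj (?B i)" using b(1) y(1) by simp
    have "?B 2 (S4_fun ?B (inv_word [Var 2]) x) = x" for x
      using word_fun_inv_word(1)[of "[Var 2]" perm_fun ?B x] y(1) by simp
    then have "S4_fun ?B c x = x + v" for x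
      unfolding C invu'[OF inj_alpha_mult y(1)] ev odd
      using y(3)[of "S4_fun ?B (inv_word [Var 2])"] by simp
    then have "S4_fun ?B (conj_word [Var 0] c) x = x + lin (S4_fun ?B [Var 0]) v" for x
      using inj by (intro word_fun_conj_translation) auto
    moreover have "S4_fun ?B [Var 0] = ?g" by auto
    moreover have "lin ?g v = 1"
      by (simp add: lin_def t flip: alpha_pow_add)
    ultimately have "S4_fun ?B (coPolEqv_to_PolSat w) x = x" for x
      by (simp add: F add.assoc)
    then show "S4_solvable (coPolEqv_to_PolSat w)"
      by (intro exI[of _ ?B] conjI allI inj[rule_format])
  next
    assume "S4_solvable (coPolEqv_to_PolSat w)"
    then obtain b where b: "\<forall>i. inj (b i)" "\<forall>x. S4_fun b (coPolEqv_to_PolSat w) x = x" by auto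
    have "\<exists>x. S4_fun b u x \<noteq> x"
    proof (rule ccontr)
      \<comment> \<open>If u is the identity, so are the commutator and its conjugate, and only tau
        remains, which moves 0.\<close>
      assume "\<not> (\<exists>x. S4_fun b u x \<noteq> x)"
      then have id: "S4_fun b u x = x" for x by auto
      then have "S4_fun b (inv_word u) x = x" for x
        using word_fun_inv_word(1)[OF inj_letter_fun_S4[OF u b(1)], of x] by simp
      then have "S4_fun b c x = x" for x
        using word_fun_inv_word(1)[of "[Var 2]" perm_fun b x] b(1) by (simp add: C id)
      then have "S4_fun b (conj_word [Var 0] c) x = x" for x
        using word_fun_inv_word(1)[of "[Var 0]" perm_fun b x] b(1) by (simp add: conj_word_def)
      then show False using b(2)[rule_format, of 0] by (simp add: F)
    qed
    then show "S4_nontrivial w"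
      using b(1) by (intro exI[of _ "\<lambda>i. b (Suc (2 * i))"]) (simp add: ev)
  qed
qed

text \<open>The additional \<open>Var 0\<close> at the end of each word turns the translation by 1
  into one by an arbitrary nonzero vector, the same for all summands: the vector to which the sum of
  matrices is applied.\<close>

definition restricted_to_S4 :: "bit mat letter list list \<Rightarrow> (nat \<Rightarrow> nat) letter list" where
  "restricted_to_S4 f = concat (map (\<lambda>u. conj_word
     (map (shift_letter (\<lambda>M. fun_perm (mat_fun M))) u @ [Var 0]) [Const translation_perm]) f)"

lemma S4_word_shift_mat:
  "u \<in> words_over (Units Mat2_Z2) \<Longrightarrow> S4_word (map (shift_letter (\<lambda>M. fun_perm (mat_fun M))) u)"
  by (rule words_over_shift) (use fun_perm_permutes in \<open>auto simp: sym_group_def Units_Mat2_Z2\<close>)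

lemma S4_word_restricted_to_S4:
  assumes "f \<in> restricted_exprs Mat2_Z2" shows "S4_word (restricted_to_S4 f)"
  unfolding restricted_to_S4_def
proof (rule words_over_concat)
  fix u assume "u \<in> set (map (\<lambda>u. conj_word
     (map (shift_letter (\<lambda>M. fun_perm (mat_fun M))) u @ [Var 0]) [Const translation_perm]) f)"
  then obtain v where v: "v \<in> set f" "u = conj_word
     (map (shift_letter (\<lambda>M. fun_perm (mat_fun M))) v @ [Var 0]) [Const translation_perm]" by auto
  then have "v \<in> words_over (Units Mat2_Z2)" using assms by (auto simp: restricted_exprs_def)
  then show "S4_word u" by (simp add: v words_over_conj_word S4_word_shift_mat)
qed

lemma lin_comp: "inj f \<Longrightarrow> lin (\<lambda>x. f (g x)) x = lin f (lin g x)"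
  using inj_f4_affine[of f "g x" "g 0"] by (simp add: lin_def add_ac)

lemma lin_word_fun:
  assumes "\<forall>l\<in>set w. inj (letter_fun h b l)"
  shows "lin (word_fun h b w) x = word_fun (\<lambda>g. lin (h g)) (\<lambda>i. lin (b i)) w x"
  using assms
proof (induction w)
  case Nil
  have "lin (\<lambda>x. x) x = x" by (simp add: lin_def)
  then show ?case by (simp add: word_fun_def id_def)
next
  case (Cons l w)
  have "word_fun h b (l # w) = (\<lambda>x. letter_fun h b l (word_fun h b w x))" by auto
  moreover have "lin (letter_fun h b l) = letter_fun (\<lambda>g. lin (h g)) (\<lambda>i. lin (b i)) l" by (cases l) auto
  ultimately show ?case using Cons by (simp add: lin_comp)
qed

lemma word_fun_restricted_to_S4:
  assumes "f \<in> restricted_exprs Mat2_Z2" and b: "\<forall>i. inj (b i)"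
  shows "S4_fun b (restricted_to_S4 f) x =
    x + (\<Sum>w\<leftarrow>f. word_fun mat_fun (\<lambda>i. lin (b (Suc (2 * i)))) w (lin (b 0) 1))"
  using assms(1)
proof (induction f arbitrary: x)
  case Nil
  then show ?case by (simp add: restricted_to_S4_def)
next
  case (Cons u f)
  let ?u = "map (shift_letter (\<lambda>M. fun_perm (mat_fun M))) u @ [Var 0]"
  have u: "u \<in> words_over (Units Mat2_Z2)" and f: "f \<in> restricted_exprs Mat2_Z2"
    using Cons.prems by (auto simp: restricted_exprs_def)
  have inj: "\<forall>l\<in>set ?u. inj (letter_fun perm_fun b l)"
    by (rule inj_letter_fun_S4[OF _ b]) (use S4_word_shift_mat[OF u] in simp)
  have "lin (S4_fun b ?u) 1 = word_fun (\<lambda>g. lin (perm_fun g)) (\<lambda>i. lin (b i)) ?u 1"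
    by (rule lin_word_fun[OF inj])
  also have "\<dots> = word_fun mat_fun (\<lambda>i. lin (b (Suc (2 * i)))) u (lin (b 0) 1)"
    by (simp only: word_fun_append word_fun_shift perm_fun_fun_perm lin_additive[OF additive_mat_fun])
      simp
  finally have "lin (S4_fun b ?u) 1 = word_fun mat_fun (\<lambda>i. lin (b (Suc (2 * i)))) u (lin (b 0) 1)" .
  moreover have "S4_fun b (conj_word ?u [Const translation_perm]) y = y + lin (S4_fun b ?u) 1" for y
    by (rule word_fun_conj_translation[OF inj]) simp
  moreover have "restricted_to_S4 (u # f) = conj_word ?u [Const translation_perm] @ restricted_to_S4 f"
    by (simp add: restricted_to_S4_def)
  ultimately show ?case
    using Cons.IH[OF f] by (simp add: add_ac)
qed

lemma additive_word_fun:
  "(\<And>i. additive (b i)) \<Longrightarrow> additive (word_fun mat_fun b w)"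
proof (induction w)
  case (Cons l w)
  have "additive (letter_fun mat_fun b l)" using Cons.prems additive_mat_fun by (cases l) auto
  with Cons show ?case by (auto simp: additive_def)
qed (simp add: additive_def)

text \<open>A vector with nonzero image is itself nonzero, hence of the form alpha^t, and
  multiplication by alpha^t as the value of \<open>Var 0\<close> reaches it from 1. Conversely, the
  linear parts of permutations are invertible and additive, so they serve as values of the matrix
  variables.\<close>

lemma restricted_to_S4_correct:
  assumes f: "f \<in> restricted_exprs Mat2_Z2"
  shows "(mat_nonzero f) \<longleftrightarrow>
    (S4_nontrivial (restricted_to_S4 f))"
proof
  assume "mat_nonzero f"
  then obtain b x where b: "\<And>i. additive (b i)" "\<And>i. inj (b i)" "(\<Sum>w\<leftarrow>f. word_fun mat_fun b w x) \<noteq> 0"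
    by blast
  have "(\<Sum>w\<leftarrow>f. word_fun mat_fun b w 0) = 0"
    using additive_0[OF additive_word_fun[of b, OF b(1)]] by (induction f) auto
  then obtain t where t: "x = alpha_pow t" using b(3) f4_nonzero_cases[of x] by metis
  let ?b = "\<lambda>i. if i = 0 then (\<lambda>y. alpha_pow t * y) else b ((i - 1) div 2)"
  have "\<forall>i. inj (?b i)" using b(2) by simp
  moreover have "(\<lambda>i. lin (?b (Suc (2 * i)))) = b"
    by (rule ext) (simp add: lin_additive b(1))
  moreover have "lin (?b 0) 1 = x" by (simp add: lin_additive t)
  ultimately have "S4_fun ?b (restricted_to_S4 f) 0 \<noteq> 0"
    using b(3) word_fun_restricted_to_S4[OF f, of ?b 0] by simp
  then show "S4_nontrivial (restricted_to_S4 f)"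
    using \<open>\<forall>i. inj (?b i)\<close> by (intro exI[of _ ?b] conjI exI[of _ 0])
next
  assume "S4_nontrivial (restricted_to_S4 f)"
  then obtain b x where b: "\<forall>i. inj (b i)" "S4_fun b (restricted_to_S4 f) x \<noteq> x" by blast
  then have "(\<Sum>w\<leftarrow>f. word_fun mat_fun (\<lambda>i. lin (b (Suc (2 * i)))) w (lin (b 0) 1)) \<noteq> 0"
    using word_fun_restricted_to_S4[OF f b(1), of x] by auto
  then show "mat_nonzero f"
    using b(1) additive_lin inj_lin
    by (intro exI[of _ "\<lambda>i. lin (b (Suc (2 * i)))"]) blast
qed

lemma ptime_replicate:
  assumes "ptime e a f" shows "ptime e (enc_list a) (\<lambda>x. replicate n (f x))"
  by (induction n) (auto intro: ptime_const ptime_Cons assms)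

lemma ptime_inv_word:
  assumes "ptime e (enc_list a) f" shows "ptime e (enc_list a) (\<lambda>x. inv_word (f x))"
  unfolding inv_word_def by (rule ptime_replicate ptime_rules assms)+

lemma ptime_conj_word:
  assumes "ptime e (enc_list a) f" "ptime e (enc_list a) g"
  shows "ptime e (enc_list a) (\<lambda>x. conj_word (f x) (g x))"
  unfolding conj_word_def by (rule ptime_inv_word ptime_rules assms)+

lemma ptime_shift_letter:
  assumes "ptime a b \<psi>" "ptime e (enc_letter a) f"
  shows "ptime e (enc_letter b) (\<lambda>x. shift_letter \<psi> (f x))"
  unfolding shift_letter_def
  by (rule ptime_case_letter ptime_comp[OF _ assms(1)] assms(2) ptime_Const ptime_Var
      ptime_double_Suc ptime_rules)+

lemma ptime_coPolEqv_to_PolSat: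
  "ptime (enc_word enc_S4) (enc_word enc_S4) coPolEqv_to_PolSat"
  unfolding enc_word_def coPolEqv_to_PolSat_def Let_def
  by (rule ptime_conj_word ptime_inv_word ptime_shift_letter ptime_rules)+

lemma ptime_fun_perm_mat_fun: "ptime enc_Mat2_Z2 enc_S4 (\<lambda>M. fun_perm (mat_fun M))"
proof (rule ptime_finite)
  \<comment> \<open>The code of a matrix of any dimension consists of four bits, and
    \<open>mat_fun\<close> reads no other entries. Hence a table suffices.\<close>
  have "range enc_Mat2_Z2 \<subseteq> enc_list enc_bool ` {bs. set bs \<subseteq> UNIV \<and> length bs = 4}"
    unfolding enc_Mat2_Z2_def by (rule image_subsetI, rule imageI) simp
  then show "finite (range enc_Mat2_Z2)"
    by (rule finite_subset) (intro finite_imageI finite_lists_length_eq, simp)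
  fix M N assume "enc_Mat2_Z2 M = enc_Mat2_Z2 N"
  moreover have "(x = 1) = (y = 1) \<Longrightarrow> x = y" for x y :: bit
    by (cases x; cases y) auto
  ultimately have "M $$ (0,0) = N $$ (0,0)" "M $$ (1,0) = N $$ (1,0)" "M $$ (0,1) = N $$ (0,1)" "M $$ (1,1) = N $$ (1,1)"
    by (simp_all add: enc_Mat2_Z2_def)
  then have "mat_fun M = mat_fun N" by (simp add: mat_fun_def fun_eq_iff)
  then show "enc_S4 (fun_perm (mat_fun M)) = enc_S4 (fun_perm (mat_fun N))" by simp
qed

lemma ptime_restricted_to_S4:
  "ptime (enc_list (enc_word enc_Mat2_Z2)) (enc_word enc_S4) restricted_to_S4"
  unfolding enc_word_def restricted_to_S4_def
  by (rule ptime_conj_word ptime_shift_letter[OF ptime_fun_perm_mat_fun] ptime_rules)+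

section \<open>From power sums to circuits\<close>

definition f4_into :: "('f, 'm) ring_scheme \<Rightarrow> 'f \<Rightarrow> f4 \<Rightarrow> 'f" where
  "f4_into F \<alpha> x = (case x of F0 \<Rightarrow> \<zero>\<^bsub>F\<^esub> | F1 \<Rightarrow> \<one>\<^bsub>F\<^esub> | Fa \<Rightarrow> \<alpha> | Fb \<Rightarrow> \<alpha> \<otimes>\<^bsub>F\<^esub> \<alpha>)"

text \<open>As alpha generates the three nonzero elements, the field consists of 0, 1, alpha and
  alpha^2, which leaves one possible addition table. Thus sums can be tested for zero in
  \<open>f4\<close> instead of F.\<close>

lemma field_4_facts:
  fixes F (structure)
  assumes "Ring.field F" and "Coset.order F = 4" and "primitive_element F \<alpha>"
  shows "\<alpha> \<in> carrier F" and "f4_into F \<alpha> (x + y) = f4_into F \<alpha> x \<oplus> f4_into F \<alpha> y"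
    and "f4_into F \<alpha> x = \<zero> \<longleftrightarrow> x = 0" and "f4_into F \<alpha> x \<in> carrier F"
proof -
  interpret field F by fact
  have card: "card (carrier F) = 4" using assms(2) by (simp add: Coset.order_def)
  then have fin: "finite (carrier F)" by (metis card.infinite zero_neq_numeral)
  interpret M: group "mult_of F" by (rule field_mult_group)
  have cm: "carrier (mult_of F) = carrier F - {\<zero>}" by simp
  have card3: "card (carrier F - {\<zero>}) = 3" using card fin by simp
  have a: "\<alpha> \<in> carrier F" "\<alpha> \<noteq> \<zero>" using assms(3) by (auto simp: primitive_element_def)
  then show \<alpha>: "\<alpha> \<in> carrier F" by simp
  have gen: "carrier F - {\<zero>} = range (\<lambda>i::nat. \<alpha> [^] i)"
    using assms(3) cm by (auto simp: primitive_element_def)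
  have "\<alpha> [^]\<^bsub>mult_of F\<^esub> Coset.order (mult_of F) = \<one>\<^bsub>mult_of F\<^esub>"
    by (rule M.pow_order_eq_1) (use a in simp)
  then have a3: "\<alpha> [^] (3::nat) = \<one>" using card3 by (simp add: Coset.order_def nat_pow_mult_of)
  then have a3': "\<alpha> \<otimes> (\<alpha> \<otimes> \<alpha>) = \<one>" using \<alpha> by (simp add: numeral_3_eq_3 m_assoc)
  have ne1: "\<alpha> \<noteq> \<one>"
  proof
    assume "\<alpha> = \<one>"
    then have "carrier F - {\<zero>} \<subseteq> {\<one>}" using gen by auto
    then have "card (carrier F - {\<zero>}) \<le> card {\<one>}" by (intro card_mono) auto
    then show False using card3 by simp
  qed
  have ne2: "\<alpha> \<otimes> \<alpha> \<noteq> \<one>" using a3' ne1 \<alpha> by auto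
  have ne3: "\<alpha> \<otimes> \<alpha> \<noteq> \<alpha>" using m_lcancel[OF a(2) \<alpha> \<alpha> one_closed] ne1 \<alpha> by simp
  have nz: "\<alpha> \<otimes> \<alpha> \<noteq> \<zero>" using a by (simp add: integral_iff)
  have carr: "carrier F = {\<zero>, \<one>, \<alpha>, \<alpha> \<otimes> \<alpha>}"
  proof (rule sym, rule card_subset_eq[OF fin])
    show "{\<zero>, \<one>, \<alpha>, \<alpha> \<otimes> \<alpha>} \<subseteq> carrier F" using \<alpha> by simp
    show "card {\<zero>, \<one>, \<alpha>, \<alpha> \<otimes> \<alpha>} = card (carrier F)"
      using ne1 ne2 ne3 nz a(2) card one_not_zero
        ne1[symmetric] ne2[symmetric] ne3[symmetric] nz[symmetric] a(2)[symmetric] one_not_zero[symmetric]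
      by (simp only: card_insert_if finite.intros insert_iff empty_iff simp_thms if_False card.empty)
  qed
  have a4: "(\<alpha> \<otimes> \<alpha>) \<otimes> (\<alpha> \<otimes> \<alpha>) = \<alpha>"
    using a3' \<alpha> by (simp add: m_assoc)
  \<comment> \<open>-1 has square 1. This excludes 0, alpha and alpha^2, since alpha^2 and alpha^4 =
    alpha differ from 1; so -1 = 1.\<close>
  have sq: "(\<ominus> \<one>) \<otimes> (\<ominus> \<one>) = \<one>" by (simp add: l_minus r_minus)
  have "\<ominus> \<one> \<in> {\<zero>, \<one>, \<alpha>, \<alpha> \<otimes> \<alpha>}" by (simp only: carr[symmetric] a_inv_closed one_closed)
  then have "\<ominus> \<one> = \<zero> \<or> \<ominus> \<one> = \<one> \<or> \<ominus> \<one> = \<alpha> \<or> \<ominus> \<one> = \<alpha> \<otimes> \<alpha>"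
    by (simp only: insert_iff empty_iff simp_thms)
  then have "\<ominus> \<one> = \<one>"
  proof (elim disjE)
    assume "\<ominus> \<one> = \<zero>"
    then have "\<zero> \<otimes> \<zero> = \<one>" using sq by (simp only:)
    then show ?thesis by simp
  next
    assume "\<ominus> \<one> = \<alpha>"
    then have "\<alpha> \<otimes> \<alpha> = \<one>" using sq by (simp only:)
    with ne2 show ?thesis by contradiction
  next
    assume "\<ominus> \<one> = \<alpha> \<otimes> \<alpha>"
    then have "(\<alpha> \<otimes> \<alpha>) \<otimes> (\<alpha> \<otimes> \<alpha>) = \<one>" using sq by (simp only:)
    with a4 ne1 show ?thesis by simp
  qed
  then have one2: "\<one> \<oplus> \<one> = \<zero>" using r_neg[of \<one>] by simp
  have self: "z \<oplus> z = \<zero>" if "z \<in> carrier F" for z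
    using r_distr[of \<one> \<one> z] one2 that by simp
  have s1: "\<one> \<oplus> (\<one> \<oplus> \<alpha>) = \<alpha>"
    using one2 \<alpha> by (simp add: a_assoc[symmetric])
  have s2: "(\<one> \<oplus> \<alpha>) \<oplus> \<alpha> = \<one>"
    using self[OF \<alpha>] \<alpha> by (simp add: a_assoc)
  \<comment> \<open>In characteristic 2, 1 + alpha differs from 0, 1 and alpha, so it is
    alpha^2.\<close>
  have "\<one> \<oplus> \<alpha> \<in> {\<zero>, \<one>, \<alpha>, \<alpha> \<otimes> \<alpha>}"
    by (simp only: carr[symmetric] a_closed one_closed \<alpha>)
  moreover have "\<one> \<oplus> \<alpha> \<noteq> \<zero>" using s1 ne1 by auto
  moreover have "\<one> \<oplus> \<alpha> \<noteq> \<one>" using s1 one2 a(2) by auto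
  moreover have "\<one> \<oplus> \<alpha> \<noteq> \<alpha>" using s2 self[OF \<alpha>] by auto
  ultimately have a2: "\<alpha> \<otimes> \<alpha> = \<one> \<oplus> \<alpha>" by auto
  have sums: "\<one> \<oplus> (\<one> \<oplus> \<alpha>) = \<alpha>" "\<alpha> \<oplus> (\<one> \<oplus> \<alpha>) = \<one>" "\<alpha> \<oplus> \<one> = \<one> \<oplus> \<alpha>"
    "(\<one> \<oplus> \<alpha>) \<oplus> \<one> = \<alpha>" "(\<one> \<oplus> \<alpha>) \<oplus> \<alpha> = \<one>"
    using s1 s2 a_comm[of \<alpha> "\<one> \<oplus> \<alpha>"] a_comm[of "\<one> \<oplus> \<alpha>" \<one>] a_comm[of \<alpha> \<one>] \<alpha> by simp_all
  show "f4_into F \<alpha> (x + y) = f4_into F \<alpha> x \<oplus> f4_into F \<alpha> y"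
    by (cases x; cases y) (use \<alpha> a2 sums self in \<open>simp_all add: f4_into_def zero_f4_def\<close>)
  show "f4_into F \<alpha> x = \<zero> \<longleftrightarrow> x = 0"
    using a nz by (cases x) (auto simp: f4_into_def zero_f4_def)
  show "f4_into F \<alpha> x \<in> carrier F" using \<alpha> by (cases x) (simp_all add: f4_into_def)
qed

definition f4_power_sum :: "expanded_poly list \<Rightarrow> 3 list \<Rightarrow> f4" where
  "f4_power_sum ps y = (\<Sum>p\<leftarrow>ps. alpha_pow (expanded_poly_eval p y))"

lemma power_sum_nonzero_iff:
  fixes F (structure)
  assumes F: "Ring.field F" "Coset.order F = 4" "primitive_element F \<alpha>"
  shows "power_sum F \<alpha> ps y \<noteq> \<zero> \<longleftrightarrow> f4_power_sum ps y \<noteq> 0"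
proof -
  interpret field F by fact
  note facts = field_4_facts[OF F]
  have pow: "\<alpha> [^] residue3 t = f4_into F \<alpha> (alpha_pow t)" for t
    by (rule three_cases[of t]) (use facts(1) in \<open>simp_all add: f4_into_def one_f4_def numeral_2_eq_2\<close>)
  have "(\<Oplus>i\<in>{..<n}. f4_into F \<alpha> (v i)) = f4_into F \<alpha> (\<Sum>i<n. v i)" for v and n :: nat
  proof (induction n)
    case 0
    then show ?case using facts(3)[of 0] by simp
  next
    case (Suc n)
    have "{..<Suc n} = insert n {..<n}" by auto
    then show ?case using Suc by (simp add: facts finsum_insert Pi_def)
  qed
  then have "power_sum F \<alpha> ps y = f4_into F \<alpha> (\<Sum>i<length ps. alpha_pow (expanded_poly_eval (ps ! i) y))"
    by (simp add: power_sum_def pow)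
  also have "(\<Sum>i<length ps. alpha_pow (expanded_poly_eval (ps ! i) y)) = f4_power_sum ps y"
    by (simp add: f4_power_sum_def sum_list_sum_nth atLeast0LessThan)
  finally show ?thesis by (simp add: facts)
qed

lemma of_nat_3_eq_0_iff: "(of_nat k :: 3) = 0 \<longleftrightarrow> 3 dvd k"
proof -
  have "(of_nat k :: 3) = of_nat (3 * (k div 3) + k mod 3)" by simp
  also have "\<dots> = of_nat (k mod 3)" by (simp only: of_nat_add of_nat_mult of_nat_numeral three_arith(14)) simp
  finally have *: "(of_nat k :: 3) = of_nat (k mod 3)" .
  have "k mod 3 = 0 \<or> k mod 3 = 1 \<or> k mod 3 = 2" by presburger
  then show ?thesis using * three_arith by (auto simp: dvd_eq_mod_eq_0)
qed

lemma of_nat_f4_eq: "(of_nat k :: f4) = (if odd k then 1 else 0)"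
  by (induction k) auto

lemma minus_one_power_3: "(- 1 :: 3) ^ k = (if even k then 1 else 2)"
  by (induction k) (auto simp: three_arith)

text \<open>For y in {1,-1} and b the corresponding bit, the product of the y to the e is 2 M + 2 modulo 3,
  where M is the output of the MOD 2 gate with input the sum of the e b.  A zero vector yields a
  gate with output 1.\<close>

definition term_gates :: "nat list \<times> 3 \<Rightarrow> (nat \<times> nat list) list" where
  "term_gates t = (let E = (0, fst t); Z = (0, map (\<lambda>_. 0) (fst t)) in
     if snd t = 1 then [E, E, Z, Z] else [E, Z])"

definition poly_gates :: "expanded_poly \<Rightarrow> (nat \<times> nat list) list" where
  "poly_gates p = concat (map term_gates p)"

text \<open>With s the power sum, the gates for p and q contribute to the final sum the traces of
  alpha to the 1 + p + 2 q, which add up to the trace of alpha times the cube of s.\<close>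

definition power_sum_to_circuit :: "nat \<times> expanded_poly list \<Rightarrow> cc232_circuit" where
  "power_sum_to_circuit x = (fst x, 0, concat (map (\<lambda>p. concat (map (\<lambda>q.
     [(1, poly_gates p @ poly_gates q @ poly_gates q), (0, [])]) (snd x))) (snd x)))"

definition bits_of_signs :: "3 list \<Rightarrow> nat list" where
  "bits_of_signs = map (\<lambda>z. if z = 1 then 0 else 1)"

lemma prod_signs:
  assumes "set y \<subseteq> {-1, 1}"
  shows "(\<Prod>i<length y. y ! i ^ (e ! i)) = (- 1 :: 3) ^ (\<Sum>m<length y. e ! m * bits_of_signs y ! m)"
proof -
  have "y ! i ^ (e ! i) = (-1) ^ (e ! i * bits_of_signs y ! i)" if "i < length y" for i
  proof -
    have "y ! i = -1 \<or> y ! i = 1" using assms that nth_mem by blast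
    then show ?thesis using that by (auto simp: bits_of_signs_def three_arith)
  qed
  then show ?thesis by (simp add: power_sum)
qed

abbreviation mod2_sum :: "nat \<Rightarrow> nat list \<Rightarrow> (nat \<times> nat list) list \<Rightarrow> nat" where
  "mod2_sum n y hs \<equiv> \<Sum>(c2, es)\<leftarrow>hs. MOD_gate 2 (c2 + (\<Sum>m<n. es ! m * y ! m))"

lemma sum_poly_gates:
  assumes "p \<in> expanded_polys n" "length y = n" "set y \<subseteq> {-1, 1}"
  shows "of_nat (mod2_sum n (bits_of_signs y) (poly_gates p))
    = expanded_poly_eval p y"
proof -
  have "of_nat (\<Sum>(c2, es)\<leftarrow>term_gates t. MOD_gate 2 (c2 + (\<Sum>m<n. es ! m * bits_of_signs y ! m)))
    = snd t * (\<Prod>i<length y. y ! i ^ (fst t ! i))" if "length (fst t) = n" "snd t \<noteq> 0" for t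
  proof -
    have z: "(\<Sum>m<n. map (\<lambda>_. 0) (fst t) ! m * bits_of_signs y ! m) = 0"
      using that(1) by simp
    show ?thesis
      using that(2) unfolding assms(2) prod_signs[OF assms(3), unfolded assms(2)] minus_one_power_3
      by (rule_tac three_cases[of "snd t"])
        (auto simp: term_gates_def Let_def MOD_gate_def z three_arith)
  qed
  moreover have "\<forall>t\<in>set p. length (fst t) = n \<and> snd t \<noteq> 0"
    using assms(1) by (auto simp: expanded_polys_def)
  ultimately show ?thesis
    by (induction p) (auto simp: poly_gates_def expanded_poly_eval_def split_beta)
qed

text \<open>x + x^2 is the trace from the field to Z_2; it is additive because squaring is.\<close>

lemma f4_trace_add: "(x + y) + (x + y) * (x + y) = (x + x * x) + (y + y * (y :: f4))"
  unfolding f4_frobenius_add by (simp add: add_ac)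

lemma f4_trace_sum_list: "(\<Sum>x\<leftarrow>xs. h x + h x * h x) = (\<Sum>x\<leftarrow>xs. h x) + (\<Sum>x\<leftarrow>xs. h x) * (\<Sum>x\<leftarrow>xs. h x :: f4)"
  by (induction xs) (auto simp: f4_trace_add)

lemma f4_frobenius_sum_list: "(\<Sum>x\<leftarrow>xs. h x * h x) = (\<Sum>x\<leftarrow>xs. h x) * (\<Sum>x\<leftarrow>xs. h x :: f4)"
  by (induction xs) (auto simp: f4_frobenius_add)

text \<open>The cube of s is 1 unless s = 0, and alpha has trace 1.\<close>

lemma f4_trace_cube: "(Fa * (s * (s * s))) + (Fa * (s * (s * s))) * (Fa * (s * (s * s))) = (if s = 0 then 0 else 1)"
  by (cases s) (simp_all add: f4_consts)

lemma sum_list_concat_map: "(\<Sum>x\<leftarrow>concat (map f xs). g x) = (\<Sum>x\<leftarrow>xs. \<Sum>y\<leftarrow>f x. (g y :: 'z :: monoid_add))"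
  by (induction xs) auto

lemma of_nat_sum_list: "of_nat (\<Sum>x\<leftarrow>xs. h x) = (\<Sum>x\<leftarrow>xs. of_nat (h x) :: 'z :: semiring_1)"
  by (induction xs) auto

lemma power_sum_to_circuit_eval:
  assumes ps: "set ps \<subseteq> expanded_polys n" and y: "length y = n" "set y \<subseteq> {-1, 1}"
  shows "cc232_eval (power_sum_to_circuit (n, ps)) (bits_of_signs y) \<noteq> 1 \<longleftrightarrow> f4_power_sum ps y \<noteq> 0"
proof -
  let ?P = "\<lambda>p. expanded_poly_eval p y"
  let ?g = "\<lambda>(c1, hs). MOD_gate 3 (c1 + mod2_sum n (bits_of_signs y) hs)"
  \<comment> \<open>The trace of alpha^t is 0 for t = 0 and 1 otherwise, that is, 1 plus the
    indicator of t = 0. The gate \<open>(0, [])\<close> has an empty sum and supplies the constant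
    1.\<close>
  let ?t = "\<lambda>p q. alpha_pow (1 + ?P p + (?P q + ?P q))"
  have "of_nat (?g (1, poly_gates p @ poly_gates q @ poly_gates q) + ?g (0, [])) =
      ?t p q + ?t p q * ?t p q" if "p \<in> set ps" "q \<in> set ps" for p q
  proof -
    note pq = sum_poly_gates[OF subsetD[OF ps that(1)] y] sum_poly_gates[OF subsetD[OF ps that(2)] y]
    have "?g (1, poly_gates p @ poly_gates q @ poly_gates q) = (if 1 + ?P p + (?P q + ?P q) = 0 then 1 else 0)"
      unfolding pq[symmetric] by (simp add: MOD_gate_def add.assoc flip: of_nat_3_eq_0_iff)
    moreover have "?t p q + ?t p q * ?t p q = 1 + (if 1 + ?P p + (?P q + ?P q) = 0 then 1 else 0)"
      unfolding alpha_pow_indicator[symmetric] alpha_pow_add[symmetric] by (simp add: add.assoc)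
    ultimately show ?thesis by (simp add: MOD_gate_def)
  qed
  then have inner: "of_nat (?g (1, poly_gates p @ poly_gates q @ poly_gates q) + ?g (0, [])) =
      ?t p q + ?t p q * ?t p q" if "p \<in> set ps" "q \<in> set ps" for p q
    using that by blast
  let ?S = "\<Sum>x\<leftarrow>snd (snd (power_sum_to_circuit (n, ps))). ?g x"
  have S: "?S = (\<Sum>p\<leftarrow>ps. \<Sum>q\<leftarrow>ps. ?g (1, poly_gates p @ poly_gates q @ poly_gates q) + ?g (0, []))"
    by (simp only: power_sum_to_circuit_def snd_conv sum_list_concat_map) simp
  have "(of_nat ?S :: f4) = (\<Sum>p\<leftarrow>ps. \<Sum>q\<leftarrow>ps. ?t p q + ?t p q * ?t p q)"
    unfolding S of_nat_sum_list using inner by (intro arg_cong[of _ _ sum_list] map_cong refl) auto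
  also have "\<dots> = (\<Sum>p\<leftarrow>ps. \<Sum>q\<leftarrow>ps. ?t p q) + (\<Sum>p\<leftarrow>ps. \<Sum>q\<leftarrow>ps. ?t p q) * (\<Sum>p\<leftarrow>ps. \<Sum>q\<leftarrow>ps. ?t p q)"
    by (simp only: f4_trace_sum_list)
  \<comment> \<open>The sum over p gives the power sum s; the sum over q, where exponents are
    doubled, gives s^2.\<close>
  also have "(\<Sum>p\<leftarrow>ps. \<Sum>q\<leftarrow>ps. ?t p q) = Fa * (f4_power_sum ps y * (f4_power_sum ps y * f4_power_sum ps y))"
    by (simp only: alpha_pow_add alpha_pow_simps(2) sum_list_const_mult sum_list_mult_const
        f4_frobenius_sum_list flip: f4_power_sum_def) (simp only: mult.assoc)
  finally have "(of_nat ?S :: f4) = (if f4_power_sum ps y = 0 then 0 else 1)"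
    by (simp only: f4_trace_cube)
  \<comment> \<open>A natural number seen in the field is its parity, which is what the top gate
    tests.\<close>
  then have "odd ?S \<longleftrightarrow> f4_power_sum ps y \<noteq> 0"
    by (simp add: of_nat_f4_eq split: if_splits)
  moreover have "cc232_eval (power_sum_to_circuit (n, ps)) (bits_of_signs y) = MOD_gate 2 ?S"
    by (simp add: power_sum_to_circuit_def)
  ultimately show ?thesis by (auto simp: MOD_gate_def)
qed

abbreviation f4_sum_nonzero :: "nat \<Rightarrow> expanded_poly list \<Rightarrow> bool" where
  "f4_sum_nonzero n ps \<equiv> \<exists>y. length y = n \<and> set y \<subseteq> {-1, 1} \<and> f4_power_sum ps y \<noteq> 0"

abbreviation circuit_not_one :: "cc232_circuit \<Rightarrow> bool" where
  "circuit_not_one C \<equiv> \<exists>y. length y = fst C \<and> set y \<subseteq> {0, 1} \<and> cc232_eval C y \<noteq> 1"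

lemma power_sum_to_circuit_correct:
  assumes "(n, ps) \<in> power_sum_inputs"
  shows "(f4_sum_nonzero n ps) \<longleftrightarrow>
    (circuit_not_one (power_sum_to_circuit (n, ps)))"
proof -
  have ps: "set ps \<subseteq> expanded_polys n" using assms by (simp add: power_sum_inputs_def)
  show ?thesis
  proof
    assume "f4_sum_nonzero n ps"
    then obtain y where y: "length y = n" "set y \<subseteq> {-1, 1}" "f4_power_sum ps y \<noteq> 0" by blast
    then have "cc232_eval (power_sum_to_circuit (n, ps)) (bits_of_signs y) \<noteq> 1"
      using power_sum_to_circuit_eval[OF ps y(1,2)] by simp
    moreover have "length (bits_of_signs y) = n" "set (bits_of_signs y) \<subseteq> {0, 1}"
      using y by (auto simp: bits_of_signs_def)
    moreover have "fst (power_sum_to_circuit (n, ps)) = n" by (simp add: power_sum_to_circuit_def)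
    ultimately show "circuit_not_one (power_sum_to_circuit (n, ps))" by metis
  next
    assume "circuit_not_one (power_sum_to_circuit (n, ps))"
    then obtain y where y: "length y = n" "set y \<subseteq> {0, 1}" "cc232_eval (power_sum_to_circuit (n, ps)) y \<noteq> 1"
      by (auto simp: power_sum_to_circuit_def)
    define z where "z = map (\<lambda>b. if b = 0 then 1 else -1 :: 3) y"
    have "bits_of_signs z = map (\<lambda>b. b) y"
      unfolding bits_of_signs_def z_def map_map using y(2) by (intro map_cong) (auto simp: three_arith)
    moreover have z: "length z = n" "set z \<subseteq> {-1, 1}" using y by (auto simp: z_def)
    ultimately show "f4_sum_nonzero n ps"
      using power_sum_to_circuit_eval[OF ps z] y(3) by auto
  qed
qed

lemma power_sum_to_circuit_input:
  assumes "x \<in> power_sum_inputs" shows "power_sum_to_circuit x \<in> cc232_circuits"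
proof -
  obtain n ps where x: "x = (n, ps)" "set ps \<subseteq> expanded_polys n"
    using assms by (auto simp: power_sum_inputs_def)
  then have "length es = n" if "p \<in> set ps" "(c, es) \<in> set (poly_gates p)" for p c es
    using that by (fastforce simp: expanded_polys_def poly_gates_def term_gates_def Let_def split: if_splits)
  then show ?thesis
    by (auto simp: cc232_circuits_def power_sum_to_circuit_def x(1))
qed

lemma ptime_power_sum_to_circuit: "ptime enc_power_sum enc_cc232 power_sum_to_circuit"
proof -
  have trm: "ptime e (enc_list (enc_pair enc_nat (enc_list enc_nat))) (\<lambda>x. term_gates (t x))"
    if t: "ptime e (enc_pair (enc_list enc_nat) enc3) t" for e :: "'x \<Rightarrow> bintree" and t
    unfolding term_gates_def Let_def
    by (rule ptime_eq[OF polytime_eq_3] ptime_rules t)+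
  have poly: "ptime e (enc_list (enc_pair enc_nat (enc_list enc_nat))) (\<lambda>x. poly_gates (p x))"
    if p: "ptime e enc_expanded_poly p" for e :: "'x \<Rightarrow> bintree" and p
    unfolding poly_gates_def
    by (rule trm ptime_rules p[unfolded enc_expanded_poly_def])+
  show ?thesis
    unfolding enc_power_sum_def enc_cc232_def power_sum_to_circuit_def
    by (rule poly ptime_rules)+
qed

section \<open>From circuits to restricted expressions\<close>

definition rot_mat :: "3 \<Rightarrow> bit mat" where
  "rot_mat t = fun_mat (\<lambda>x. alpha_pow t * x)"

lemma mat_fun_rot_mat [simp]: "mat_fun (rot_mat t) = (\<lambda>x. alpha_pow t * x)"
  by (rule ext) (simp add: rot_mat_def mat_fun_fun_mat)

lemma rot_mat_Units: "rot_mat t \<in> Units Mat2_Z2"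
  unfolding Units_Mat2_Z2 mat_fun_rot_mat by (simp add: rot_mat_def)

text \<open>A linear bijection conjugates multiplication by alpha to multiplication by alpha or by its inverse;
  \<open>orientation\<close> is the exponent.\<close>

definition orientation :: "(f4 \<Rightarrow> f4) \<Rightarrow> 3" where
  "orientation f = (if f Fa = Fa * f F1 then 1 else 2)"

text \<open>The six invertible additive maps are x \<mapsto> c x and x \<mapsto> c x^2 with c
  \<noteq> 0. The former commute with multiplication by alpha, the latter invert it; comparing the
  images of 1 and alpha tells them apart.\<close>

lemma orientation_mult:
  assumes "additive f" "inj f" shows "f (alpha_pow t * x) = alpha_pow (orientation f * t) * f x"
proof -
  have 0: "f F0 = F0" using additive_0[OF assms(1)] by (simp add: zero_f4_def)
  have b: "f Fb = f F1 + f Fa" using assms(1)[unfolded additive_def, rule_format, of F1 Fa] by simp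
  have "f F1 \<noteq> f F0" "f Fa \<noteq> f F0" "f F1 \<noteq> f Fa"
    by (simp_all add: inj_eq[OF assms(2)])
  then have ne: "f F1 \<noteq> F0" "f Fa \<noteq> F0" "f F1 \<noteq> f Fa"
    by (simp_all only: 0 not_False_eq_True)
  show ?thesis
    by (rule three_cases[of t]; cases x; cases "f F1"; cases "f Fa")
      (use ne in \<open>simp_all add: orientation_def 0 b three_arith(15) f4_consts\<close>)
qed

lemma orientation_cases: "orientation f = 1 \<or> orientation f = 2"
  by (simp only: orientation_def if_P if_not_P split: if_split) simp

definition word_orientation :: "(nat \<Rightarrow> f4 \<Rightarrow> f4) \<Rightarrow> nat list \<Rightarrow> 3" where
  "word_orientation b is = (\<Prod>i\<leftarrow>is. orientation (b i))"

lemma word_fun_vars_alpha: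
  assumes "\<And>i. additive (b i)" "\<And>i. inj (b i)"
  shows "word_fun h b (map Var is) (alpha_pow t * x) =
    alpha_pow (word_orientation b is * t) * word_fun h b (map Var is) x"
  by (induction "is" arbitrary: t x)
    (auto simp: word_orientation_def orientation_mult[OF assms] mult.assoc)

lemma word_fun_conj_rot:
  assumes "\<And>i. additive (b i)" "\<And>i. inj (b i)"
  shows "word_fun mat_fun b (conj_word (map Var is) [Const (rot_mat t)]) x =
    alpha_pow (word_orientation b is * t) * x"
proof -
  have "\<forall>l\<in>set (map Var is). inj (letter_fun mat_fun b l)" using assms(2) by auto
  from word_fun_inv_word(1)[OF this] show ?thesis
    by (simp add: conj_word_def word_fun_vars_alpha[OF assms])
qed

text \<open>Input m of a circuit with n inputs becomes the variable with index 2^(n-1-m) - 1, whose binary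
  representation is a list of n-1-m ones.\<close>

fun odd_vars :: "nat list \<Rightarrow> nat list" where
  "odd_vars [] = []"
| "odd_vars (e # es) = (if odd e then [2 ^ length es - 1] else []) @ odd_vars es"

fun encodes_signs :: "(nat \<Rightarrow> 3) \<Rightarrow> nat list \<Rightarrow> bool" where
  "encodes_signs s [] = True"
| "encodes_signs s (b # y) \<longleftrightarrow> s (2 ^ length y - 1) = (if b = 1 then -1 else 1) \<and> encodes_signs s y"

text \<open>An even multiplicity contributes an even power of a sign, which is 1, so only inputs
  with odd multiplicity need a variable in the word.\<close>

lemma prod_odd_vars:
  assumes "length es = length y" "set y \<subseteq> {0, 1}" "encodes_signs s y"
  shows "(\<Prod>i\<leftarrow>odd_vars es. s i) = (- 1) ^ (\<Sum>m<length y. es ! m * y ! m)"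
  using assms
proof (induction es y rule: list_induct2)
  case (Cons e es b y)
  have "(\<Sum>m<length (b # y). (e # es) ! m * (b # y) ! m) = e * b + (\<Sum>m<length y. es ! m * y ! m)"
    by (simp add: sum.lessThan_Suc_shift del: sum.lessThan_Suc)
  then show ?case
    using Cons by (auto simp: power_add minus_one_power_3 simp del: sum.lessThan_Suc)
qed simp

lemma ex_signs_decode:
  assumes "\<And>i. s i = 1 \<or> s i = (2 :: 3)"
  shows "\<exists>y. length y = n \<and> set y \<subseteq> {0, 1} \<and> encodes_signs s y"
proof (induction n)
  case (Suc n)
  then obtain y where "length y = n" "set y \<subseteq> {0, 1}" "encodes_signs s y" by blast
  then show ?case
    using assms[of "2 ^ n - 1"]
    by (intro exI[of _ "(if s (2 ^ n - 1) = 1 then 0 else 1) # y"]) (auto simp: three_arith)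
qed simp

text \<open>The entries of y are attached to indices 2^j - 1 with j < \<open>length y\<close>, hence
  to none with j = k.\<close>

lemma encodes_signs_upd: "length y \<le> k \<Longrightarrow> encodes_signs (s(2 ^ k - 1 := v)) y \<longleftrightarrow> encodes_signs s y"
proof (induction y)
  case (Cons b y)
  have "(2 :: nat) ^ length y < 2 ^ k" using Cons.prems by (intro power_strict_increasing) auto
  moreover have "(1 :: nat) \<le> 2 ^ length y" by simp
  ultimately have "(2 :: nat) ^ length y - 1 \<noteq> 2 ^ k - 1" by linarith
  then show ?case using Cons by simp
qed simp

lemma ex_signs_encode: "\<exists>s. (\<forall>i. s i = 1 \<or> s i = 2) \<and> encodes_signs s y"
proof (induction y)
  case (Cons b y)
  then obtain s where s: "\<forall>i. s i = 1 \<or> s i = 2" "encodes_signs s y" by blast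
  define s' where "s' = s(2 ^ length y - 1 := if b = 1 then -1 else 1)"
  have "encodes_signs s' y"
    using encodes_signs_upd[OF order_refl] s(2) by (simp only: s'_def)
  moreover have "\<forall>i. s' i = 1 \<or> s' i = 2"
    using s(1) by (auto simp: s'_def three_arith)
  moreover have "s' (2 ^ length y - 1) = (if b = 1 then -1 else 1)" by (simp add: s'_def)
  ultimately show ?case by (intro exI[of _ s'] conjI) (simp_all only: encodes_signs.simps simp_thms)
qed auto

text \<open>All pieces are multiplications by powers of alpha, so composing them adds exponents. The
  output of a MOD 2 gate with constant c and weighted sum S is 2 + 2 (-1)^(c+S) modulo 3. The plain
  rotation yields the first 2, the conjugated one the rest, as 2 (-1)^c is 1 for odd c and 2 for
  even c.\<close>

definition gate_word :: "nat \<times> (nat \<times> nat list) list \<Rightarrow> bit mat letter list" where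
  "gate_word g = Const (rot_mat (of_nat (fst g))) # concat (map (\<lambda>h. Const (rot_mat 2) #
     conj_word (map Var (odd_vars (snd h))) [Const (rot_mat (if odd (fst h) then 1 else 2))]) (snd g))"

text \<open>\<open>rot_mat 0\<close> is the unit matrix, written as a letter because monomials are
  nonempty. A gate with sum t contributes 1 + R + R^2, where R is multiplication by alpha^t.\<close>

definition circuit_to_restricted :: "cc232_circuit \<Rightarrow> bit mat letter list list" where
  "circuit_to_restricted C = (if odd (fst (snd C)) then [[Const (rot_mat 0)]] else []) @
     concat (map (\<lambda>g. [[Const (rot_mat 0)], gate_word g, gate_word g @ gate_word g]) (snd (snd C)))"

lemma circuit_to_restricted_input: "circuit_to_restricted C \<in> restricted_exprs Mat2_Z2"
proof -
  have vars: "map Var is \<in> words_over (Units Mat2_Z2)" for "is"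
    by (induction "is") auto
  have "gate_word g \<in> words_over (Units Mat2_Z2)" for g
    unfolding gate_word_def
    by (auto simp: rot_mat_Units intro!: words_over_concat words_over_conj_word vars)
  moreover have "gate_word g \<noteq> []" "[] \<noteq> gate_word g" for g by (simp_all add: gate_word_def)
  ultimately show ?thesis
    by (auto simp: restricted_exprs_def circuit_to_restricted_def rot_mat_Units split: if_splits)
qed

lemma word_fun_gate_word:
  assumes b: "\<And>i. additive (b i)" "\<And>i. inj (b i)"
    and y: "length y = n" "set y \<subseteq> {0, 1}" "encodes_signs (\<lambda>i. orientation (b i)) y"
    and hs: "\<forall>(c2, es)\<in>set hs. length es = n"
  shows "word_fun mat_fun b (gate_word (c1, hs)) x =
    alpha_pow (of_nat (c1 + mod2_sum n y hs)) * x"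
proof -
  have "word_fun mat_fun b (Const (rot_mat 2) # conj_word (map Var (odd_vars es))
      [Const (rot_mat (if odd c2 then 1 else 2))]) x
      = alpha_pow (of_nat (MOD_gate 2 (c2 + (\<Sum>m<n. es ! m * y ! m)))) * x"
    if "length es = n" for c2 es x
  proof -
    have o: "word_orientation b (odd_vars es) = (- 1) ^ (\<Sum>m<n. es ! m * y ! m)"
      unfolding word_orientation_def using prod_odd_vars[of es y "\<lambda>i. orientation (b i)"] y that by simp
    show ?thesis
      unfolding word_fun_simps word_fun_conj_rot[OF b] o minus_one_power_3 letter_fun.simps mat_fun_rot_mat
        mult.assoc[symmetric] alpha_pow_add[symmetric]
      by (rule arg_cong[of _ _ "\<lambda>t. alpha_pow t * x"]) (auto simp: MOD_gate_def three_arith)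
  qed
  then have "word_fun mat_fun b (concat (map (\<lambda>h. Const (rot_mat 2) # conj_word (map Var (odd_vars (snd h)))
      [Const (rot_mat (if odd (fst h) then 1 else 2))]) hs)) x =
    alpha_pow (of_nat (mod2_sum n y hs)) * x" for x
    using hs
  proof (induction hs)
    case (Cons h hs)
    obtain c2 es where h: "h = (c2, es)" by force
    from Cons show ?case
      by (simp only: h list.map concat.simps word_fun_append fst_conv snd_conv sum_list.Cons split_conv
          of_nat_add alpha_pow_add mult.assoc list.set insert_iff ball_simps) (simp add: mult.assoc)
  qed simp
  then show ?thesis
    by (simp add: gate_word_def alpha_pow_add mult.assoc)
qed

text \<open>The whole expression is the scalar 0 or 1 that is the parity of the sum entering the top
  gate, and this gate outputs 1 iff the sum is even.\<close>

lemma circuit_to_restricted_eval: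
  assumes b: "\<And>i. additive (b i)" "\<And>i. inj (b i)"
    and y: "length y = n" "set y \<subseteq> {0, 1}" "encodes_signs (\<lambda>i. orientation (b i)) y"
    and C: "(n, c0, gs) \<in> cc232_circuits"
  shows "(\<exists>x. (\<Sum>w\<leftarrow>circuit_to_restricted (n, c0, gs). word_fun mat_fun b w x) \<noteq> 0) \<longleftrightarrow>
    cc232_eval (n, c0, gs) y \<noteq> 1"
proof -
  let ?g = "\<lambda>(c1, hs). MOD_gate 3 (c1 + mod2_sum n y hs)"
  have gate: "x + (word_fun mat_fun b (gate_word g) x +
      word_fun mat_fun b (gate_word g) (word_fun mat_fun b (gate_word g) x)) = of_nat (?g g) * x"
    if "g \<in> set gs" for g x
  proof -
    obtain c1 hs where g: "g = (c1, hs)" by force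
    define k where "k = c1 + mod2_sum n y hs"
    have "\<forall>(c2, es)\<in>set hs. length es = n"
      using C that by (auto simp: cc232_circuits_def g)
    from word_fun_gate_word[OF b y this]
    have w: "word_fun mat_fun b (gate_word g) x = alpha_pow (of_nat k) * x" for x
      by (simp add: g k_def)
    have "x + (alpha_pow (of_nat k) * x + alpha_pow (of_nat k) * (alpha_pow (of_nat k) * x)) =
      (1 + alpha_pow (of_nat k) + alpha_pow (of_nat k + of_nat k)) * x"
      by (simp only: alpha_pow_add) (simp add: distrib_right mult.assoc add.assoc)
    also have "\<dots> = of_nat (?g g) * x"
      unfolding alpha_pow_indicator of_nat_3_eq_0_iff by (simp add: g MOD_gate_def k_def)
    finally show ?thesis unfolding w .
  qed
  have "(\<Sum>w\<leftarrow>concat (map (\<lambda>g. [[Const (rot_mat 0)], gate_word g, gate_word g @ gate_word g]) gs).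
      word_fun mat_fun b w x) = of_nat (\<Sum>g\<leftarrow>gs. ?g g) * x" for x
    using gate
  proof (induction gs)
    case (Cons g gs)
    have "(\<Sum>w\<leftarrow>concat (map (\<lambda>g. [[Const (rot_mat 0)], gate_word g, gate_word g @ gate_word g]) gs).
      word_fun mat_fun b w x) = of_nat (\<Sum>g\<leftarrow>gs. ?g g) * x"
      by (rule Cons.IH) (use Cons.prems in auto)
    moreover have "x + (word_fun mat_fun b (gate_word g) x +
      word_fun mat_fun b (gate_word g) (word_fun mat_fun b (gate_word g) x)) = of_nat (?g g) * x"
      by (rule Cons.prems) simp
    ultimately show ?case by (simp add: distrib_right add.assoc)
  qed simp
  then have "(\<Sum>w\<leftarrow>circuit_to_restricted (n, c0, gs). word_fun mat_fun b w x) =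
     of_nat (c0 + (\<Sum>g\<leftarrow>gs. ?g g)) * x" for x
    by (simp add: circuit_to_restricted_def of_nat_f4_eq[of c0] distrib_right)
  then show ?thesis
    by (auto simp: of_nat_f4_eq MOD_gate_def split: if_splits intro: exI[of _ 1])
qed

lemma inj_frobenius: "inj (\<lambda>x. x * x :: f4)"
proof (rule injI)
  fix x y :: f4 assume "x * x = y * y"
  then show "x = y" by (cases x; cases y) simp_all
qed

lemma additive_frobenius: "additive (\<lambda>x. x * x :: f4)"
  by (simp only: additive_def f4_frobenius_add) simp

lemma circuit_to_restricted_correct:
  assumes C: "C \<in> cc232_circuits"
  shows "(circuit_not_one C) \<longleftrightarrow>
    (\<exists>b. (\<forall>i. additive (b i) \<and> inj (b i)) \<and>
      (\<exists>x. (\<Sum>w\<leftarrow>circuit_to_restricted C. word_fun mat_fun b w x) \<noteq> 0))"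
proof -
  obtain n c0 gs where Ceq: "C = (n, c0, gs)" by (cases C) auto
  show ?thesis
  proof
    assume "circuit_not_one C"
    then obtain y where y: "length y = n" "set y \<subseteq> {0, 1}" "cc232_eval C y \<noteq> 1" by (auto simp: Ceq)
    obtain s where s: "\<forall>i. s i = 1 \<or> s i = 2" "encodes_signs s y" using ex_signs_encode by blast
    \<comment> \<open>The identity has orientation 1 and Frobenius has orientation -1, so every
      pattern of signs is realized.\<close>
    define b :: "nat \<Rightarrow> f4 \<Rightarrow> f4" where "b = (\<lambda>i. if s i = 1 then (\<lambda>x. x) else (\<lambda>x. x * x))"
    have "orientation (b i) = s i" for i
      using s(1)[rule_format, of i] by (auto simp: b_def orientation_def three_arith)
    then have es: "encodes_signs (\<lambda>i. orientation (b i)) y" using s(2) by simp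
    have b: "additive (b i)" "inj (b i)" for i
      by (simp_all add: b_def additive_frobenius inj_frobenius additive_def[of "\<lambda>x. x"])
    have "\<exists>x. (\<Sum>w\<leftarrow>circuit_to_restricted C. word_fun mat_fun b w x) \<noteq> 0"
      unfolding Ceq
      by (rule iffD2[OF circuit_to_restricted_eval[OF b y(1,2) es C[unfolded Ceq]] y(3)[unfolded Ceq]])
    with b show "\<exists>b. (\<forall>i. additive (b i) \<and> inj (b i)) \<and>
      (\<exists>x. (\<Sum>w\<leftarrow>circuit_to_restricted C. word_fun mat_fun b w x) \<noteq> 0)" by (intro exI[of _ b]) simp
  next
    assume "\<exists>b. (\<forall>i. additive (b i) \<and> inj (b i)) \<and>
      (\<exists>x. (\<Sum>w\<leftarrow>circuit_to_restricted C. word_fun mat_fun b w x) \<noteq> 0)"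
    then obtain b where b: "\<And>i. additive (b i)" "\<And>i. inj (b i)"
      "\<exists>x. (\<Sum>w\<leftarrow>circuit_to_restricted C. word_fun mat_fun b w x) \<noteq> 0" by blast
    \<comment> \<open>The input bits are read off the orientations; nothing else about the
      assignment enters the value.\<close>
    obtain y where y: "length y = n" "set y \<subseteq> {0, 1}" "encodes_signs (\<lambda>i. orientation (b i)) y"
      using ex_signs_decode[of "\<lambda>i. orientation (b i)" n] orientation_cases by blast
    have "cc232_eval C y \<noteq> 1"
      unfolding Ceq
      by (rule iffD1[OF circuit_to_restricted_eval[OF b(1,2) y C[unfolded Ceq]] b(3)[unfolded Ceq]])
    with y show "circuit_not_one C"
      by (intro exI[of _ y]) (simp add: Ceq)
  qed
qed

text \<open>The reason for the numbering of the variables: replacing every entry of a list by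
  \<open>True\<close> already yields the binary code of the index.\<close>

lemma bits_power_minus_1: "bits (2 ^ k - 1) = replicate k True"
proof (induction k)
  case (Suc k)
  obtain m where "(2 :: nat) ^ k = Suc m" by (cases "(2 :: nat) ^ k") auto
  then have "(2 :: nat) ^ Suc k - 1 = Suc (2 * (2 ^ k - 1))" by simp
  then show ?case using Suc by (simp only: bits_double_Suc) simp
qed simp

lemma ptime_odd_vars:
  assumes "ptime e (enc_list enc_nat) f"
  shows "ptime e (enc_list enc_nat) (\<lambda>x. odd_vars (f x))"
proof -
  have name: "ptime e enc_nat (\<lambda>x. 2 ^ length (g x) - 1)"
    if g: "ptime e (enc_list enc_nat) g" for e :: "'x \<Rightarrow> bintree" and g
  proof (rule ptime_of_bits)
    have "ptime e (enc_list enc_bool) (\<lambda>x. map (\<lambda>_. True) (g x))"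
      by (rule ptime_rules g)+
    then show "ptime e (enc_list enc_bool) (\<lambda>x. bits (2 ^ length (g x) - 1))"
      by (simp only: bits_power_minus_1 map_replicate_const)
  qed
  let ?h = "\<lambda>s. case s of [] \<Rightarrow> [] | e # es \<Rightarrow> if odd e then [2 ^ length es - 1] else []"
  have "odd_vars es = concat (map ?h (nonempty_suffixes es))" for es
    by (induction es) auto
  moreover have "ptime e (enc_list enc_nat) (\<lambda>x. concat (map ?h (nonempty_suffixes (f x))))"
    by (rule ptime_nonempty_suffixes name ptime_odd ptime_rules assms)+
  ultimately show ?thesis by simp
qed

lemma ptime_circuit_to_restricted:
  "ptime enc_cc232 (enc_list (enc_word enc_Mat2_Z2)) circuit_to_restricted"
proof -
  have rot: "ptime e enc_Mat2_Z2 (\<lambda>x. rot_mat (t x))" if "ptime e enc3 t" for e :: "'x \<Rightarrow> bintree" and t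
    by (rule ptime_comp[OF that], rule ptime_finite[OF finite_range_enc3])
      (simp add: inj_eq[OF inj_enc3])
  have gate: "ptime e (enc_list (enc_letter enc_Mat2_Z2)) (\<lambda>x. gate_word (g x))"
    if g: "ptime e (enc_pair enc_nat (enc_list (enc_pair enc_nat (enc_list enc_nat)))) g"
    for e :: "'x \<Rightarrow> bintree" and g
    unfolding gate_word_def
    by (rule g ptime_Const ptime_Var rot ptime_of_nat3 ptime_odd ptime_odd_vars
        ptime_conj_word ptime_rules)+
  show ?thesis
    unfolding enc_cc232_def enc_word_def circuit_to_restricted_def
    by (rule gate ptime_odd ptime_rules)+
qed

section \<open>From equations over the symmetric group to power sums\<close>

text \<open>Variables may be repeated in the list of a monomial, so multiplying is concatenation;
  exponent vectors are formed only at the very end, by \<open>expand\<close>.\<close>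

type_synonym sign_term = "nat list \<times> 3"
type_synonym sign_poly = "sign_term list"

definition signs :: "(nat \<Rightarrow> 3) \<Rightarrow> bool" where
  "signs z \<longleftrightarrow> (\<forall>v. z v = 1 \<or> z v = 2)"

definition term_val :: "(nat \<Rightarrow> 3) \<Rightarrow> sign_term \<Rightarrow> 3" where
  "term_val z t = snd t * (\<Prod>v\<leftarrow>fst t. z v)"

definition poly_val :: "(nat \<Rightarrow> 3) \<Rightarrow> sign_poly \<Rightarrow> 3" where
  "poly_val z p = (\<Sum>t\<leftarrow>p. term_val z t)"

definition alpha_sum :: "(nat \<Rightarrow> 3) \<Rightarrow> sign_poly list \<Rightarrow> f4" where
  "alpha_sum z ps = (\<Sum>p\<leftarrow>ps. alpha_pow (poly_val z p))"

definition term_mult :: "sign_term \<Rightarrow> sign_term \<Rightarrow> sign_term" where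
  "term_mult s t = (fst s @ fst t, snd s * snd t)"

lemma term_val_mult: "term_val z (term_mult s t) = term_val z s * term_val z t"
  by (simp add: term_val_def term_mult_def mult_ac)

lemma term_val_Nil: "term_val z ([], c) = c"
  by (simp add: term_val_def)

lemma poly_val_simps [simp]:
  "poly_val z [] = 0" "poly_val z (t # p) = term_val z t + poly_val z p" "poly_val z (p @ q) = poly_val z p + poly_val z q"
  by (simp_all add: poly_val_def)

lemma alpha_sum_simps [simp]:
  "alpha_sum z [] = 0" "alpha_sum z (p # ps) = alpha_pow (poly_val z p) + alpha_sum z ps"
  "alpha_sum z (ps @ qs) = alpha_sum z ps + alpha_sum z qs"
  by (simp_all add: alpha_sum_def)

text \<open>An atom (k, t) is the generator number k of the affine semilinear group of the field
  (multiplication by alpha, Frobenius, translation by 1), switched on iff the sign t is -1.\<close>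

type_synonym atom = "nat \<times> sign_term"

definition generator :: "nat \<Rightarrow> f4 \<Rightarrow> f4" where
  "generator k x = (if k = 0 then Fa * x else if k = 1 then x * x else x + 1)"

definition atom_fun :: "(nat \<Rightarrow> 3) \<Rightarrow> atom \<Rightarrow> f4 \<Rightarrow> f4" where
  "atom_fun z a x = (if term_val z (snd a) = 2 then generator (fst a) x else x)"

definition twist :: "3 \<Rightarrow> f4 \<Rightarrow> f4" where
  "twist s x = (if s = 1 then x else x * x)"

text \<open>The following functions expect the atoms in reverse order, so that a suffix of the list is
  a prefix of the word.\<close>

definition sign_part :: "atom list \<Rightarrow> sign_term" where
  "sign_part r = (concat (map (\<lambda>a. if fst a = 1 then fst (snd a) else []) r),
     foldr (\<lambda>a c. if fst a = 1 then snd (snd a) * c else c) r 1)"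

text \<open>A rotation switched by the sign t has exponent 2 + t, which modulo 3 is 0 for t = 1 and
  1 for t = -1. The letters applied after it raise it to their sign s, whence the terms 2 s and t
  s.\<close>

definition rotation_part :: "atom list \<Rightarrow> sign_poly" where
  "rotation_part r = concat (map (\<lambda>s. case s of [] \<Rightarrow> [] | a # q \<Rightarrow>
     if fst a = 0 then [term_mult ([], 2) (sign_part q), term_mult (snd a) (sign_part q)] else [])
     (nonempty_suffixes r))"

text \<open>A translation switched by the sign t is by alpha + alpha^t, which is 0 for t = 1 and 1
  for t = -1. Frobenius fixes these values, so of the letters applied later only the rotation part
  acts on them.\<close>

definition translation_part :: "atom list \<Rightarrow> sign_poly list" where
  "translation_part r = concat (map (\<lambda>s. case s of [] \<Rightarrow> [] | a # q \<Rightarrow>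
     if fst a = 2 then [rotation_part q @ [([], 1)], rotation_part q @ [snd a]] else [])
     (nonempty_suffixes r))"

lemma sign_part_simps:
  "sign_part [] = ([], 1)"
  "sign_part (a # r) = (if fst a = 1 then term_mult (snd a) (sign_part r) else sign_part r)"
  by (simp_all add: sign_part_def term_mult_def)

lemma rotation_part_simps:
  "rotation_part [] = []"
  "rotation_part (a # r) = (if fst a = 0 then [term_mult ([], 2) (sign_part r), term_mult (snd a) (sign_part r)]
     else []) @ rotation_part r"
  by (simp_all add: rotation_part_def)

lemma translation_part_simps:
  "translation_part [] = []"
  "translation_part (a # r) = (if fst a = 2 then [rotation_part r @ [([], 1)], rotation_part r @ [snd a]] else [])
     @ translation_part r"
  by (simp_all add: translation_part_def)

definition valid_atom :: "atom \<Rightarrow> bool" where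
  "valid_atom a \<longleftrightarrow> fst a \<le> 2 \<and> (snd (snd a) = 1 \<or> snd (snd a) = 2)"

lemma prod_signs_cases:
  assumes "signs z" shows "(\<Prod>v\<leftarrow>vs. z v) = 1 \<or> (\<Prod>v\<leftarrow>vs. z v) = 2"
proof (induction vs)
  case (Cons v vs)
  then show ?case using assms[unfolded signs_def, rule_format, of v] by (auto simp: three_arith)
qed simp

lemma term_val_cases:
  assumes "signs z" "snd t = 1 \<or> snd t = 2" shows "term_val z t = 1 \<or> term_val z t = 2"
  using assms(2) prod_signs_cases[OF assms(1), of "fst t"] by (auto simp: term_val_def three_arith)

lemma sign_part_cases:
  assumes "signs z" "\<forall>a\<in>set r. valid_atom a"
  shows "term_val z (sign_part r) = 1 \<or> term_val z (sign_part r) = 2"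
  using assms(2)
proof (induction r)
  case (Cons a r)
  then have "term_val z (snd a) = 1 \<or> term_val z (snd a) = 2"
    by (intro term_val_cases assms(1)) (simp add: valid_atom_def)
  with Cons show ?case by (auto simp: sign_part_simps term_val_mult three_arith)
qed (simp add: sign_part_simps term_val_Nil)

lemma twist_add: "twist s (x + y) = twist s x + twist s y"
  unfolding twist_def f4_frobenius_add by simp

text \<open>The induction adds the letter that is applied first. The semilinear map given by all the
  others acts on it, so what it contributes is expressed by the parts of the remaining list.\<close>

lemma fold_atom_fun:
  assumes z: "signs z" and "\<forall>a\<in>set r. valid_atom a"
  shows "fold (atom_fun z) r x = alpha_pow (poly_val z (rotation_part r)) * twist (term_val z (sign_part r)) x
    + alpha_sum z (translation_part r)"
  using assms(2)
proof (induction r arbitrary: x)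
  case Nil
  then show ?case
    by (simp add: sign_part_simps rotation_part_simps translation_part_simps term_val_Nil twist_def)
next
  case (Cons a r)
  define s where "s = term_val z (sign_part r)"
  define P where "P = poly_val z (rotation_part r)"
  define t where "t = term_val z (snd a)"
  have s: "s = 1 \<or> s = 2" unfolding s_def by (rule sign_part_cases) (use z Cons.prems in auto)
  have t: "t = 1 \<or> t = 2" unfolding t_def
    by (rule term_val_cases[OF z]) (use Cons.prems in \<open>simp add: valid_atom_def\<close>)
  have IH: "fold (atom_fun z) r y = alpha_pow P * twist s y + alpha_sum z (translation_part r)" for y
    using Cons by (simp add: s_def P_def)
  have k: "fst a = 0 \<or> fst a = 1 \<or> fst a = 2" using Cons.prems by (auto simp: valid_atom_def)
  have atom: "atom_fun z a x = (if t = 2 then generator (fst a) x else x)"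
    by (simp add: atom_fun_def t_def)
  have fold: "fold (atom_fun z) (a # r) x = alpha_pow P * twist s (atom_fun z a x) + alpha_sum z (translation_part r)"
    by (simp add: IH)
  from k show ?case
  proof (elim disjE)
    assume a: "fst a = 0"
    have "twist s (Fa * x) = alpha_pow s * twist s x"
      using s by (cases x) (auto simp: twist_def f4_consts)
    then have "twist s (atom_fun z a x) = alpha_pow (if t = 2 then s else 0) * twist s x"
      using a by (simp add: atom generator_def)
    moreover have "2 * s + t * s = (if t = 2 then s else 0)"
      using s t by (auto simp: three_arith)
    then have "poly_val z (rotation_part (a # r)) = P + (if t = 2 then s else 0)"
      using a by (simp add: rotation_part_simps term_val_mult term_val_Nil s_def[symmetric] P_def[symmetric]
          t_def[symmetric] add.assoc[symmetric] add.commute[of P])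
    moreover have "sign_part (a # r) = sign_part r" "translation_part (a # r) = translation_part r"
      using a by (simp_all add: sign_part_simps translation_part_simps)
    ultimately show ?thesis
      unfolding fold by (simp only: alpha_pow_add mult.assoc s_def[symmetric])
  next
    assume a: "fst a = 1"
    have "twist s (x * x) = twist (2 * s) x"
      using s by (cases x) (auto simp: twist_def three_arith f4_consts)
    then have "twist s (atom_fun z a x) = twist (t * s) x"
      using a t by (auto simp: atom generator_def)
    moreover have "term_val z (sign_part (a # r)) = t * s"
      using a by (simp add: sign_part_simps term_val_mult s_def t_def)
    moreover have "rotation_part (a # r) = rotation_part r" "translation_part (a # r) = translation_part r"
      using a by (simp_all add: rotation_part_simps translation_part_simps)
    ultimately show ?thesis
      unfolding fold by (simp only: P_def[symmetric])
  next
    assume a: "fst a = 2"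
    have "alpha_pow (P + 1) + alpha_pow (P + t) = (if t = 2 then alpha_pow P else 0)"
    proof -
      have "alpha_pow 1 + alpha_pow t = (if t = 2 then 1 else 0)"
        using t by (auto simp: f4_consts)
      then show ?thesis by (simp only: alpha_pow_add distrib_left[symmetric]) simp
    qed
    then have "alpha_sum z (translation_part (a # r)) =
        (if t = 2 then alpha_pow P else 0) + alpha_sum z (translation_part r)"
      using a by (simp add: translation_part_simps P_def t_def term_val_Nil add.assoc[symmetric])
    moreover have "twist s 1 = 1" by (simp add: twist_def)
    then have "twist s (atom_fun z a x) = twist s x + (if t = 2 then 1 else 0)"
      using a by (simp add: atom generator_def twist_add)
    moreover have "sign_part (a # r) = sign_part r" "rotation_part (a # r) = rotation_part r"
      using a by (simp_all add: sign_part_simps rotation_part_simps)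
    ultimately show ?thesis
      unfolding fold by (simp add: s_def[symmetric] P_def[symmetric] distrib_left add.assoc)
  qed
qed

text \<open>The product of these atoms is x \<open>\<mapsto>\<close> b0 + alpha b1 + alpha^(b2 + b3) x (or x^2 in place of x, if b4),
  with bi = 1 iff ti has value -1; every permutation of the field is of this form.\<close>

definition affine_atoms ::
    "sign_term \<Rightarrow> sign_term \<Rightarrow> sign_term \<Rightarrow> sign_term \<Rightarrow> sign_term \<Rightarrow> atom list" where
  "affine_atoms t0 t1 t2 t3 t4 =
     [(2, t0), (0, ([], 2)), (2, t1), (0, ([], 2)), (0, ([], 2)), (0, t2), (0, t3), (1, t4)]"

definition affine_fun :: "(nat \<Rightarrow> bool) \<Rightarrow> f4 \<Rightarrow> f4" where
  "affine_fun s x = of_bool (s 0) + Fa * of_bool (s 1) +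
     alpha_pow (of_bool (s 2) + of_bool (s 3)) * (if s 4 then x * x else x)"

lemma foldr_affine_atoms:
  "foldr (atom_fun z) (affine_atoms (t 0) (t 1) (t 2) (t 3) (t 4)) x =
    affine_fun (\<lambda>j. term_val z (t (j :: nat)) = 2) x"
proof -
  let ?s = "\<lambda>j. term_val z (t j) = 2"
  have atoms: "atom_fun z (2, u) y = y + of_bool (term_val z u = 2)"
    "atom_fun z (1, u) y = (if term_val z u = 2 then y * y else y)"
    "atom_fun z (0, u) y = alpha_pow (of_bool (term_val z u = 2)) * y"
    "atom_fun z (0, ([], 2)) y = Fa * y" for u y
    by (auto simp: atom_fun_def generator_def term_val_Nil)
  \<comment> \<open>The three rotations that are always on surround the second translation, one on
    the left and two on the right. As alpha^3 = 1, they turn it from a translation by 1 into one by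
    alpha.\<close>
  have cube: "Fa * (Fa * (Fa * y)) = y" for y :: f4 by (cases y) simp_all
  have "Fa * (Fa * (Fa * (c * (d * y))) + v) + u = u + Fa * v + (c * d) * y" for c d y u v
    unfolding distrib_left cube by (simp only: add_ac mult.assoc)
  then show ?thesis
    by (simp only: affine_atoms_def foldr.simps comp_apply id_apply atoms(4), simp only: atoms affine_fun_def
        alpha_pow_add)
qed

lemma inj_affine_fun: "inj (affine_fun s)"
proof (rule injI)
  fix x y :: f4
  have *: "x * x = y * y \<Longrightarrow> x = y" by (cases x; cases y) simp_all
  assume "affine_fun s x = affine_fun s y"
  then have "alpha_pow (of_bool (s 2) + of_bool (s 3)) * ((if s 4 then x * x else x) + (if s 4 then y * y else y)) = 0"
    unfolding affine_fun_def distrib_left by (simp add: f4_add_eq_0_iff)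
  then show "x = y" using * by (auto simp: f4_add_eq_0_iff split: if_splits)
qed

text \<open>The linear part L is determined by L 1 = alpha^k and its orientation o, since L
  (alpha^t) = alpha^k alpha^(o t); for o = 2 the last factor is the square of alpha^t.\<close>

lemma ex_affine_fun:
  assumes "inj f" shows "\<exists>s. f = affine_fun s"
proof -
  define L where "L = lin f"
  have L: "additive L" "inj L" using additive_lin[OF assms] inj_lin[OF assms] by (simp_all add: L_def)
  have L0: "L 0 = 0" by (rule additive_0[OF L(1)])
  obtain k where k: "L 1 = alpha_pow k"
    using f4_nonzero_cases[of "L 1"] L0 injD[OF L(2), of 1 0] by auto
  \<comment> \<open>The first two switches are the coordinates of \<open>f 0\<close> in the basis 1,
    alpha; the next two add up to k, and a single one would not reach k = 2; the last one switches
    Frobenius on.\<close>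
  define s where "s = (\<lambda>j::nat. if j = 0 then f 0 = F1 \<or> f 0 = Fb else if j = 1 then f 0 = Fa \<or> f 0 = Fb
    else if j = 2 then k \<noteq> 0 else if j = 3 then k = 2 else orientation L = 2)"
  have s_simps: "s 0 = (f 0 = F1 \<or> f 0 = Fb)" "s 1 = (f 0 = Fa \<or> f 0 = Fb)" "s 2 = (k \<noteq> 0)" "s 3 = (k = 2)"
    "s 4 = (orientation L = 2)" by (simp_all add: s_def)
  have "of_bool (c = F1 \<or> c = Fb) + Fa * of_bool (c = Fa \<or> c = Fb) = c" for c
    by (cases c) (simp_all add: f4_consts)
  then have f0: "of_bool (s 0) + Fa * of_bool (s 1) = f 0" by (simp only: s_simps)
  have k': "of_bool (s 2) + of_bool (s 3) = k"
    unfolding s_simps by (rule three_cases[of k]) (simp_all add: three_arith)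
  have Lx: "L x = alpha_pow k * (if s 4 then x * x else x)" for x
  proof (cases "x = 0")
    case False
    then obtain t where t: "x = alpha_pow t" using f4_nonzero_cases by blast
    have "L x = alpha_pow (orientation L * t) * alpha_pow k"
      using orientation_mult[OF L, of t 1] by (simp add: t k)
    also have "\<dots> = alpha_pow k * alpha_pow (orientation L * t)" by (rule mult.commute)
    also have "alpha_pow (orientation L * t) = (if s 4 then x * x else x)"
    proof (cases "orientation L = 2")
      case True
      then have "alpha_pow (orientation L * t) = x * x" by (simp only: t mult_2 alpha_pow_add)
      with True show ?thesis by (simp add: s_simps)
    next
      case False
      then have "orientation L = 1" using orientation_cases[of L] by blast
      then have "alpha_pow (orientation L * t) = x" by (simp only: t mult_1_left)
      with False show ?thesis by (simp add: s_simps)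
    qed
    finally show ?thesis .
  qed (simp add: L0)
  have "f x = affine_fun s x" for x
    unfolding affine_fun_def f0 k' Lx[symmetric] by (simp add: L_def lin_def add.commute[of _ "f 0"])
  then have "f = affine_fun s" by (rule ext)
  then show ?thesis by (rule exI[of _ s])
qed

definition sign_term_of_bool :: "bool \<Rightarrow> sign_term" where
  "sign_term_of_bool b = ([], if b then 2 else 1)"

definition affine_perm_atoms :: "(nat \<Rightarrow> nat) \<Rightarrow> atom list" where
  "affine_perm_atoms p = (let s = (SOME s. perm_fun p = affine_fun s) in
     affine_atoms (sign_term_of_bool (s 0)) (sign_term_of_bool (s 1)) (sign_term_of_bool (s 2))
       (sign_term_of_bool (s 3)) (sign_term_of_bool (s 4)))"

text \<open>The detour through \<open>inv_into\<close> makes this a function of the code of the permutation with finite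
  support, hence computable by table lookup.\<close>

definition perm_atoms :: "(nat \<Rightarrow> nat) \<Rightarrow> atom list" where
  "perm_atoms p = (if enc_S4 p \<in> enc_S4 ` carrier (sym_group 4)
     then affine_perm_atoms (inv_into (carrier (sym_group 4)) enc_S4 (enc_S4 p)) else [])"

text \<open>The variable i gets the signs numbered 8 i, ..., 8 i + 4. The factor 8 is a power of 2,
  so that the indices are computed by doubling and incrementing.\<close>

definition var_atoms :: "nat \<Rightarrow> atom list" where
  "var_atoms i = affine_atoms ([2 * (2 * (2 * i))], 1) ([Suc (2 * (2 * (2 * i)))], 1)
     ([2 * Suc (2 * (2 * i))], 1) ([Suc (2 * Suc (2 * (2 * i)))], 1) ([2 * (2 * Suc (2 * i))], 1)"

definition letter_atoms :: "(nat \<Rightarrow> nat) letter \<Rightarrow> atom list" where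
  "letter_atoms l = (case l of Const p \<Rightarrow> perm_atoms p | Var i \<Rightarrow> var_atoms i)"

definition var_signs :: "(nat \<Rightarrow> 3) \<Rightarrow> nat \<Rightarrow> nat \<Rightarrow> bool" where
  "var_signs z i j \<longleftrightarrow> z (8 * i + j) = 2"

lemma foldr_perm_atoms:
  assumes "p \<in> carrier (sym_group 4)" shows "foldr (atom_fun z) (perm_atoms p) x = perm_fun p x"
proof -
  define s where "s = (SOME s. perm_fun p = affine_fun s)"
  have "inj (perm_fun p)" using assms by (intro inj_perm_fun) (simp add: sym_group_def)
  from someI_ex[OF ex_affine_fun[OF this]] have s: "perm_fun p = affine_fun s" by (simp add: s_def)
  have "perm_atoms p = affine_perm_atoms p"
    using assms by (simp add: perm_atoms_def inv_into_f_f[OF inj_on_enc_S4])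
  also have "\<dots> = affine_atoms (sign_term_of_bool (s 0)) (sign_term_of_bool (s 1)) (sign_term_of_bool (s 2))
      (sign_term_of_bool (s 3)) (sign_term_of_bool (s 4))"
    by (simp only: affine_perm_atoms_def Let_def s_def)
  finally have "foldr (atom_fun z) (perm_atoms p) x = affine_fun (\<lambda>j. term_val z (sign_term_of_bool (s j)) = 2) x"
    using foldr_affine_atoms[of z "\<lambda>j. sign_term_of_bool (s j)" x] by (simp only:)
  moreover have "term_val z (sign_term_of_bool b) = 2 \<longleftrightarrow> b" for b
    by (simp add: sign_term_of_bool_def term_val_Nil)
  ultimately show ?thesis by (simp only: s)
qed

lemma foldr_var_atoms: "foldr (atom_fun z) (var_atoms i) x = affine_fun (var_signs z i) x"
proof -
  have "var_atoms i = affine_atoms ([8 * i + 0], 1) ([8 * i + 1], 1) ([8 * i + 2], 1) ([8 * i + 3], 1) ([8 * i + 4], 1)"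
  proof -
    have "2 * (2 * (2 * i)) = 8 * i + 0" "Suc (2 * (2 * (2 * i))) = 8 * i + 1" "2 * Suc (2 * (2 * i)) = 8 * i + 2"
      "Suc (2 * Suc (2 * (2 * i))) = 8 * i + 3" "2 * (2 * Suc (2 * i)) = 8 * i + 4"
      by simp_all
    then show ?thesis by (simp only: var_atoms_def)
  qed
  then have "foldr (atom_fun z) (var_atoms i) x = affine_fun (\<lambda>j. term_val z ([8 * i + j], 1) = 2) x"
    using foldr_affine_atoms[of z "\<lambda>j. ([8 * i + j], 1)" x] by (simp only:)
  then show ?thesis by (simp add: term_val_def var_signs_def[abs_def])
qed

lemma valid_affine_atoms:
  "\<forall>t\<in>{t0, t1, t2, t3, t4}. snd t = 1 \<or> snd t = 2 \<Longrightarrow> \<forall>a\<in>set (affine_atoms t0 t1 t2 t3 t4). valid_atom a"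
  by (auto simp: affine_atoms_def valid_atom_def)

lemma valid_letter_atoms: "\<forall>a\<in>set (letter_atoms l). valid_atom a"
proof (cases l)
  case (Const p)
  have "\<forall>a\<in>set (affine_perm_atoms q). valid_atom a" for q
    unfolding affine_perm_atoms_def Let_def by (rule valid_affine_atoms) (auto simp: sign_term_of_bool_def)
  moreover have "perm_atoms p = [] \<or> (\<exists>q. perm_atoms p = affine_perm_atoms q)"
    by (auto simp: perm_atoms_def)
  ultimately have "\<forall>a\<in>set (perm_atoms p). valid_atom a"
    by (metis empty_iff list.set(1))
  then show ?thesis by (simp only: Const letter_atoms_def letter.case)
next
  case (Var i)
  then show ?thesis
    unfolding letter_atoms_def Var letter.case var_atoms_def by (intro valid_affine_atoms) auto
qed

definition word_atoms :: "(nat \<Rightarrow> nat) letter list \<Rightarrow> atom list" where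
  "word_atoms w = rev (concat (map letter_atoms w))"

lemma word_fun_eq_fold_atoms:
  assumes "S4_word w"
  shows "S4_fun (\<lambda>i. affine_fun (var_signs z i)) w x = fold (atom_fun z) (word_atoms w) x"
proof -
  have "foldr (atom_fun z) (concat (map letter_atoms w)) x = S4_fun (\<lambda>i. affine_fun (var_signs z i)) w x"
    using assms
  proof (induction w)
    case (Cons l w)
    then show ?case
      by (cases l) (auto simp: letter_atoms_def foldr_perm_atoms foldr_var_atoms)
  qed simp
  then show ?thesis by (simp add: word_atoms_def foldr_conv_fold)
qed

section \<open>Sums of powers of alpha that indicate zeros and the identity\<close>

definition products :: "sign_poly list \<Rightarrow> sign_poly list \<Rightarrow> sign_poly list" where
  "products ps qs = concat (map (\<lambda>p. map (\<lambda>q. p @ q) qs) ps)"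

lemma alpha_sum_products: "alpha_sum z (products ps qs) = alpha_sum z ps * alpha_sum z qs"
proof (induction ps)
  case (Cons p ps)
  have "alpha_sum z (map (\<lambda>q. p @ q) qs) = alpha_pow (poly_val z p) * alpha_sum z qs"
    by (induction qs) (simp_all add: alpha_pow_add distrib_left)
  with Cons show ?case by (simp add: products_def distrib_right)
qed (simp add: products_def)

definition zero_indicator :: "sign_poly \<Rightarrow> sign_poly list" where
  "zero_indicator p = [[], p, p @ p]"

lemma alpha_sum_zero_indicator: "alpha_sum z (zero_indicator p) = (if poly_val z p = 0 then 1 else 0)"
  using alpha_pow_indicator[of "poly_val z p"] by (simp add: zero_indicator_def add.assoc)

text \<open>This is 1 + s^3 for the sum s, as s^3 = 1 unless s = 0. Doubling all exponents squares a
  sum, so the cube takes one product.\<close>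

definition sum_zero_indicator :: "sign_poly list \<Rightarrow> sign_poly list" where
  "sum_zero_indicator ps = [] # products ps (map (\<lambda>p. p @ p) ps)"

lemma alpha_sum_sum_zero_indicator:
  "alpha_sum z (sum_zero_indicator ps) = (if alpha_sum z ps = 0 then 1 else 0)"
proof -
  have "alpha_sum z (map (\<lambda>p. p @ p) ps) = alpha_sum z ps * alpha_sum z ps"
  proof (induction ps)
    case (Cons p ps)
    then show ?case
      by (simp only: list.map alpha_sum_simps poly_val_simps alpha_pow_add f4_frobenius_add)
  qed simp
  moreover have "1 + s * (s * s) = (if s = 0 then 1 else 0)" for s :: f4
    by (cases s) (simp_all add: f4_consts)
  ultimately show ?thesis by (simp add: sum_zero_indicator_def alpha_sum_products)
qed

text \<open>The number of products is fixed, so the size remains polynomial when they are multiplied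
  out. Adding 2 to the sign means subtracting 1, which gives 0 iff the sign is 1.\<close>

definition identity_indicator :: "atom list \<Rightarrow> sign_poly list" where
  "identity_indicator r = products (sum_zero_indicator (translation_part r))
     (products (zero_indicator (rotation_part r)) (zero_indicator [sign_part r, ([], 2)]))"

lemma alpha_sum_identity_indicator:
  assumes "signs z" "\<forall>a\<in>set r. valid_atom a"
  shows "alpha_sum z (identity_indicator r) \<noteq> 0 \<longleftrightarrow> (\<forall>x. fold (atom_fun z) r x = x)"
proof -
  define T where "T = alpha_sum z (translation_part r)"
  define P where "P = poly_val z (rotation_part r)"
  define s where "s = term_val z (sign_part r)"
  have s: "s = 1 \<or> s = 2" unfolding s_def by (rule sign_part_cases[OF assms])
  have "(\<forall>x. alpha_pow P * twist s x + T = x) \<longleftrightarrow> T = 0 \<and> P = 0 \<and> s = 1"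
  proof
    \<comment> \<open>The value at 0 gives T, the value at 1 gives P, and the value at alpha, which
      Frobenius moves, gives s.\<close>
    assume *: "\<forall>x. alpha_pow P * twist s x + T = x"
    have "twist s 0 = 0" "twist s 1 = 1" by (simp_all add: twist_def)
    with *[rule_format, of 0] *[rule_format, of 1] have T: "T = 0" and P: "P = 0"
      by (simp_all add: alpha_pow_eq_1_iff)
    with T *[rule_format, of Fa] s show "T = 0 \<and> P = 0 \<and> s = 1" by (auto simp: twist_def)
  qed (simp add: twist_def)
  moreover have "s + 2 = 0 \<longleftrightarrow> s = 1" using s by (auto simp: three_arith)
  ultimately show ?thesis
    unfolding fold_atom_fun[OF assms] identity_indicator_def alpha_sum_products alpha_sum_sum_zero_indicator
      alpha_sum_zero_indicator
    by (simp add: T_def[symmetric] P_def[symmetric] s_def[symmetric] term_val_Nil)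
qed

section \<open>Expanded form of polynomials in signs\<close>

definition sign_vars :: "sign_poly list \<Rightarrow> nat list" where
  "sign_vars ps = remdups (0 # concat (map (\<lambda>p. concat (map fst p)) ps))"

definition coefficient :: "expanded_poly \<Rightarrow> nat list \<Rightarrow> 3" where
  "coefficient q e = foldr (\<lambda>t c. if fst t = e then snd t + c else c) q 0"

text \<open>Concatenation produces repeated monomials and coefficients that cancel, whereas an
  expanded polynomial has distinct exponent vectors and nonzero coefficients.\<close>

definition collect_terms :: "expanded_poly \<Rightarrow> expanded_poly" where
  "collect_terms q = filter (\<lambda>t. snd t \<noteq> 0) (map (\<lambda>e. (e, coefficient q e)) (remdups (map fst q)))"

text \<open>The square of a sign is 1, so the parity of a multiplicity can serve as the
  exponent.\<close>

abbreviation parities :: "nat list \<Rightarrow> nat list \<Rightarrow> nat list" where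
  "parities vs m \<equiv> map (\<lambda>v. of_bool (odd (count_list m v))) vs"

definition expand :: "nat list \<Rightarrow> sign_poly \<Rightarrow> expanded_poly" where
  "expand vs p = collect_terms (map (\<lambda>t. (parities vs (fst t), snd t)) p)"

definition expand_all :: "sign_poly list \<Rightarrow> nat \<times> expanded_poly list" where
  "expand_all ps = (length (sign_vars ps), map (expand (sign_vars ps)) ps)"

lemma sum_coefficient:
  assumes "finite S" "fst ` set q \<subseteq> S"
  shows "(\<Sum>e\<in>S. coefficient q e * h e) = (\<Sum>t\<leftarrow>q. snd t * h (fst t))"
  using assms(2)
proof (induction q)
  case (Cons t q)
  have "(\<Sum>e\<in>S. coefficient (t # q) e * h e) = (\<Sum>e\<in>S. (if fst t = e then snd t * h e else 0) + coefficient q e * h e)"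
    by (rule sum.cong) (auto simp: coefficient_def distrib_right)
  also have "\<dots> = snd t * h (fst t) + (\<Sum>e\<in>S. coefficient q e * h e)"
    using assms(1) Cons.prems by (simp add: sum.distrib)
  finally show ?case using Cons by simp
qed (simp add: coefficient_def)

lemma sum_collect_terms: "(\<Sum>t\<leftarrow>collect_terms q. snd t * h (fst t)) = (\<Sum>t\<leftarrow>q. snd t * h (fst t))"
proof -
  have "(\<Sum>t\<leftarrow>filter (\<lambda>t. snd t \<noteq> 0) ts. snd t * h (fst t)) = (\<Sum>t\<leftarrow>ts. snd t * h (fst t))" for ts :: expanded_poly
    by (induction ts) auto
  then have "(\<Sum>t\<leftarrow>collect_terms q. snd t * h (fst t)) = (\<Sum>e\<leftarrow>remdups (map fst q). coefficient q e * h e)"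
    by (simp add: collect_terms_def comp_def)
  also have "\<dots> = (\<Sum>e\<in>set (remdups (map fst q)). coefficient q e * h e)"
    by (rule sum.distinct_set_conv_list[symmetric]) simp
  also have "\<dots> = (\<Sum>t\<leftarrow>q. snd t * h (fst t))"
    by (rule sum_coefficient) auto
  finally show ?thesis .
qed

lemma prod_parity:
  assumes "signs z" "finite V" "set m \<subseteq> V"
  shows "(\<Prod>v\<in>V. z v ^ of_bool (odd (count_list m v))) = (\<Prod>v\<leftarrow>m. z v)"
  using assms(3)
proof (induction m)
  case (Cons w m)
  have "z v ^ of_bool (odd (count_list (w # m) v)) = (if w = v then z v else 1) * z v ^ of_bool (odd (count_list m v))" for v
    using assms(1)[unfolded signs_def, rule_format, of v] by (auto simp: three_arith)
  then have "(\<Prod>v\<in>V. z v ^ of_bool (odd (count_list (w # m) v))) = z w * (\<Prod>v\<in>V. z v ^ of_bool (odd (count_list m v)))"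
    using assms(2) Cons.prems by (simp add: prod.distrib)
  with Cons show ?case by simp
qed simp

lemma expanded_poly_eval_expand:
  assumes "signs z" "distinct vs" "\<forall>t\<in>set p. set (fst t) \<subseteq> set vs"
  shows "expanded_poly_eval (expand vs p) (map z vs) = poly_val z p"
proof -
  let ?h = "\<lambda>e. \<Prod>i<length vs. map z vs ! i ^ (e ! i)"
  have "?h (parities vs m) = (\<Prod>v\<leftarrow>m. z v)" if "set m \<subseteq> set vs" for m
  proof -
    have "?h (parities vs m) =
      (\<Prod>i\<in>{0..<length vs}. map (\<lambda>v. z v ^ of_bool (odd (count_list m v))) vs ! i)"
      unfolding atLeast0LessThan by (rule prod.cong) simp_all
    also have "\<dots> = (\<Prod>v\<leftarrow>vs. z v ^ of_bool (odd (count_list m v)))"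
      using prod.list_conv_set_nth[of "map (\<lambda>v. z v ^ of_bool (odd (count_list m v))) vs"] by simp
    also have "\<dots> = (\<Prod>v\<in>set vs. z v ^ of_bool (odd (count_list m v)))"
      by (rule prod.distinct_set_conv_list[OF assms(2), symmetric])
    also have "\<dots> = (\<Prod>v\<leftarrow>m. z v)" by (rule prod_parity[OF assms(1) _ that]) simp
    finally show ?thesis .
  qed
  then have "(\<Sum>t\<leftarrow>p. snd t * ?h (parities vs (fst t))) = poly_val z p"
    unfolding poly_val_def term_val_def using assms(3) by (intro arg_cong[of _ _ sum_list] map_cong) auto
  then show ?thesis
    using sum_collect_terms[of ?h "map (\<lambda>t. (parities vs (fst t), snd t)) p"]
    by (simp add: expanded_poly_eval_def expand_def case_prod_unfold comp_def)
qed

lemma distinct_sign_vars: "distinct (sign_vars ps)"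
  by (simp add: sign_vars_def)

lemma set_sign_vars: "p \<in> set ps \<Longrightarrow> t \<in> set p \<Longrightarrow> set (fst t) \<subseteq> set (sign_vars ps)"
  by (fastforce simp: sign_vars_def)

lemma expand_all_input:
  assumes "ps \<noteq> []" shows "expand_all ps \<in> power_sum_inputs"
proof -
  \<comment> \<open>The variable 0 is always listed, so that the number of variables is
    positive.\<close>
  have "length (sign_vars ps) \<ge> 1"
    by (cases "sign_vars ps") (auto simp: sign_vars_def split: if_splits)
  moreover have "expand vs p \<in> expanded_polys (length vs)" for vs p
    unfolding expanded_polys_def expand_def collect_terms_def
    by (auto intro!: distinct_map_filter simp: comp_def)
  ultimately show ?thesis
    using assms by (auto simp: power_sum_inputs_def expand_all_def)
qed

lemma expand_all_correct:
  "(\<exists>y. length y = fst (expand_all ps) \<and> set y \<subseteq> {-1, 1} \<and> f4_power_sum (snd (expand_all ps)) y \<noteq> 0) \<longleftrightarrow>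
   (\<exists>z. signs z \<and> alpha_sum z ps \<noteq> 0)"
proof -
  let ?vs = "sign_vars ps"
  have eval: "f4_power_sum (snd (expand_all ps)) (map z ?vs) = alpha_sum z ps" if "signs z" for z
  proof -
    have "expanded_poly_eval (expand ?vs p) (map z ?vs) = poly_val z p" if "p \<in> set ps" for p
      by (rule expanded_poly_eval_expand[OF \<open>signs z\<close> distinct_sign_vars]) (use set_sign_vars[OF that] in blast)
    then show ?thesis
      unfolding f4_power_sum_def expand_all_def alpha_sum_def snd_conv map_map comp_def
      by (intro arg_cong[of _ _ sum_list] map_cong) auto
  qed
  show ?thesis
  proof
    assume "\<exists>z. signs z \<and> alpha_sum z ps \<noteq> 0"
    then obtain z where z: "signs z" "alpha_sum z ps \<noteq> 0" by blast
    have "set (map z ?vs) \<subseteq> {-1, 1}" using z(1) by (auto simp: signs_def three_arith)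
    then show "\<exists>y. length y = fst (expand_all ps) \<and> set y \<subseteq> {-1, 1} \<and> f4_power_sum (snd (expand_all ps)) y \<noteq> 0"
      using eval[OF z(1)] z(2) by (intro exI[of _ "map z ?vs"]) (simp add: expand_all_def)
  next
    assume "\<exists>y. length y = fst (expand_all ps) \<and> set y \<subseteq> {-1, 1} \<and> f4_power_sum (snd (expand_all ps)) y \<noteq> 0"
    then obtain y where y: "length y = length ?vs" "set y \<subseteq> {-1, 1}" "f4_power_sum (snd (expand_all ps)) y \<noteq> 0"
      by (auto simp: expand_all_def)
    define z where "z v = (case map_of (zip ?vs y) v of None \<Rightarrow> 1 | Some c \<Rightarrow> c)" for v
    have "map z ?vs = y"
      using y(1) distinct_sign_vars[of ps] by (intro nth_equalityI) (simp_all add: z_def map_of_zip_nth)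
    moreover have "signs z"
      unfolding signs_def
    proof
      fix v show "z v = 1 \<or> z v = 2"
        using y(2) by (auto simp: z_def three_arith split: option.splits dest!: map_of_SomeD set_zip_rightD)
    qed
    ultimately show "\<exists>z. signs z \<and> alpha_sum z ps \<noteq> 0" using eval y(3) by metis
  qed
qed

definition PolSat_to_power_sum :: "(nat \<Rightarrow> nat) letter list \<Rightarrow> nat \<times> expanded_poly list" where
  "PolSat_to_power_sum w = expand_all (identity_indicator (word_atoms w))"

lemma PolSat_to_power_sum_input: "PolSat_to_power_sum w \<in> power_sum_inputs"
  unfolding PolSat_to_power_sum_def
  by (rule expand_all_input) (simp add: identity_indicator_def products_def sum_zero_indicator_def zero_indicator_def)

lemma affine_fun_cong: "(\<And>j. j < 8 \<Longrightarrow> s j = s' j) \<Longrightarrow> affine_fun s = affine_fun s'"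
  by (rule ext) (simp add: affine_fun_def)

lemma PolSat_to_power_sum_correct:
  assumes w: "S4_word w"
  shows "(S4_solvable w) \<longleftrightarrow>
    (\<exists>y. length y = fst (PolSat_to_power_sum w) \<and> set y \<subseteq> {-1, 1} \<and>
      f4_power_sum (snd (PolSat_to_power_sum w)) y \<noteq> 0)"
proof -
  have "(S4_solvable w) \<longleftrightarrow>
    (\<exists>z. signs z \<and> (\<forall>x. S4_fun (\<lambda>i. affine_fun (var_signs z i)) w x = x))"
  proof
    assume "S4_solvable w"
    then obtain b where b: "\<forall>i. inj (b i)" "\<forall>x. S4_fun b w x = x" by blast
    have "\<forall>i. \<exists>s. b i = affine_fun s" using b(1) ex_affine_fun by blast
    then obtain s where s: "\<And>i. b i = affine_fun (s i)" by metis
    \<comment> \<open>For v = 8 i + j, the sign numbered v is the switch j of the variable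
      i.\<close>
    define z :: "nat \<Rightarrow> 3" where "z v = (if s (v div 8) (v mod 8) then 2 else 1)" for v
    have "signs z" by (simp add: signs_def z_def)
    moreover have "(\<lambda>i. affine_fun (var_signs z i)) = b"
      unfolding s by (rule ext, rule affine_fun_cong) (simp add: var_signs_def z_def)
    ultimately show "\<exists>z. signs z \<and> (\<forall>x. S4_fun (\<lambda>i. affine_fun (var_signs z i)) w x = x)"
      using b(2) by auto
  next
    assume "\<exists>z. signs z \<and> (\<forall>x. S4_fun (\<lambda>i. affine_fun (var_signs z i)) w x = x)"
    then show "S4_solvable w"
      using inj_affine_fun by meson
  qed
  also have "\<dots> \<longleftrightarrow> (\<exists>z. signs z \<and> alpha_sum z (identity_indicator (word_atoms w)) \<noteq> 0)"
  proof -
    have "\<forall>a\<in>set (word_atoms w). valid_atom a" using valid_letter_atoms by (auto simp: word_atoms_def)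
    from alpha_sum_identity_indicator[OF _ this] show ?thesis
      unfolding word_fun_eq_fold_atoms[OF w] by blast
  qed
  also have "\<dots> \<longleftrightarrow> (\<exists>y. length y = fst (PolSat_to_power_sum w) \<and> set y \<subseteq> {-1, 1} \<and>
      f4_power_sum (snd (PolSat_to_power_sum w)) y \<noteq> 0)"
    unfolding PolSat_to_power_sum_def expand_all_correct ..
  finally show ?thesis .
qed

section \<open>Running time of the reduction to power sums\<close>

abbreviation enc_sign_term :: "sign_term \<Rightarrow> bintree" where
  "enc_sign_term \<equiv> enc_pair (enc_list enc_nat) enc3"

abbreviation enc_sign_poly :: "sign_poly \<Rightarrow> bintree" where
  "enc_sign_poly \<equiv> enc_list enc_sign_term"

abbreviation enc_atom :: "atom \<Rightarrow> bintree" where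
  "enc_atom \<equiv> enc_pair enc_nat enc_sign_term"

lemma ptime_letter_atoms:
  assumes "ptime e (enc_letter enc_S4) f" shows "ptime e (enc_list enc_atom) (\<lambda>x. letter_atoms (f x))"
proof -
  have "finite (enc_S4 ` carrier (sym_group 4))" by (simp add: sym_group_def finite_permutations)
  from ptime_lookup[OF this]
  have perm: "ptime enc_S4 (enc_list enc_atom) perm_atoms"
    unfolding perm_atoms_def .
  have var: "ptime e (enc_list enc_atom) (\<lambda>x. var_atoms (i x))" if i: "ptime e enc_nat i"
    for e :: "'x \<Rightarrow> bintree" and i
    unfolding var_atoms_def affine_atoms_def
    by (rule ptime_const ptime_double ptime_double_Suc i ptime_rules)+
  show ?thesis
    unfolding letter_atoms_def
    by (rule assms ptime_case_letter ptime_comp[OF _ perm] var ptime_rules)+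
qed

lemma ptime_sign_part:
  assumes "ptime e (enc_list enc_atom) f" shows "ptime e enc_sign_term (\<lambda>x. sign_part (f x))"
  unfolding sign_part_def
  by (rule assms ptime_foldr_finite finite_range_enc3 ptime_arith3 ptime_eq[OF polytime_eq_nat]
      ptime_rules)+

lemma ptime_term_mult:
  assumes "ptime e enc_sign_term f" "ptime e enc_sign_term g"
  shows "ptime e enc_sign_term (\<lambda>x. term_mult (f x) (g x))"
  unfolding term_mult_def by (rule assms ptime_arith3 ptime_rules)+

lemma ptime_rotation_part:
  assumes "ptime e (enc_list enc_atom) f" shows "ptime e enc_sign_poly (\<lambda>x. rotation_part (f x))"
  unfolding rotation_part_def
  by (rule assms ptime_nonempty_suffixes ptime_sign_part ptime_term_mult
      ptime_eq[OF polytime_eq_nat] ptime_rules)+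

lemma ptime_translation_part:
  assumes "ptime e (enc_list enc_atom) f"
  shows "ptime e (enc_list enc_sign_poly) (\<lambda>x. translation_part (f x))"
  unfolding translation_part_def
  by (rule assms ptime_nonempty_suffixes ptime_rotation_part
      ptime_eq[OF polytime_eq_nat] ptime_rules)+

lemma ptime_products:
  assumes "ptime e (enc_list enc_sign_poly) f" "ptime e (enc_list enc_sign_poly) g"
  shows "ptime e (enc_list enc_sign_poly) (\<lambda>x. products (f x) (g x))"
  unfolding products_def
  by (rule assms ptime_comp[OF _ assms(2)] ptime_rules)+

lemma ptime_identity_indicator:
  assumes "ptime e (enc_list enc_atom) f"
  shows "ptime e (enc_list enc_sign_poly) (\<lambda>x. identity_indicator (f x))"
  unfolding identity_indicator_def sum_zero_indicator_def zero_indicator_def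
  by (rule assms ptime_products ptime_translation_part ptime_rotation_part
      ptime_sign_part ptime_rules)+

lemma ptime_expand_all: "ptime (enc_list enc_sign_poly) enc_power_sum expand_all"
proof -
  have vars: "ptime e (enc_list enc_nat) (\<lambda>x. sign_vars (f x))"
    if f: "ptime e (enc_list enc_sign_poly) f" for e :: "'x \<Rightarrow> bintree" and f
    unfolding sign_vars_def
    by (rule ptime_remdups[OF polytime_eq_nat] f ptime_rules)+
  have coeff: "ptime e enc3 (\<lambda>x. coefficient (f x) (g x))"
    if f: "ptime e enc_sign_poly f" and g: "ptime e (enc_list enc_nat) g"
    for e :: "'x \<Rightarrow> bintree" and f g
    unfolding coefficient_def
    by (rule f ptime_comp[OF _ g] ptime_foldr_finite finite_range_enc3 ptime_arith3
        ptime_eq[OF polytime_eq_list[OF polytime_eq_nat]] ptime_rules)+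
  have collect: "ptime e enc_sign_poly (\<lambda>x. collect_terms (f x))"
    if f: "ptime e enc_sign_poly f" for e :: "'x \<Rightarrow> bintree" and f
    unfolding collect_terms_def
    by (rule f ptime_comp[OF _ f] coeff ptime_filter
        ptime_remdups[OF polytime_eq_list[OF polytime_eq_nat]]
        ptime_eq[OF polytime_eq_3] ptime_rules)+
  have expand: "ptime (enc_pair enc_sign_poly (enc_list enc_sign_poly)) enc_sign_poly
      (\<lambda>p. expand (sign_vars (snd p)) (fst p))"
    unfolding expand_def
    by (rule collect vars ptime_of_bool ptime_odd_count[OF polytime_eq_nat] ptime_rules)+
  show ?thesis
    unfolding enc_power_sum_def enc_expanded_poly_def expand_all_def
    by (rule expand vars ptime_length ptime_rules)+
qed

lemma ptime_PolSat_to_power_sum: "ptime (enc_word enc_S4) enc_power_sum PolSat_to_power_sum"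
  unfolding enc_word_def PolSat_to_power_sum_def word_atoms_def
  by (rule ptime_comp[OF _ ptime_expand_all])
    (rule ptime_identity_indicator ptime_letter_atoms ptime_rules)+

section \<open>The cycle of reductions\<close>

text \<open>This compares problems on data instead of trees: the program of \<open>ptime\<close>
  works on all codes, correctness is asked on inputs, and injectivity makes a yes-code the same as
  the code of a yes-input.\<close>

definition encoded_reducible ::
    "('a \<Rightarrow> bintree) \<Rightarrow> 'a set \<Rightarrow> ('a \<Rightarrow> bool) \<Rightarrow> ('b \<Rightarrow> bintree) \<Rightarrow> 'b set \<Rightarrow> ('b \<Rightarrow> bool) \<Rightarrow> bool" where
  "encoded_reducible e I A e' J B \<longleftrightarrow>
    inj_on e I \<and> inj_on e' J \<and> (\<exists>f. ptime e e' f \<and> (\<forall>x\<in>I. f x \<in> J \<and> (A x \<longleftrightarrow> B (f x))))"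

lemma encoded_reducible_trans:
  assumes "encoded_reducible e I A e' J B" "encoded_reducible e' J B e'' K C"
  shows "encoded_reducible e I A e'' K C"
proof -
  obtain f where f: "ptime e e' f" "\<forall>x\<in>I. f x \<in> J \<and> (A x \<longleftrightarrow> B (f x))"
    using assms(1) unfolding encoded_reducible_def by blast
  obtain g where g: "ptime e' e'' g" "\<forall>x\<in>J. g x \<in> K \<and> (B x \<longleftrightarrow> C (g x))"
    using assms(2) unfolding encoded_reducible_def by blast
  have "\<forall>x\<in>I. g (f x) \<in> K \<and> (A x \<longleftrightarrow> C (g (f x)))" using f(2) g(2) by blast
  with ptime_comp[OF f(1) g(1)] assms show ?thesis
    unfolding encoded_reducible_def by (intro conjI exI[of _ "\<lambda>x. g (f x)"]) simp_all
qed

lemma encoded_reducible_imp_polytime_reducible: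
  assumes "encoded_reducible e I A e' J B"
  shows "polytime_reducible (encoded_problem e I A) (encoded_problem e' J B)"
proof -
  obtain f where inj: "inj_on e I" "inj_on e' J" and f: "ptime e e' f"
    and AB: "\<And>x. x \<in> I \<Longrightarrow> f x \<in> J" "\<And>x. x \<in> I \<Longrightarrow> A x \<longleftrightarrow> B (f x)"
    using assms unfolding encoded_reducible_def by blast
  \<comment> \<open>\<open>inv_into\<close> serves only to specify P on trees. No decoding is ever
    executed, because the program for f maps codes to codes.\<close>
  define P where "P d = e' (f (inv_into I e d))" for d
  have P: "P (e x) = e' (f x)" if "x \<in> I" for x using that inj(1) by (simp add: P_def)
  obtain c m and q :: "nat poly" where c: "\<And>(s :: store) x. s 0 = e x \<Longrightarrow>
     runs c s (e' (f x)) m (poly q (size (e x)))"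
    using f unfolding ptime_def by blast
  have "polytime_on (e ` I) P"
    unfolding polytime_on_def
  proof (intro exI[of _ c] exI[of _ q] ballI)
    fix d assume "d \<in> e ` I"
    then obtain x where x: "x \<in> I" "d = e x" by auto
    then show "\<exists>t s. exec c (init_store d) t s \<and> s 0 = P d \<and> t \<le> poly q (size d)"
      using c[of "init_store d" x] P[OF x(1)] by (auto simp: init_store_def)
  qed
  moreover have "P (e x) \<in> e' ` J" "e x \<in> e ` {x \<in> I. A x} \<longleftrightarrow> P (e x) \<in> e' ` {y \<in> J. B y}" if "x \<in> I" for x
    using that inj AB P by (auto dest: inj_onD)
  ultimately show ?thesis
    unfolding polytime_reducible_def encoded_problem_def by (intro exI[of _ P]) auto
qed

theorem theorem1p1:
  fixes F :: "('f, 'm) ring_scheme" and \<alpha> :: 'f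
  assumes "Ring.field F" and "Coset.order F = 4" and "primitive_element F \<alpha>"
  shows "pairwise polytime_equivalent
    {coPolEqv (sym_group 4) enc_S4,
     PolSat (sym_group 4) enc_S4,
     PowerSumNonzero F \<alpha>,
     CC232NotOne,
     RestrictedNonzero Mat2_Z2 enc_Mat2_Z2}"
proof -
  define A1 where "A1 w \<longleftrightarrow> (\<exists>a \<in> UNIV \<rightarrow> carrier (sym_group 4). \<exists>g \<in> carrier (sym_group 4) - {\<one>\<^bsub>sym_group 4\<^esub>}.
      word_eval (sym_group 4) a w = g)" for w
  define A2 where "A2 w \<longleftrightarrow> (\<exists>a \<in> UNIV \<rightarrow> carrier (sym_group 4). word_eval (sym_group 4) a w = \<one>\<^bsub>sym_group 4\<^esub>)" for w
  define A3 where "A3 = (\<lambda>(n, ps). \<exists>y. length y = n \<and> set y \<subseteq> {-1, 1} \<and> power_sum F \<alpha> ps y \<noteq> \<zero>\<^bsub>F\<^esub>)"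
  define A4 where "A4 C \<longleftrightarrow> (circuit_not_one C)" for C
  define A5 where "A5 f \<longleftrightarrow> (\<exists>a \<in> UNIV \<rightarrow> Units Mat2_Z2. restricted_eval Mat2_Z2 a f \<noteq> \<zero>\<^bsub>Mat2_Z2\<^esub>)" for f
  let ?W = "words_over (carrier (sym_group 4))" and ?e = "enc_word enc_S4"
    and ?R = "restricted_exprs Mat2_Z2" and ?r = "enc_list (enc_word enc_Mat2_Z2)"
  have inj: "inj_on ?e ?W" "inj_on enc_power_sum power_sum_inputs" "inj_on enc_cc232 cc232_circuits"
    "inj_on ?r ?R"
    using inj_on_enc_word[OF inj_on_enc_S4] inj_on_subset[OF inj_enc_power_sum] inj_on_subset[OF inj_enc_cc232]
      inj_on_enc_restricted[OF inj_on_enc_Mat2_Z2] by auto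
  have A3: "A3 x \<longleftrightarrow> (\<exists>y. length y = fst x \<and> set y \<subseteq> {-1, 1} \<and> f4_power_sum (snd x) y \<noteq> 0)" for x
    by (simp add: A3_def case_prod_unfold power_sum_nonzero_iff[OF assms])
  have r12: "encoded_reducible ?e ?W A1 ?e ?W A2"
    unfolding encoded_reducible_def
  proof (intro conjI inj exI[of _ coPolEqv_to_PolSat] ptime_coPolEqv_to_PolSat ballI)
    fix w assume w: "S4_word w"
    then show "S4_word (coPolEqv_to_PolSat w)" by (rule S4_word_coPolEqv_to_PolSat)
    from coPolEqv_S4_iff[OF w] coPolEqv_to_PolSat_correct[OF w] PolSat_S4_iff[OF this]
    show "A1 w \<longleftrightarrow> A2 (coPolEqv_to_PolSat w)" by (simp only: A1_def A2_def)
  qed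
  have r23: "encoded_reducible ?e ?W A2 enc_power_sum power_sum_inputs A3"
    unfolding encoded_reducible_def
  proof (intro conjI inj exI[of _ PolSat_to_power_sum] ptime_PolSat_to_power_sum ballI
      PolSat_to_power_sum_input)
    fix w assume w: "S4_word w"
    show "A2 w \<longleftrightarrow> A3 (PolSat_to_power_sum w)"
      unfolding A3 A2_def PolSat_S4_iff[OF w] by (rule PolSat_to_power_sum_correct[OF w])
  qed
  have r34: "encoded_reducible enc_power_sum power_sum_inputs A3 enc_cc232 cc232_circuits A4"
    unfolding encoded_reducible_def
  proof (intro conjI inj exI[of _ power_sum_to_circuit] ptime_power_sum_to_circuit ballI
      power_sum_to_circuit_input)
    fix x assume x: "x \<in> power_sum_inputs"
    show "A3 x \<longleftrightarrow> A4 (power_sum_to_circuit x)"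
      using power_sum_to_circuit_correct[of "fst x" "snd x"] x by (simp add: A3 A4_def)
  qed
  have r45: "encoded_reducible enc_cc232 cc232_circuits A4 ?r ?R A5"
    unfolding encoded_reducible_def
  proof (intro conjI inj exI[of _ circuit_to_restricted] ptime_circuit_to_restricted ballI
      circuit_to_restricted_input)
    fix C assume C: "C \<in> cc232_circuits"
    show "A4 C \<longleftrightarrow> A5 (circuit_to_restricted C)"
      unfolding A4_def A5_def RestrictedNonzero_Mat2_iff[OF circuit_to_restricted_input]
      by (rule circuit_to_restricted_correct[OF C])
  qed
  have r51: "encoded_reducible ?r ?R A5 ?e ?W A1"
    unfolding encoded_reducible_def
  proof (intro conjI inj exI[of _ restricted_to_S4] ptime_restricted_to_S4 ballI
      S4_word_restricted_to_S4)
    fix f assume f: "f \<in> ?R"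
    show "A5 f \<longleftrightarrow> A1 (restricted_to_S4 f)"
      unfolding A5_def A1_def RestrictedNonzero_Mat2_iff[OF f]
        coPolEqv_S4_iff[OF S4_word_restricted_to_S4[OF f]]
      by (rule restricted_to_S4_correct[OF f])
  qed
  \<comment> \<open>Composition along the cycle yields the other 15 of the 20 ordered pairs.\<close>
  note r13 = encoded_reducible_trans[OF r12 r23]
  note r14 = encoded_reducible_trans[OF r13 r34]
  note r15 = encoded_reducible_trans[OF r14 r45]
  note r24 = encoded_reducible_trans[OF r23 r34]
  note r25 = encoded_reducible_trans[OF r24 r45]
  note r21 = encoded_reducible_trans[OF r25 r51]
  note r35 = encoded_reducible_trans[OF r34 r45]
  note r31 = encoded_reducible_trans[OF r35 r51]
  note r32 = encoded_reducible_trans[OF r31 r12]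
  note r41 = encoded_reducible_trans[OF r45 r51]
  note r42 = encoded_reducible_trans[OF r41 r12]
  note r43 = encoded_reducible_trans[OF r42 r23]
  note r52 = encoded_reducible_trans[OF r51 r12]
  note r53 = encoded_reducible_trans[OF r52 r23]
  note r54 = encoded_reducible_trans[OF r53 r34]
  have problems: "coPolEqv (sym_group 4) enc_S4 = encoded_problem ?e ?W A1"
    "PolSat (sym_group 4) enc_S4 = encoded_problem ?e ?W A2"
    "PowerSumNonzero F \<alpha> = encoded_problem enc_power_sum power_sum_inputs A3"
    "CC232NotOne = encoded_problem enc_cc232 cc232_circuits A4"
    "RestrictedNonzero Mat2_Z2 enc_Mat2_Z2 = encoded_problem ?r ?R A5"
    by (simp_all add: coPolEqv_def PolSat_def PowerSumNonzero_def CC232NotOne_def RestrictedNonzero_def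
        A1_def[abs_def] A2_def[abs_def] A3_def A4_def[abs_def] A5_def[abs_def])
  note reductions = r12 r13 r14 r15 r21 r23 r24 r25 r31 r32 r34 r35 r41 r42 r43 r45 r51 r52 r53 r54
  show ?thesis
    unfolding problems pairwise_insert polytime_equivalent_def
    by (auto simp: reductions[THEN encoded_reducible_imp_polytime_reducible])
qed

end
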